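(* For every uniformity $r \ge 2$ and every residue class $k \not\equiv 0 \pmod r$ such that $r/\gcd(r,k)$ is odd, there is an integer $L$ such that for every $\ell > L$ with $\ell \equiv k \pmod r$, we have $\gamma(\mathcal{C}_\ell^r) \le 1/3$.
   Context: An $r$-graph is an $r$-uniform hypergraph. For $\ell > r \ge 2$, the tight $r$-uniform cycle $\mathcal{C}_\ell^r$ of length $\ell$ is the $r$-graph with vertex set $\{0,1,\ldots,\ell-1\}$ and edge set $\{\{i,i+1,\ldots,i+r-1\} : 0 \le i < \ell\}$, with addition modulo $\ell$. For an $r$-graph $\mathcal{H}$, its minimum codegree $\delta_{r-1}(\mathcal{H})$ is the minimum, over all $(r-1)$-subsets $S$ of vertices, of the number of edges containing $S$. For a family $\mathcal{F}$ of $r$-graphs, $\mathrm{ex}_{r-1}(n,\mathcal{F})$ is the maximum of $\delta_{r-1}(\mathcal{H})$ over all $n$-vertex $r$-graphs $\mathcal{H}$ containing no member of $\mathcal{F}$ as a subgraph, and the codegree Turán density is $\gamma(\mathcal{F}) = \lim_{n\to\infty} \mathrm{ex}_{r-1}(n,\mathcal{F})/n$ (this limit exists); $\gamma(\mathcal{H}) := \gamma(\{\mathcal{H}\})$. *)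

theory Defs
  imports Complex_Main "HOL-Number_Theory.Cong"
begin

type_synonym 'a hypergraph = "'a set \<times> 'a set set"

abbreviation verts :: "'a hypergraph \<Rightarrow> 'a set" where "verts \<equiv> fst"
abbreviation edges :: "'a hypergraph \<Rightarrow> 'a set set" where "edges \<equiv> snd"

definition r_graph :: "nat \<Rightarrow> 'a hypergraph \<Rightarrow> bool" where
  "r_graph r H \<longleftrightarrow> finite (verts H) \<and> (\<forall>e \<in> edges H. e \<subseteq> verts H \<and> card e = r)"

definition tight_cycle :: "nat \<Rightarrow> nat \<Rightarrow> nat hypergraph" where
  "tight_cycle r l = ({..<l}, {{(i + j) mod l | j. j < r} | i. i < l})"

text \<open>Not necessarily induced, up to isomorphism.\<close>

definition contains_subgraph :: "'a hypergraph \<Rightarrow> 'b hypergraph \<Rightarrow> bool" where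
  "contains_subgraph H F \<longleftrightarrow>
     (\<exists>f. inj_on f (verts F) \<and> f ` verts F \<subseteq> verts H \<and> (\<forall>e \<in> edges F. f ` e \<in> edges H))"

text \<open>Meaningful if \<open>H\<close> has at least \<open>r - 1\<close> vertices; otherwise the minimum ranges over the
  empty set. This affects only finitely many \<open>n\<close> in the density below.\<close>

definition min_codegree :: "nat \<Rightarrow> 'a hypergraph \<Rightarrow> nat" where
  "min_codegree r H =
     Min {card {e \<in> edges H. S \<subseteq> e} | S. S \<subseteq> verts H \<and> card S = r - 1}"

text \<open>Up to isomorphism, every finite hypergraph has its vertices in \<^typ>\<open>nat\<close>.\<close>

definition codegree_ex :: "nat \<Rightarrow> nat \<Rightarrow> 'b hypergraph set \<Rightarrow> nat" where
  "codegree_ex r n \<F> =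
     Max {min_codegree r H | H :: nat hypergraph.
            r_graph r H \<and> card (verts H) = n \<and> (\<forall>F \<in> \<F>. \<not> contains_subgraph H F)}"

definition codegree_density_family :: "nat \<Rightarrow> 'b hypergraph set \<Rightarrow> real" where
  "codegree_density_family r \<F> = lim (\<lambda>n. real (codegree_ex r n \<F>) / real n)"

definition codegree_density :: "nat \<Rightarrow> 'b hypergraph \<Rightarrow> real" where
  "codegree_density r F = codegree_density_family r {F}"

end

theory Submission
  imports Defs "HOL-Combinatorics.Permutations" "HOL-Library.FuncSet"
begin

text \<open>
  Label the vertices of an edge by the positions \<open>0, \<dots>, r - 1\<close> and let two labelled edges be adjacent
  if they differ in one position. A path from \<open>f\<close> to \<open>f\<close> composed with a rotation by \<open>c\<close> unrolls to a closed
  tight walk of length \<open>- c\<close> modulo \<open>r\<close>, so everything depends on the monodromy group of \<open>f\<close>.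

  Let every codegree exceed \<open>n / 3\<close>. Three link neighbourhoods cannot be disjoint, so for two positions
  either the transposition lies in the monodromy group or the link graph is connected and bipartite.
  If no transposition is available, all 3-cycles are, and the rotation, having odd order, is
  a product of them. Otherwise, if no rotation occurs anywhere, the positions of every labelled edge
  split into exactly two blocks, which extend to a 2-colouring of the vertices preserving the parity of
  the colour count of nearby edges; these colourings agree, so all edges have the same
  parity. An edge with \<open>0\<close> or \<open>r / gcd r c\<close> (an odd number) vertices of the first colour, labelled so that the
  colour classes are unions of orbits of the rotation, then has the rotation in its
  monodromy group after all.

  A packing argument bounds the length of the path in terms of \<open>r\<close> only. Random samples
  inherit the codegree condition, so a positive proportion of samples contains one fixed closed
  walk; a blow-up of it contains the cycle. Sampling also shows that the density exists as a limit.
\<close>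

section \<open>Labelled edges and their monodromy\<close>

text \<open>The oddness of \<open>r div gcd r c\<close> is spent twice. It makes the rotation an
  even permutation, so that 3-cycles suffice to produce it; and since every orbit of the rotation
  has that size, it permits an invariant set of positions of odd size, without which edges of odd
  colour parity could not be labelled compatibly. The monodromy group is studied through its
  transpositions: under \<open>swappable\<close> the positions form one block, two blocks or only
  singletons, because with three blocks a single non-trivial partner leads to a contradiction by
  conjugation. In the case of two blocks the colouring is first visible only through triples of
  positions, and only up to complement; hence the normalising and gluing. The walk length must be
  bounded in terms of \<open>r\<close> alone: the threshold for the cycle length is fixed before the
  slack \<open>\<epsilon>\<close>, while the sample in which the walk is found grows as
  \<open>\<epsilon>\<close> shrinks, so the trivial bound by the number of labelled edges is
  useless.\<close>

lemma card_filter_insert2: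
  assumes "finite S" "x \<notin> S" "y \<notin> S" "x \<noteq> y"
  shows "card {v \<in> insert y (insert x S). \<chi> v} = card {v \<in> S. \<chi> v} + of_bool (\<chi> x) + of_bool (\<chi> y)"
proof -
  have "{v \<in> insert y (insert x S). \<chi> v} = {v \<in> S. \<chi> v} \<union> (if \<chi> x then {x} else {}) \<union> (if \<chi> y then {y} else {})"
    by auto
  then show ?thesis using assms by (auto simp: card_insert_if)
qed

text \<open>The bound \<open>codeg\<close> is strict so that three neighbourhoods never fit
  disjointly into \<open>V\<close>. By \<open>big\<close>, a set larger than a third of
  \<open>V\<close> keeps more than \<open>r\<close> elements after losing the vertices of one
  edge.\<close>

locale large_codegree =
  fixes r :: nat and V :: "'a set" and E :: "'a set set"
  assumes r3: "3 \<le> r"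
    and finV: "finite V"
    and edgeV: "e \<in> E \<Longrightarrow> e \<subseteq> V"
    and edge_card: "e \<in> E \<Longrightarrow> card e = r"
    and codeg: "S \<subseteq> V \<Longrightarrow> card S = r - 1 \<Longrightarrow> card V < 3 * card {v \<in> V. v \<notin> S \<and> insert v S \<in> E}"
    and big: "6 * r \<le> card V"
begin

text \<open>A labelled edge is a function on all of \<open>nat\<close>. The values from
  \<open>r\<close> on carry no information, but \<open>step\<close> never alters them, so connected
  states agree there. Injectivity on the positions is automatic because edges have \<open>r\<close>
  elements.\<close>

definition state :: "(nat \<Rightarrow> 'a) \<Rightarrow> bool" where "state f \<longleftrightarrow> f ` {..<r} \<in> E"

definition step :: "(nat \<Rightarrow> 'a) \<Rightarrow> (nat \<Rightarrow> 'a) \<Rightarrow> bool" where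
  "step f g \<longleftrightarrow> state f \<and> state g \<and> (\<exists>i<r. \<exists>v. g = f(i := v))"

abbreviation conn :: "(nat \<Rightarrow> 'a) \<Rightarrow> (nat \<Rightarrow> 'a) \<Rightarrow> bool" where "conn \<equiv> step\<^sup>*\<^sup>*"

text \<open>The permutations \<open>p\<close> with \<open>conn f (f \<circ> p)\<close> form a group, constant along
  \<open>conn\<close>; a transposition of positions \<open>i\<close>, \<open>j\<close> lies in it iff \<open>swappable f i j\<close>.\<close>

abbreviation swappable :: "(nat \<Rightarrow> 'a) \<Rightarrow> nat \<Rightarrow> nat \<Rightarrow> bool" where
  "swappable f i j \<equiv> conn f (f \<circ> transpose i j)"

lemma state_inj: "state f \<Longrightarrow> inj_on f {..<r}"
  unfolding state_def using edge_card by (metis card_lessThan eq_card_imp_inj_on finite_lessThan)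

lemma state_V: "state f \<Longrightarrow> i < r \<Longrightarrow> f i \<in> V"
  unfolding state_def using edgeV by blast

lemma step_sym: "step f g \<Longrightarrow> step g f"
  unfolding step_def by (metis fun_upd_triv fun_upd_upd)

lemma conn_sym: "conn f g \<Longrightarrow> conn g f"
proof (induction rule: rtranclp_induct)
  case (step g h)
  show ?case
    by (rule converse_rtranclp_into_rtranclp[OF _ step.IH]) (rule step_sym[OF step.hyps(2)])
qed simp

lemma conn_trans: "conn f g \<Longrightarrow> conn g h \<Longrightarrow> conn f h"
  by (rule rtranclp_trans)

lemma state_conn: "conn f g \<Longrightarrow> state f \<Longrightarrow> state g"
  by (induction rule: rtranclp_induct) (auto simp: step_def)

lemma state_perm: assumes "p permutes {..<r}" shows "state (f \<circ> p) \<longleftrightarrow> state f"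
  unfolding state_def using permutes_image[OF assms] by (metis image_comp)

text \<open>Relabelling the positions is an automorphism of the graph of states; this is what makes
  the monodromy a group.\<close>

lemma step_perm: assumes "p permutes {..<r}" "step f g" shows "step (f \<circ> p) (g \<circ> p)"
proof -
  obtain i v where iv: "i < r" "g = f(i := v)" using assms(2) by (auto simp: step_def)
  have "g \<circ> p = (f \<circ> p)(inv p i := v)"
    using iv permutes_inverses[OF assms(1)] by (auto simp: fun_eq_iff)
  moreover have "inv p i < r" using permutes_in_image[OF permutes_inv[OF assms(1)], of i] iv by simp
  ultimately show ?thesis using assms state_perm[OF assms(1)] unfolding step_def by blast
qed

lemma conn_perm: assumes "p permutes {..<r}" "conn f g" shows "conn (f \<circ> p) (g \<circ> p)"
  using assms(2)
proof (induction rule: rtranclp_induct)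
  case (step g h)
  show ?case
    by (rule rtranclp.rtrancl_into_rtrancl[OF step.IH]) (rule step_perm[OF assms(1) step.hyps(2)])
qed simp

lemma conn_same: "state (f(i := a)) \<Longrightarrow> state (f(i := b)) \<Longrightarrow> i < r \<Longrightarrow> conn (f(i := a)) (f(i := b))"
  by (rule r_into_rtranclp) (auto simp: step_def intro!: exI[of _ i] exI[of _ b])

lemma monodromy_comp:
  assumes "conn f (f \<circ> p)" "conn f (f \<circ> q)" "q permutes {..<r}" shows "conn f (f \<circ> (p \<circ> q))"
  using conn_trans[OF assms(2) conn_perm[OF assms(3,1)]] by (simp add: comp_assoc)

lemma monodromy_inv: assumes "conn f (f \<circ> p)" "p permutes {..<r}" shows "conn f (f \<circ> inv p)"
  using conn_sym[OF conn_perm[OF permutes_inv[OF assms(2)] assms(1)]] permutes_inv_o[OF assms(2)]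
  by (simp add: comp_assoc)

lemma monodromy_conn: assumes "conn f g" "p permutes {..<r}" "conn f (f \<circ> p)" shows "conn g (g \<circ> p)"
  using conn_trans[OF conn_sym[OF assms(1)] conn_trans[OF assms(3) conn_perm[OF assms(2,1)]]] .

lemma transpose_permutes: "i < r \<Longrightarrow> j < r \<Longrightarrow> transpose i j permutes {..<r}"
  by (simp add: permutes_swap_id)

lemma swappable_conn: "conn f g \<Longrightarrow> i < r \<Longrightarrow> j < r \<Longrightarrow> swappable f i j \<Longrightarrow> swappable g i j"
  by (rule monodromy_conn) (auto simp: transpose_permutes)

lemma swappable_sym: "swappable f i j \<Longrightarrow> swappable f j i" by (simp add: transpose_commute)

lemma swappable_refl: "swappable f i i" by simp

lemma swappable_trans: assumes "swappable f i j" "swappable f j k" "i < r" "j < r" "k < r" shows "swappable f i k"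
proof (cases "i = j \<or> j = k \<or> i = k")
  case True then show ?thesis using assms swappable_refl by auto
next
  case False
  have "transpose i k = transpose i j \<circ> (transpose j k \<circ> transpose i j)"
    using False by (auto simp: fun_eq_iff transpose_def)
  then show ?thesis
    using monodromy_comp[OF assms(1) monodromy_comp[OF assms(2,1)]] transpose_permutes[OF assms(3,4)]
      permutes_compose[OF transpose_permutes[OF assms(3,4)] transpose_permutes[OF assms(4,5)]] by simp
qed

lemma upd_transpose: "i \<noteq> j \<Longrightarrow> f(i := a, j := b) \<circ> transpose i j = f(i := b, j := a)"
  by (auto simp: fun_eq_iff transpose_def)

lemma upd_swap: assumes "i \<noteq> j" "i < r" "j < r" shows "state (f(i := a, j := b)) \<longleftrightarrow> state (f(i := b, j := a))"
  using state_perm[OF transpose_permutes[OF assms(2,3)], of "f(i := a, j := b)"] upd_transpose[OF assms(1)] by metis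

section \<open>Link graphs of two positions\<close>

lemma three_disjoint:
  assumes "A \<subseteq> V" "B \<subseteq> V" "C \<subseteq> V" "A \<inter> B = {}" "A \<inter> C = {}" "B \<inter> C = {}"
    "card V < 3 * card A" "card V < 3 * card B" "card V < 3 * card C" shows False
proof -
  have "finite A" "finite B" "finite C" using assms finV finite_subset by blast+
  then have "card (A \<union> B \<union> C) = card A + card B + card C"
    using assms by (simp add: card_Un_disjoint Int_Un_distrib2)
  moreover have "card (A \<union> B \<union> C) \<le> card V" using assms finV by (intro card_mono) auto
  ultimately show False using assms by linarith
qed

text \<open>This is the neighbourhood of \<open>v\<close> in the link graph of the set
  \<open>S\<close> of \<open>r - 2\<close> vertices, whose edges are the pairs that complete
  \<open>S\<close> to an edge.\<close>

definition link_nbs :: "'a set \<Rightarrow> 'a \<Rightarrow> 'a set" where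
  "link_nbs S v = {b \<in> V. b \<notin> insert v S \<and> insert b (insert v S) \<in> E}"

lemma link_nbs_card: assumes "S \<subseteq> V" "card S = r - 2" "v \<in> V" "v \<notin> S" shows "card V < 3 * card (link_nbs S v)"
proof -
  have "card (insert v S) = r - 1" using assms r3 finV finite_subset[OF assms(1)] by auto
  then show ?thesis using codeg[of "insert v S"] assms unfolding link_nbs_def by auto
qed

definition rest :: "(nat \<Rightarrow> 'a) \<Rightarrow> nat \<Rightarrow> nat \<Rightarrow> 'a set" where
  "rest f i j = f ` ({..<r} - {i, j})"

lemma upd_image: "i \<noteq> j \<Longrightarrow> i < r \<Longrightarrow> j < r \<Longrightarrow> f(i := a, j := b) ` {..<r} = insert b (insert a (rest f i j))"
  unfolding rest_def by (auto simp: image_iff)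

lemma rest_props: assumes "state f" "i \<noteq> j" "i < r" "j < r"
  shows "rest f i j \<subseteq> V" "card (rest f i j) = r - 2" "f i \<notin> rest f i j" "f j \<notin> rest f i j"
    "f ` {..<r} = insert (f j) (insert (f i) (rest f i j))"
proof -
  note inj = state_inj[OF assms(1)]
  show "rest f i j \<subseteq> V" using state_V[OF assms(1)] by (auto simp: rest_def)
  have "card ({..<r} - {i,j}) = r - 2" using assms by (simp add: card_Diff_subset)
  then show "card (rest f i j) = r - 2" unfolding rest_def
    using inj by (metis Diff_subset card_image inj_on_subset)
  show "f i \<notin> rest f i j" "f j \<notin> rest f i j" unfolding rest_def
    using inj assms by (auto simp: inj_on_def)
  show "f ` {..<r} = insert (f j) (insert (f i) (rest f i j))"
    using upd_image[OF assms(2-4), of f "f i" "f j"] by simp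
qed

lemma state_upd: assumes "state f" "i \<noteq> j" "i < r" "j < r"
  shows "state (f(i := a, j := b)) \<longleftrightarrow> b \<in> link_nbs (rest f i j) a \<and> a \<notin> rest f i j \<and> a \<in> V"
proof
  assume s: "state (f(i := a, j := b))"
  let ?g = "f(i := a, j := b)"
  have "rest ?g i j = rest f i j" by (auto simp: rest_def image_iff)
  then have "a \<notin> rest f i j" "b \<notin> rest f i j" using rest_props(3,4)[OF s assms(2-4)] assms by auto
  moreover have "a \<noteq> b" using inj_onD[OF state_inj[OF s], of i j] assms(2-4) by auto
  moreover have "a \<in> V" "b \<in> V" using state_V[OF s, of i] state_V[OF s, of j] assms by auto
  moreover have "insert b (insert a (rest f i j)) \<in> E" using s upd_image[OF assms(2-4)] by (simp add: state_def)
  ultimately show "b \<in> link_nbs (rest f i j) a \<and> a \<notin> rest f i j \<and> a \<in> V" by (auto simp: link_nbs_def)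
next
  assume "b \<in> link_nbs (rest f i j) a \<and> a \<notin> rest f i j \<and> a \<in> V"
  then show "state (f(i := a, j := b))" unfolding state_def upd_image[OF assms(2-4)] link_nbs_def by auto
qed

text \<open>Each side of the link component of \<open>f\<close> contains a neighbourhood, and a vertex outside the
  component would supply a third disjoint one: the link graph is connected and bipartite.\<close>

lemma dichotomy:
  assumes state: "state f" and ij: "i \<noteq> j" "i < r" "j < r" and ntr: "\<not> swappable f i j"
  defines "A \<equiv> {a. \<exists>b. conn f (f(i := a, j := b))}" and "B \<equiv> {b. \<exists>a. conn f (f(i := a, j := b))}"
  shows "A \<inter> B = {}" "link_nbs (rest f i j) (f i) \<subseteq> B" "link_nbs (rest f i j) (f j) \<subseteq> A"
    "\<And>v. v \<in> V \<Longrightarrow> v \<notin> rest f i j \<Longrightarrow> v \<in> A \<or> v \<in> B"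
    "\<And>a b. state (f(i := a, j := b)) \<Longrightarrow>
      (a \<in> A \<and> b \<in> B \<and> conn f (f(i := a, j := b))) \<or> (a \<in> B \<and> b \<in> A \<and> conn f (f(i := b, j := a)))"
    "A \<subseteq> V" "B \<subseteq> V"
proof -
  let ?S = "rest f i j"
  note sc = state_conn[OF _ state]
  note rp = rest_props[OF state ij]
  \<comment> \<open>Rewriting position \<open>j\<close> alone is a single step, so once
    \<open>a\<close> has been brought to position \<open>i\<close>, every link edge at
    \<open>a\<close> is reached with \<open>a\<close> there.\<close>
  have A1: "conn f (f(i := a, j := b))" if a: "a \<in> A" and s: "state (f(i := a, j := b))" for a b
  proof -
    obtain c where "conn f (f(i := a, j := c))" using a A_def by blast
    then show ?thesis using conn_same[of "f(i := a)" j c b] s sc ij conn_trans by blast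
  qed
  have B1: "conn f (f(i := a, j := b))" if a: "b \<in> B" and s: "state (f(i := a, j := b))" for a b
  proof -
    obtain c where c: "conn f (f(i := c, j := b))" using a B_def by blast
    then show ?thesis using conn_same[of "f(j := b)" i c a] s sc[OF c] ij conn_trans[OF c]
      by (simp add: fun_upd_twist)
  qed
  show disj: "A \<inter> B = {}"
  proof (rule ccontr)
    assume "A \<inter> B \<noteq> {}"
    then obtain v where v: "v \<in> A" "v \<in> B" by blast
    then obtain c where c: "conn f (f(i := c, j := v))" using B_def by blast
    \<comment> \<open>The relabelled path ends with \<open>v\<close> at \<open>i\<close> and
      \<open>c\<close> at \<open>j\<close>. Since \<open>v\<close> also lies in \<open>A\<close>,
      the same state is reached from \<open>f\<close> itself, which closes a path from
      \<open>f\<close> to its transposed labelling.\<close>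
    have "conn (f \<circ> transpose i j) (f(i := v, j := c))"
      using conn_perm[OF transpose_permutes[OF ij(2,3)] c] upd_transpose[OF ij(1)] by metis
    moreover have "conn f (f(i := v, j := c))"
      using A1[OF v(1)] sc[OF c] upd_swap[OF ij] by blast
    ultimately show False using ntr conn_trans conn_sym by blast
  qed
  have ff: "f(i := f i, j := f j) = f" by simp
  show nB: "link_nbs ?S (f i) \<subseteq> B"
  proof
    fix b assume "b \<in> link_nbs ?S (f i)"
    then have "state (f(i := f i, j := b))" using state_upd[OF state ij, of "f i" b] rp state_V[OF state] ij by auto
    moreover have "f i \<in> A" unfolding A_def using ff by (metis (mono_tags) mem_Collect_eq rtranclp.rtrancl_refl)
    ultimately show "b \<in> B" using A1 B_def by blast
  qed
  show nA: "link_nbs ?S (f j) \<subseteq> A"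
  proof
    fix b assume "b \<in> link_nbs ?S (f j)"
    then have "state (f(i := f j, j := b))" using state_upd[OF state ij, of "f j" b] rp state_V[OF state] ij by auto
    then have "state (f(i := b, j := f j))" using upd_swap[OF ij] by blast
    moreover have "f j \<in> B" unfolding B_def using ff by (metis (mono_tags) mem_Collect_eq rtranclp.rtrancl_refl)
    ultimately show "b \<in> A" using B1 A_def by blast
  qed
  show AV: "A \<subseteq> V" using state_V[OF sc, of _ i] ij unfolding A_def by fastforce
  show BV: "B \<subseteq> V" using state_V[OF sc, of _ j] ij unfolding B_def by fastforce
  show cover: "v \<in> A \<or> v \<in> B" if v: "v \<in> V" "v \<notin> ?S" for v
  proof (rule ccontr)
    assume n: "\<not> (v \<in> A \<or> v \<in> B)"
    have N: "link_nbs ?S v \<inter> A = {}" "link_nbs ?S v \<inter> B = {}"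
    proof -
      { fix b assume b: "b \<in> link_nbs ?S v"
        then have s: "state (f(i := v, j := b))" using state_upd[OF state ij] v by blast
        then have s': "state (f(i := b, j := v))" using upd_swap[OF ij] by blast
        have "b \<notin> A" using A1[OF _ s'] n B_def by blast
        moreover have "b \<notin> B" using B1[OF _ s] n A_def by blast
        ultimately have "b \<notin> A \<and> b \<notin> B" by blast }
      then show "link_nbs ?S v \<inter> A = {}" "link_nbs ?S v \<inter> B = {}" by blast+
    qed
    have "card V < 3 * card (link_nbs ?S v)" "card V < 3 * card (link_nbs ?S (f i))" "card V < 3 * card (link_nbs ?S (f j))"
      using link_nbs_card[OF rp(1,2)] v rp state_V[OF state] ij by auto
    moreover have "link_nbs ?S (f i) \<inter> link_nbs ?S (f j) = {}" using nA nB disj by blast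
    moreover have "link_nbs ?S w \<subseteq> V" for w by (auto simp: link_nbs_def)
    ultimately show False using three_disjoint[of "link_nbs ?S (f i)" "link_nbs ?S (f j)" "link_nbs ?S v"] N nA nB by blast
  qed
  show "(a \<in> A \<and> b \<in> B \<and> conn f (f(i := a, j := b))) \<or> (a \<in> B \<and> b \<in> A \<and> conn f (f(i := b, j := a)))"
    if s: "state (f(i := a, j := b))" for a b
  proof -
    have s': "state (f(i := b, j := a))" using upd_swap[OF ij] s by blast
    have "a \<in> V" "a \<notin> ?S" using state_upd[OF state ij] s by blast+
    then consider "a \<in> A" | "a \<in> B" using cover by blast
    then show ?thesis
    proof cases
      case 1 then show ?thesis using A1[OF 1 s] B_def by blast
    next
      case 2 then show ?thesis using B1[OF 2 s'] A_def by blast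
    qed
  qed
qed

text \<open>The path may pass through arbitrary states; only its last state has to agree with
  \<open>f\<close> off \<open>I\<close>.\<close>

definition at_pos :: "(nat \<Rightarrow> 'a) \<Rightarrow> nat set \<Rightarrow> nat \<Rightarrow> 'a \<Rightarrow> bool" where
  "at_pos f I p v \<longleftrightarrow> (\<exists>g. conn f g \<and> (\<forall>x. x \<notin> I \<longrightarrow> g x = f x) \<and> g p = v)"

lemma not_swappable_conn: "conn f g \<Longrightarrow> i < r \<Longrightarrow> j < r \<Longrightarrow> \<not> swappable f i j \<Longrightarrow> \<not> swappable g i j"
  using swappable_conn conn_sym by blast

text \<open>Composing \<open>h\<close> with \<open>transpose p q\<close> moves \<open>v\<close> to
  position \<open>p\<close>, where \<open>g\<close> has it too. The two states then differ only at
  \<open>q\<close> and \<open>s\<close>, and as the link graph of these positions is connected and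
  bipartite, they are connected up to \<open>transpose q s\<close>.\<close>

lemma merge:
  assumes state: "state f" and d: "p \<noteq> q" "q \<noteq> s" "p \<noteq> s" and lt: "p < r" "q < r" "s < r"
    and I: "I = {p, q, s}" and ntr: "\<not> swappable f q s" and v: "at_pos f I p v" "at_pos f I q v"
  shows "swappable f p q \<or> conn f (f \<circ> (transpose p q \<circ> transpose q s))"
proof -
  obtain g where g: "conn f g" "\<forall>x. x \<notin> I \<longrightarrow> g x = f x" "g p = v" using v(1) by (auto simp: at_pos_def)
  obtain h where h: "conn f h" "\<forall>x. x \<notin> I \<longrightarrow> h x = f x" "h q = v" using v(2) by (auto simp: at_pos_def)
  have sg: "state g" and sh: "state h" using g h state_conn state by blast+
  have e1: "h \<circ> transpose p q = g(q := h p, s := h s)"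
    using g h I d by (auto simp: fun_eq_iff transpose_def)
  have e2: "h \<circ> (transpose p q \<circ> transpose q s) = g(q := h s, s := h p)"
    using e1 upd_transpose[OF d(2)] by (simp add: comp_assoc[symmetric])
  have "state (g(q := h p, s := h s))" using state_perm[OF transpose_permutes[OF lt(1,2)]] sh e1 by metis
  from dichotomy(5)[OF sg d(2) lt(2,3) not_swappable_conn[OF g(1) lt(2,3) ntr] this]
  have "conn g (h \<circ> transpose p q) \<or> conn g (h \<circ> (transpose p q \<circ> transpose q s))"
    unfolding e1 e2 by blast
  then have "conn h (h \<circ> transpose p q) \<or> conn h (h \<circ> (transpose p q \<circ> transpose q s))"
    using conn_trans[OF conn_trans[OF conn_sym[OF h(1)] g(1)]] by blast
  then show ?thesis
    using monodromy_conn[OF conn_sym[OF h(1)] transpose_permutes[OF lt(1,2)]]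
      monodromy_conn[OF conn_sym[OF h(1)] permutes_compose[OF transpose_permutes[OF lt(2,3)] transpose_permutes[OF lt(1,2)]]]
    by blast
qed

lemma at_pos_cover:
  assumes state: "state f" and ij: "i \<noteq> j" "i < r" "j < r" and "\<not> swappable f i j" "v \<in> V" "v \<notin> rest f i j" "{i, j} \<subseteq> I"
  shows "at_pos f I i v \<or> at_pos f I j v"
  using dichotomy(4)[OF assms(1-7)]
proof (elim disjE CollectE exE)
  fix b assume "conn f (f(i := v, j := b))"
  then show ?thesis unfolding at_pos_def using assms by (intro disjI1 exI[of _ "f(i := v, j := b)"]) auto
next
  fix b assume "conn f (f(i := b, j := v))"
  then show ?thesis unfolding at_pos_def using assms by (intro disjI2 exI[of _ "f(i := b, j := v)"]) auto
qed

lemma ex_outside: assumes "finite A" "card A \<le> r" shows "\<exists>v\<in>V. v \<notin> A"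
proof (rule ccontr)
  assume "\<not> ?thesis"
  then have "V \<subseteq> A" by blast
  then have "card V \<le> r" using card_mono[OF assms(1)] assms(2) le_trans by blast
  then show False using big r3 by linarith
qed

text \<open>A vertex outside the edge can occupy two of the three positions.\<close>

lemma three_cycle:
  assumes state: "state f" and d: "i \<noteq> j" "j \<noteq> k" "i \<noteq> k" and lt: "i < r" "j < r" "k < r"
    and n: "\<not> swappable f i j" "\<not> swappable f j k" "\<not> swappable f i k"
  shows "conn f (f \<circ> (transpose i j \<circ> transpose j k))"
proof -
  have "card (f ` {..<r}) \<le> r" using card_image_le[of "{..<r}" f] by simp
  then obtain v where v: "v \<in> V" "v \<notin> f ` {..<r}" using ex_outside by blast
  define I where "I = {i, j, k}"
  have "at_pos f I i v \<or> at_pos f I j v"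
    by (rule at_pos_cover[OF state d(1) lt(1,2) n(1) v(1)]) (use v in \<open>auto simp: rest_def I_def\<close>)
  moreover have "at_pos f I j v \<or> at_pos f I k v"
    by (rule at_pos_cover[OF state d(2) lt(2,3) n(2) v(1)]) (use v in \<open>auto simp: rest_def I_def\<close>)
  moreover have "at_pos f I i v \<or> at_pos f I k v"
    by (rule at_pos_cover[OF state d(3) lt(1,3) n(3) v(1)]) (use v in \<open>auto simp: rest_def I_def\<close>)
  ultimately consider "at_pos f I i v" "at_pos f I j v" | "at_pos f I j v" "at_pos f I k v"
    | "at_pos f I k v" "at_pos f I i v" by blast
  then show ?thesis
  proof cases
    case 1
    show ?thesis using merge[OF state d(1,2,3) lt I_def n(2) 1] n by blast
  next
    case 2
    \<comment> \<open>The three cyclic arrangements of \<open>i\<close>, \<open>j\<close>,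
      \<open>k\<close> all produce the same 3-cycle, so it does not matter which two positions
      \<open>v\<close> can take.\<close>
    have "transpose j k \<circ> transpose k i = transpose i j \<circ> transpose j k"
      using d by (auto simp: fun_eq_iff transpose_def)
    moreover have "I = {j, k, i}" unfolding I_def by auto
    moreover have "\<not> swappable f k i" using n(3) swappable_sym by blast
    ultimately show ?thesis using merge[OF state d(2) d(3)[symmetric] d(1)[symmetric] lt(2,3,1) _ _ 2] n by metis
  next
    case 3
    have "transpose k i \<circ> transpose i j = transpose i j \<circ> transpose j k"
      using d by (auto simp: fun_eq_iff transpose_def)
    moreover have "I = {k, i, j}" unfolding I_def by auto
    moreover have "\<not> swappable f k i" using n(3) swappable_sym by blast
    ultimately show ?thesis using merge[OF state d(3)[symmetric] d(1) d(2)[symmetric] lt(3,1,2) _ _ 3] n by metis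
  qed
qed

section \<open>Generating permutations by 3-cycles and by transpositions\<close>

lemma monodromy_even:
  assumes cyc: "\<And>i j k. i < r \<Longrightarrow> j < r \<Longrightarrow> k < r \<Longrightarrow> i \<noteq> j \<Longrightarrow> j \<noteq> k \<Longrightarrow> i \<noteq> k \<Longrightarrow>
      conn f (f \<circ> (transpose i j \<circ> transpose j k))"
    and p: "p permutes {..<r}" and ev: "evenperm p"
  shows "conn f (f \<circ> p)"
proof -
  have pair_parity: "transpose a b \<circ> transpose c d permutes {..<r}" if "a < r" "b < r" "c < r" "d < r" for a b c d
    using that by (intro permutes_compose transpose_permutes)
  have cyc': "conn f (f \<circ> (transpose a b \<circ> transpose b d))" if "a < r" "b < r" "d < r" "a \<noteq> b" "b \<noteq> d" for a b d
  proof (cases "a = d")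
    case True
    then have "transpose a b \<circ> transpose b d = id" by (simp add: transpose_commute)
    then show ?thesis by simp
  qed (use cyc that in auto)
  have two: "conn f (f \<circ> (transpose a b \<circ> transpose c d))"
    if l: "a < r" "b < r" "c < r" "d < r" and ne: "a \<noteq> b" "c \<noteq> d" for a b c d
  proof (cases "b = c")
    case True then show ?thesis using cyc' l ne by simp
  next
    case False
    \<comment> \<open>Inserting \<open>transpose b c\<close> twice splits the product into two pairs
      that share a position, each of which is a 3-cycle or the identity.\<close>
    have "transpose a b \<circ> transpose c d = (transpose a b \<circ> transpose b c) \<circ> (transpose b c \<circ> transpose c d)"
      by (simp add: comp_assoc) (simp add: comp_assoc[symmetric])
    then show ?thesis
      using monodromy_comp[OF cyc'[OF l(1,2,3) ne(1) False] cyc'[OF l(2,3,4) False ne(2)] pair_parity[OF l(2,3,3,4)]] by simp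
  qed
  \<comment> \<open>The factor \<open>transpose 0 1\<close> corrects the sign of odd permutations,
    so that the induction can add one transposition at a time.\<close>
  have "(evenperm p \<longrightarrow> conn f (f \<circ> p)) \<and> (\<not> evenperm p \<longrightarrow> conn f (f \<circ> (transpose 0 1 \<circ> p)))"
    using p finite_lessThan[of r]
  proof (induction rule: permutes_induct)
    case id then show ?case by simp
  next
    case (swap a b p)
    have ab: "a < r" "b < r" using swap by auto
    have p01: "0 < r" "1 < r" using r3 by auto
    have perm: "permutation p" using swap.hyps by (auto simp: permutation_permutes)
    have edge_parity: "evenperm (transpose a b \<circ> p) \<longleftrightarrow> \<not> evenperm p"
      using evenperm_comp[OF permutation_swap_id perm] evenperm_swap[of a b] swap by auto
    show ?case
    proof (cases "evenperm p")
      case True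
      have "conn f (f \<circ> ((transpose 0 1 \<circ> transpose a b) \<circ> p))"
        using monodromy_comp[OF two[OF p01 ab zero_neq_one swap(3)] mp[OF conjunct1[OF swap.IH] True] swap.hyps(4)] .
      then show ?thesis using True edge_parity by (simp add: comp_def)
    next
      case False
      have "transpose 0 1 \<circ> p permutes {..<r}"
        using swap.hyps by (intro permutes_compose transpose_permutes p01) auto
      then have "conn f (f \<circ> ((transpose a b \<circ> transpose 0 1) \<circ> (transpose 0 1 \<circ> p)))"
        using monodromy_comp[OF two[OF ab p01 swap(3) zero_neq_one] mp[OF conjunct2[OF swap.IH] False]] by blast
      moreover have "(transpose a b \<circ> transpose 0 1) \<circ> (transpose 0 1 \<circ> p) = transpose a b \<circ> p"
        by (simp add: fun_eq_iff)
      ultimately show ?thesis using False edge_parity by (simp add: comp_def)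
    qed
  qed
  then show ?thesis using ev by blast
qed

text \<open>Transpositions inside the blocks of \<open>swappable\<close> generate every permutation
  that preserves each block: composing \<open>p\<close> with \<open>transpose i (p i)\<close>
  shrinks its support and keeps it within the blocks.\<close>

lemma monodromy_blocks:
  assumes "p permutes {..<r}" "\<And>i. i < r \<Longrightarrow> swappable f i (p i)" shows "conn f (f \<circ> p)"
  using assms
proof (induction "card {i. p i \<noteq> i}" arbitrary: p rule: less_induct)
  case less
  show ?case
  proof (cases "p = id")
    case True then show ?thesis by simp
  next
    case False
    then obtain i where i: "p i \<noteq> i" by fastforce
    have il: "i < r" using i permutes_not_in[OF less.prems(1)] by force
    have pil: "p i < r" using permutes_in_image[OF less.prems(1)] il by simp
    let ?t = "transpose i (p i)"
    let ?q = "?t \<circ> p"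
    have inj: "p x = p y \<longleftrightarrow> x = y" for x y using permutes_inj[OF less.prems(1)] by (auto simp: inj_def)
    have fin: "finite {i. p i \<noteq> i}"
      using permutes_not_in[OF less.prems(1)] by (intro finite_subset[OF _ finite_lessThan[of r]]) force
    have "{i. ?q i \<noteq> i} \<subset> {i. p i \<noteq> i}"
    proof
      show "{i. ?q i \<noteq> i} \<subseteq> {i. p i \<noteq> i}"
      proof (intro subsetI CollectI notI)
        fix x assume x: "x \<in> {i. ?q i \<noteq> i}" and "p x = x"
        then have "x \<noteq> i" "x \<noteq> p i" using i inj by metis+
        then show False using x \<open>p x = x\<close> by (simp add: transpose_def)
      qed
      show "{i. ?q i \<noteq> i} \<noteq> {i. p i \<noteq> i}" using i by (auto simp: set_eq_iff transpose_def)
    qed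
    then have lt: "card {i. ?q i \<noteq> i} < card {i. p i \<noteq> i}" using psubset_card_mono[OF fin] by blast
    have tp: "?t permutes {..<r}" by (rule transpose_permutes[OF il pil])
    have qp: "?q permutes {..<r}" by (rule permutes_compose[OF less.prems(1) tp])
    have "swappable f x (?q x)" if x: "x < r" for x
    proof (cases "p x = i")
      case True
      then have "?q x = p i" by simp
      moreover have "swappable f x i" using less.prems(2)[OF x] True by simp
      ultimately show ?thesis using swappable_trans[OF _ less.prems(2)[OF il] x il pil] by metis
    next
      case False
      show ?thesis
      proof (cases "x = i")
        case True then show ?thesis by simp
      next
        case False2: False
        then have "?q x = p x" using False inj by (simp add: transpose_def)
        then show ?thesis using less.prems(2)[OF x] by simp
      qed
    qed
    from less.hyps[OF lt qp this] have "conn f (f \<circ> ?q)" .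
    from monodromy_comp[OF less.prems(2)[OF il] this qp]
    show ?thesis by (simp add: comp_assoc[symmetric])
  qed
qed

text \<open>The edges of the link graph at positions \<open>i\<close>, \<open>j\<close> are either
  all monochromatic or all bichromatic; \<open>f\<close> itself, being one of them, tells
  which.\<close>

definition pair_parity :: "(nat \<Rightarrow> 'a) \<Rightarrow> ('a \<Rightarrow> bool) \<Rightarrow> nat \<Rightarrow> nat \<Rightarrow> bool" where
  "pair_parity f \<chi> i j \<longleftrightarrow> (\<forall>a b. state (f(i := a, j := b)) \<longrightarrow> (\<chi> a = \<chi> b) = (\<chi> (f i) = \<chi> (f j)))"

text \<open>The colour of a vertex records which of the three positions it can be moved to.
  Positions \<open>i\<close> and \<open>j\<close> are interchangeable. A vertex that could reach
  both \<open>i\<close> and \<open>k\<close> would, by \<open>merge\<close>, put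
  \<open>transpose i k\<close> or a 3-cycle into the monodromy, and that 3-cycle times
  \<open>transpose i j\<close> is \<open>transpose j k\<close>.\<close>

lemma mixed_triple:
  assumes state: "state f" and d: "i \<noteq> j" "j \<noteq> k" "i \<noteq> k" and lt: "i < r" "j < r" "k < r"
    and swappable: "swappable f i j" and ntr: "\<not> swappable f i k"
  shows "\<exists>\<chi>. \<chi> (f i) \<and> \<chi> (f j) \<and> \<not> \<chi> (f k) \<and> pair_parity f \<chi> i j \<and> pair_parity f \<chi> j k \<and> pair_parity f \<chi> i k
    \<and> card V < 3 * card {v \<in> V. \<chi> v} \<and> card V < 3 * card {v \<in> V. \<not> \<chi> v}"
proof -
  define I where "I = {i, j, k}"
  define \<chi> where "\<chi> = at_pos f I i"
  have ntr2: "\<not> swappable f j k" using swappable_trans[OF swappable _ lt] ntr by blast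
  have swap: "at_pos f I i v \<longleftrightarrow> at_pos f I j v" for v
  proof -
    { fix g assume g: "conn f g" "\<forall>x. x \<notin> I \<longrightarrow> g x = f x"
      have "conn f (g \<circ> transpose i j)"
        using conn_trans[OF swappable conn_perm[OF transpose_permutes[OF lt(1,2)] g(1)]] .
      moreover have "\<forall>x. x \<notin> I \<longrightarrow> (g \<circ> transpose i j) x = f x" using g by (auto simp: I_def transpose_def)
      ultimately have "at_pos f I i (g j) \<and> at_pos f I j (g i)"
        unfolding at_pos_def by (intro conjI exI[of _ "g \<circ> transpose i j"]) auto }
    note * = this
    show ?thesis
    proof
      assume "at_pos f I i v"
      then obtain g where "conn f g" "\<forall>x. x \<notin> I \<longrightarrow> g x = f x" "g i = v" unfolding at_pos_def by blast
      then show "at_pos f I j v" using * by blast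
    next
      assume "at_pos f I j v"
      then obtain g where "conn f g" "\<forall>x. x \<notin> I \<longrightarrow> g x = f x" "g j = v" unfolding at_pos_def by blast
      then show "at_pos f I i v" using * by blast
    qed
  qed
  have disj: "\<not> (at_pos f I i v \<and> at_pos f I k v)" for v
  proof
    assume v: "at_pos f I i v \<and> at_pos f I k v"
    have "I = {k, j, i}" "I = {i, k, j}" unfolding I_def by auto
    then have "swappable f i k \<or> conn f (f \<circ> (transpose i k \<circ> transpose k j))"
      using merge[OF state d(3) d(2)[symmetric] d(1) lt(1,3,2) _ _ conjunct1[OF v] conjunct2[OF v]] ntr2 swappable_sym by blast
    then have c: "conn f (f \<circ> (transpose i k \<circ> transpose k j))" using ntr by blast
    have "conn f (f \<circ> (transpose i k \<circ> transpose k j \<circ> transpose i j))"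
      using monodromy_comp[OF c swappable transpose_permutes[OF lt(1,2)]] .
    moreover have "transpose i k \<circ> transpose k j \<circ> transpose i j = transpose j k"
      using d by (auto simp: fun_eq_iff transpose_def)
    ultimately show False using ntr2 by simp
  qed
  have fi: "at_pos f I i (f i)" "at_pos f I j (f j)" "at_pos f I k (f k)" unfolding at_pos_def by auto
  have cross: "(at_pos f I j a \<and> at_pos f I k b) \<or> (at_pos f I k a \<and> at_pos f I j b)"
    if g: "conn f g" "\<forall>x. x \<notin> I \<longrightarrow> g x = f x" and s: "state (g(j := a, k := b))" for g a b
  proof -
    have sg: "state g" using g state state_conn by blast
    from dichotomy(5)[OF sg d(2) lt(2,3) not_swappable_conn[OF g(1) lt(2,3) ntr2] s]
    have "conn f (g(j := a, k := b)) \<or> conn f (g(j := b, k := a))" using g(1) conn_trans by blast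
    then show ?thesis
    proof
      assume "conn f (g(j := a, k := b))"
      then have "at_pos f I j a \<and> at_pos f I k b" unfolding at_pos_def
        by (intro conjI exI[of _ "g(j := a, k := b)"]) (use g d in \<open>auto simp: I_def\<close>)
      then show ?thesis by blast
    next
      assume "conn f (g(j := b, k := a))"
      then have "at_pos f I j b \<and> at_pos f I k a" unfolding at_pos_def
        by (intro conjI exI[of _ "g(j := b, k := a)"]) (use g d in \<open>auto simp: I_def\<close>)
      then show ?thesis by blast
    qed
  qed
  have f1: "\<chi> (f i)" "\<chi> (f j)" "\<not> \<chi> (f k)" using fi swap disj by (auto simp: \<chi>_def)
  have pjk: "pair_parity f \<chi> j k"
    unfolding pair_parity_def using cross[of f] f1 swap disj unfolding \<chi>_def by blast
  have pik: "pair_parity f \<chi> i k"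
    unfolding pair_parity_def
  proof (intro allI impI)
    fix a b assume s: "state (f(i := a, k := b))"
    from dichotomy(5)[OF state d(3) lt(1,3) ntr s]
    have "conn f (f(i := a, k := b)) \<or> conn f (f(i := b, k := a))" by blast
    then have "(at_pos f I i a \<and> at_pos f I k b) \<or> (at_pos f I i b \<and> at_pos f I k a)"
    proof
      assume "conn f (f(i := a, k := b))"
      then have "at_pos f I i a \<and> at_pos f I k b" unfolding at_pos_def
        by (intro conjI exI[of _ "f(i := a, k := b)"]) (use d in \<open>auto simp: I_def\<close>)
      then show ?thesis by blast
    next
      assume "conn f (f(i := b, k := a))"
      then have "at_pos f I i b \<and> at_pos f I k a" unfolding at_pos_def
        by (intro conjI exI[of _ "f(i := b, k := a)"]) (use d in \<open>auto simp: I_def\<close>)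
      then show ?thesis by blast
    qed
    then show "(\<chi> a = \<chi> b) = (\<chi> (f i) = \<chi> (f k))" using f1 disj unfolding \<chi>_def by blast
  qed
  \<comment> \<open>The state \<open>g\<close> already has \<open>a\<close> at position
    \<open>i\<close>, so only \<open>j\<close> and \<open>k\<close> remain to be set. As
    \<open>f k\<close> is not coloured it must come back to position \<open>k\<close>, which leaves
    \<open>b\<close> for position \<open>j\<close>.\<close>
  have half: "\<chi> b" if a: "\<chi> a" and s: "state (f(i := a, j := b))" for a b
  proof -
    obtain g where g: "conn f g" "\<forall>x. x \<notin> I \<longrightarrow> g x = f x" "g i = a"
      using a by (auto simp: \<chi>_def at_pos_def)
    have "g(j := b, k := f k) = f(i := a, j := b)" using g d by (auto simp: fun_eq_iff I_def)
    then have "(at_pos f I j b \<and> at_pos f I k (f k)) \<or> (at_pos f I k b \<and> at_pos f I j (f k))"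
      using cross[OF g(1,2), of b "f k"] s by metis
    then show ?thesis using f1 swap unfolding \<chi>_def by blast
  qed
  have pij: "pair_parity f \<chi> i j"
    unfolding pair_parity_def using half f1 upd_swap[OF d(1) lt(1,2)] by blast
  \<comment> \<open>All link edges at \<open>i\<close>, \<open>k\<close> are bichromatic, so each
    colour class contains a whole neighbourhood.\<close>
  note rp = rest_props[OF state d(3) lt(1,3)]
  have "link_nbs (rest f i k) (f i) \<subseteq> {v \<in> V. \<not> \<chi> v}"
  proof
    fix b assume b: "b \<in> link_nbs (rest f i k) (f i)"
    then have "state (f(i := f i, k := b))" using state_upd[OF state d(3) lt(1,3)] rp state_V[OF state lt(1)] by blast
    then have "\<not> \<chi> b" using pik f1 unfolding pair_parity_def by blast
    then show "b \<in> {v \<in> V. \<not> \<chi> v}" using b by (auto simp: link_nbs_def)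
  qed
  then have "card (link_nbs (rest f i k) (f i)) \<le> card {v \<in> V. \<not> \<chi> v}" using finV by (intro card_mono) auto
  moreover have "card V < 3 * card (link_nbs (rest f i k) (f i))"
    using link_nbs_card[OF rp(1,2) state_V[OF state lt(1)] rp(3)] .
  moreover have "link_nbs (rest f i k) (f k) \<subseteq> {v \<in> V. \<chi> v}"
  proof
    fix b assume b: "b \<in> link_nbs (rest f i k) (f k)"
    then have "state (f(i := f k, k := b))" using state_upd[OF state d(3) lt(1,3)] rp state_V[OF state lt(3)] by blast
    then have "\<chi> b" using pik f1 unfolding pair_parity_def by blast
    then show "b \<in> {v \<in> V. \<chi> v}" using b by (auto simp: link_nbs_def)
  qed
  then have "card (link_nbs (rest f i k) (f k)) \<le> card {v \<in> V. \<chi> v}" using finV by (intro card_mono) auto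
  moreover have "card V < 3 * card (link_nbs (rest f i k) (f k))"
    using link_nbs_card[OF rp(1,2) state_V[OF state lt(3)] rp(4)] .
  ultimately have "card V < 3 * card {v \<in> V. \<chi> v} \<and> card V < 3 * card {v \<in> V. \<not> \<chi> v}" by linarith
  then show ?thesis using f1 pij pjk pik by blast
qed

section \<open>Parity colourings\<close>

definition balanced :: "('a \<Rightarrow> bool) \<Rightarrow> bool" where
  "balanced \<chi> \<longleftrightarrow> r < card {v \<in> V. \<chi> v} \<and> r < card {v \<in> V. \<not> \<chi> v}"

lemma balanced_ex: assumes "balanced \<chi>" "finite S" "card S \<le> r" shows "\<exists>v\<in>V. v \<notin> S \<and> \<chi> v = b"
proof (rule ccontr)
  assume "\<not> ?thesis"
  then have "{v \<in> V. \<chi> v = b} \<subseteq> S" by blast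
  then have "card {v \<in> V. \<chi> v = b} \<le> r" using card_mono[OF assms(2)] assms(3) le_trans by blast
  then show False using assms(1) by (cases b) (auto simp: balanced_def)
qed

text \<open>The neighbourhood of a vertex lies in a single one of the four classes cut out by the two
  colourings, and distinct classes give disjoint neighbourhoods, so at most two classes occur.\<close>

lemma unique_parity:
  assumes S: "S \<subseteq> V" "card S = r - 2"
    and p1: "\<And>a b. a \<notin> S \<Longrightarrow> b \<notin> S \<Longrightarrow> a \<noteq> b \<Longrightarrow> insert b (insert a S) \<in> E \<Longrightarrow> (\<chi> a = \<chi> b) = \<kappa>"
    and p2: "\<And>a b. a \<notin> S \<Longrightarrow> b \<notin> S \<Longrightarrow> a \<noteq> b \<Longrightarrow> insert b (insert a S) \<in> E \<Longrightarrow> (\<chi>' a = \<chi>' b) = \<kappa>'"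
    and b: "balanced \<chi>" "balanced \<chi>'"
  shows "\<exists>d. \<forall>v\<in>V - S. \<chi>' v = (\<chi> v = d)"
proof (rule ccontr)
  assume n: "\<not> ?thesis"
  have fS: "finite S" "card S \<le> r" using S finV finite_subset by auto
  have three: False if w: "u \<in> V - S" "v \<in> V - S" "w \<in> V - S"
    and d: "\<chi> u \<noteq> \<chi> v \<or> \<chi>' u \<noteq> \<chi>' v" "\<chi> u \<noteq> \<chi> w \<or> \<chi>' u \<noteq> \<chi>' w" "\<chi> v \<noteq> \<chi> w \<or> \<chi>' v \<noteq> \<chi>' w" for u v w
  proof -
    have disj: "link_nbs S x \<inter> link_nbs S y = {}" if "x \<in> V - S" "y \<in> V - S" "\<chi> x \<noteq> \<chi> y \<or> \<chi>' x \<noteq> \<chi>' y" for x y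
    proof (rule ccontr)
      assume "link_nbs S x \<inter> link_nbs S y \<noteq> {}"
      then obtain z where z: "z \<in> link_nbs S x" "z \<in> link_nbs S y" by blast
      have "(\<chi> x = \<chi> z) = \<kappa>" "(\<chi>' x = \<chi>' z) = \<kappa>'" "(\<chi> y = \<chi> z) = \<kappa>" "(\<chi>' y = \<chi>' z) = \<kappa>'"
        using p1[of x z] p2[of x z] p1[of y z] p2[of y z] z that by (auto simp: link_nbs_def)
      then show False using that(3) by blast
    qed
    have "link_nbs S x \<subseteq> V" for x by (auto simp: link_nbs_def)
    then show False
      using three_disjoint[of "link_nbs S u" "link_nbs S v" "link_nbs S w"] disj w d link_nbs_card[OF S] by blast
  qed
  obtain u where u: "u \<in> V - S" using balanced_ex[OF b(1) fS] by blast
  obtain v where v: "v \<in> V - S" "(\<chi>' v = \<chi> v) \<noteq> (\<chi>' u = \<chi> u)" using n by blast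
  show False
  proof (cases "\<chi> u = \<chi> v")
    case True
    obtain w where "w \<in> V - S" "\<chi> w = (\<not> \<chi> u)" using balanced_ex[OF b(1) fS, of "\<not> \<chi> u"] by blast
    then show False using three[OF u v(1), of w] True v(2) by blast
  next
    case False
    obtain w where "w \<in> V - S" "\<chi>' w = (\<not> \<chi>' u)" using balanced_ex[OF b(2) fS, of "\<not> \<chi>' u"] by blast
    then show False using three[OF u v(1), of w] False v(2) by blast
  qed
qed

lemma pair_parity_sym: assumes "i \<noteq> j" "pair_parity f \<chi> i j" shows "pair_parity f \<chi> j i"
  unfolding pair_parity_def
proof (intro allI impI)
  fix a b assume "state (f(j := a, i := b))"
  then have "state (f(i := b, j := a))" by (simp add: fun_upd_twist[OF assms(1)])
  then show "(\<chi> a = \<chi> b) = (\<chi> (f j) = \<chi> (f i))" using assms(2) unfolding pair_parity_def by blast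
qed

text \<open>Vertices of \<open>rest f i j\<close> never occur in link edges, so their colours are
  free; complementing a colouring does not affect which pairs are monochromatic.\<close>

lemma pair_parity_transfer:
  assumes state: "state f" and ij: "i \<noteq> j" "i < r" "j < r" and pair_parity: "pair_parity f \<chi> i j"
    and e: "\<And>v. v \<in> V \<Longrightarrow> v \<notin> rest f i j \<Longrightarrow> \<chi>' v = (\<chi> v = d)"
  shows "pair_parity f \<chi>' i j"
  unfolding pair_parity_def
proof (intro allI impI)
  fix a b assume s: "state (f(i := a, j := b))"
  then have "a \<in> V" "a \<notin> rest f i j" "b \<in> V" "b \<notin> rest f i j"
    using state_upd[OF state ij] upd_swap[OF ij] by blast+
  moreover have "f i \<in> V" "f i \<notin> rest f i j" "f j \<in> V" "f j \<notin> rest f i j"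
    using rest_props[OF state ij] state_V[OF state] ij by auto
  ultimately have "\<chi>' a = (\<chi> a = d)" "\<chi>' b = (\<chi> b = d)" "\<chi>' (f i) = (\<chi> (f i) = d)" "\<chi>' (f j) = (\<chi> (f j) = d)"
    using e by blast+
  moreover have "(\<chi> a = \<chi> b) = (\<chi> (f i) = \<chi> (f j))" using pair_parity s by (simp add: pair_parity_def)
  ultimately show "(\<chi>' a = \<chi>' b) = (\<chi>' (f i) = \<chi>' (f j))" by argo
qed

text \<open>Equal colours at \<open>i\<close> and \<open>j\<close> make every link edge
  monochromatic. Without a swap the neighbourhoods of \<open>f i\<close> and \<open>f j\<close>
  would be disjoint, and a vertex of the opposite colour would contribute a third disjoint
  one.\<close>

lemma same_side_swappable:
  assumes state: "state f" and ij: "i \<noteq> j" "i < r" "j < r" and b: "balanced \<chi>" and pair_parity: "pair_parity f \<chi> i j"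
    and eq: "\<chi> (f i) = \<chi> (f j)"
  shows "swappable f i j"
proof (rule ccontr)
  assume ntr: "\<not> swappable f i j"
  let ?S = "rest f i j"
  note rp = rest_props[OF state ij]
  have "finite ?S" "card ?S \<le> r" using rp(2) by (auto simp: rest_def)
  then obtain w where w: "w \<in> V" "w \<notin> ?S" "\<chi> w = (\<not> \<chi> (f i))" using balanced_ex[OF b] by blast
  have side: "\<chi> b = \<chi> v" if "v \<in> V" "v \<notin> ?S" "b \<in> link_nbs ?S v" for v b
  proof -
    have "state (f(i := v, j := b))" using state_upd[OF state ij] that by blast
    then show ?thesis using pair_parity eq unfolding pair_parity_def by blast
  qed
  have fV: "f i \<in> V" "f j \<in> V" using state_V[OF state] ij by auto
  have "link_nbs ?S (f i) \<inter> link_nbs ?S (f j) = {}" using dichotomy(1,2,3)[OF state ij ntr] by blast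
  moreover have "link_nbs ?S (f i) \<inter> link_nbs ?S w = {}" "link_nbs ?S (f j) \<inter> link_nbs ?S w = {}"
    using side[OF fV(1) rp(3)] side[OF fV(2) rp(4)] side[OF w(1,2)] w(3) eq by blast+
  moreover have "link_nbs ?S x \<subseteq> V" for x by (auto simp: link_nbs_def)
  ultimately show False
    using three_disjoint[of "link_nbs ?S (f i)" "link_nbs ?S (f j)" "link_nbs ?S w"]
      link_nbs_card[OF rp(1,2) fV(1) rp(3)] link_nbs_card[OF rp(1,2) fV(2) rp(4)] link_nbs_card[OF rp(1,2) w(1,2)] by blast
qed

text \<open>This frees \<open>pair_parity\<close> from the labelling: exchanging two vertices of
  \<open>e\<close> so that an edge results never changes the parity of the number of coloured
  vertices.\<close>

definition edge_parity :: "'a set \<Rightarrow> ('a \<Rightarrow> bool) \<Rightarrow> bool" where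
  "edge_parity e \<chi> \<longleftrightarrow> (\<forall>S x y a b. e = insert y (insert x S) \<longrightarrow> x \<notin> S \<longrightarrow> y \<notin> S \<longrightarrow> x \<noteq> y \<longrightarrow>
     a \<notin> S \<longrightarrow> b \<notin> S \<longrightarrow> a \<noteq> b \<longrightarrow> insert b (insert a S) \<in> E \<longrightarrow> (\<chi> a = \<chi> b) = (\<chi> x = \<chi> y))"

lemma edge_parityD: "edge_parity e \<chi> \<Longrightarrow> e = insert y (insert x S) \<Longrightarrow> x \<notin> S \<Longrightarrow> y \<notin> S \<Longrightarrow> x \<noteq> y \<Longrightarrow>
     a \<notin> S \<Longrightarrow> b \<notin> S \<Longrightarrow> a \<noteq> b \<Longrightarrow> insert b (insert a S) \<in> E \<Longrightarrow> (\<chi> a = \<chi> b) = (\<chi> x = \<chi> y)"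
  unfolding edge_parity_def by blast

lemma edge_parity_imp_pair_parity: assumes state: "state f" and ij: "i \<noteq> j" "i < r" "j < r" and p: "edge_parity (f ` {..<r}) \<chi>" shows "pair_parity f \<chi> i j"
  unfolding pair_parity_def
proof (intro allI impI)
  fix a b assume s: "state (f(i := a, j := b))"
  note rp = rest_props[OF state ij]
  have s1: "b \<in> link_nbs (rest f i j) a" "a \<notin> rest f i j" using state_upd[OF state ij] s by blast+
  have "f i \<noteq> f j" using inj_onD[OF state_inj[OF state], of i j] ij by auto
  then show "(\<chi> a = \<chi> b) = (\<chi> (f i) = \<chi> (f j))"
    using edge_parityD[OF p rp(5) rp(3,4)] s1 by (auto simp: link_nbs_def)
qed

lemma pair_parity_imp_edge_parity: assumes state: "state f" and pair_parity: "\<And>i j. i < r \<Longrightarrow> j < r \<Longrightarrow> i \<noteq> j \<Longrightarrow> pair_parity f \<chi> i j" shows "edge_parity (f ` {..<r}) \<chi>"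
  unfolding edge_parity_def
proof (intro allI impI)
  fix S x y a b assume e: "f ` {..<r} = insert y (insert x S)" and xy: "x \<notin> S" "y \<notin> S" "x \<noteq> y"
    and ab: "a \<notin> S" "b \<notin> S" "a \<noteq> b" "insert b (insert a S) \<in> E"
  have "x \<in> f ` {..<r}" "y \<in> f ` {..<r}" using e by auto
  then obtain i j where ij: "i < r" "j < r" "x = f i" "y = f j" by blast
  then have ne: "i \<noteq> j" using xy by auto
  have "S = insert y (insert x S) - {x, y}" using xy by auto
  also have "\<dots> = rest f i j"
    unfolding e[symmetric] using rest_props(3-5)[OF state ne ij(1,2)] ij by auto
  finally have "S = rest f i j" .
  then have "state (f(i := a, j := b))" unfolding state_def upd_image[OF ne ij(1,2)] using ab by simp
  then show "(\<chi> a = \<chi> b) = (\<chi> x = \<chi> y)" using pair_parity[OF ij(1,2) ne] ij by (simp add: pair_parity_def)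
qed

lemma edge_state: assumes "e \<in> E" shows "\<exists>f. state f \<and> f ` {..<r} = e"
proof -
  have "finite e" using edgeV[OF assms] finV finite_subset by blast
  then obtain f where "bij_betw f {..<r} e"
    using ex_bij_betw_nat_finite[of e] edge_card[OF assms] by (auto simp: atLeast0LessThan)
  then show ?thesis using assms by (auto simp: bij_betw_def state_def)
qed

text \<open>Both colourings control the link graph of \<open>S\<close>, so
  \<open>unique_parity\<close> compares them off \<open>S\<close>. A vertex \<open>u\<close> of
  \<open>S\<close> is handled through a third edge, which contains \<open>b\<close> and
  \<open>x\<close> but not \<open>u\<close>: it arises from \<open>e\<close> by exchanging
  \<open>x'\<close> and \<open>u\<close>, and from \<open>e'\<close> by exchanging \<open>c\<close>
  and \<open>u\<close>.\<close>

lemma glue: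
  assumes E: "e \<in> E" "e' \<in> E" and e: "e = insert x' (insert x S)" "e' = insert c (insert b S)"
    and x: "x \<notin> S" "x' \<notin> S" "x \<noteq> x'" and bc: "b \<notin> S" "c \<notin> S" "b \<noteq> c" and be: "b \<notin> e"
    and p: "edge_parity e \<chi>" "edge_parity e' \<chi>'" and balanced: "balanced \<chi>" "balanced \<chi>'"
  shows "\<exists>d. \<forall>v\<in>V. \<chi>' v = (\<chi> v = d)"
proof -
  have inV: "S \<subseteq> V" "x \<in> V" "x' \<in> V" "b \<in> V" "c \<in> V" using edgeV[OF E(1)] edgeV[OF E(2)] e by auto
  have fS: "finite S" using inV finV finite_subset by blast
  have cS: "card S = r - 2" using edge_card[OF E(1)] e x fS by simp
  obtain d where d: "\<forall>v\<in>V - S. \<chi>' v = (\<chi> v = d)"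
    using unique_parity[OF inV(1) cS edge_parityD[OF p(1) e(1) x(1,2,3)] edge_parityD[OF p(2) e(2) bc(1,2,3)] balanced] by blast
  have "\<chi>' u = (\<chi> u = d)" if u: "u \<in> S" for u
  proof -
    let ?T = "S - {u}"
    let ?Z = "insert b (insert x ?T)"
    have "b \<noteq> x" using be e by auto
    then have "card ?Z = Suc (Suc (r - 2 - 1))" using x bc u fS cS by (simp add: card_Diff_singleton)
    moreover have "r - 2 > 0" using r3 by auto
    ultimately have "card ?Z = r - 1" by linarith
    then have "card V < 3 * card {w \<in> V. w \<notin> ?Z \<and> insert w ?Z \<in> E}" using codeg[of ?Z] inV by auto
    \<comment> \<open>There are more than \<open>2 * r\<close> candidates for the last vertex, so
      one avoids \<open>S\<close>; in particular \<open>w\<close> differs from \<open>u\<close>, and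
      the relation off \<open>S\<close> applies to it.\<close>
    then have c: "card S < card {w \<in> V. w \<notin> ?Z \<and> insert w ?Z \<in> E}" using big cS by linarith
    have "\<not> {w \<in> V. w \<notin> ?Z \<and> insert w ?Z \<in> E} \<subseteq> S" using card_mono[OF fS] c not_less by blast
    then obtain w where w: "w \<in> V" "w \<notin> ?Z" "insert w ?Z \<in> E" "w \<notin> S" by blast
    have "(\<chi> b = \<chi> w) = (\<chi> x' = \<chi> u)"
      by (rule edge_parityD[OF p(1), of u x' "insert x ?T"]) (use e x u w \<open>b \<noteq> x\<close> bc in auto)
    moreover have "(\<chi>' x = \<chi>' w) = (\<chi>' c = \<chi>' u)"
      by (rule edge_parityD[OF p(2), of u c "insert b ?T"]) (use e x u w \<open>b \<noteq> x\<close> bc in \<open>auto simp: insert_commute\<close>)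
    moreover have "(\<chi> b = \<chi> c) = (\<chi> x = \<chi> x')"
      by (rule edge_parityD[OF p(1) e(1) x bc]) (use E e in auto)
    moreover have "\<chi>' x = (\<chi> x = d)" "\<chi>' w = (\<chi> w = d)" "\<chi>' c = (\<chi> c = d)"
      using d inV x bc w by auto
    ultimately show ?thesis by argo
  qed
  then show ?thesis using d by blast
qed

text \<open>Exchanging two vertices at a time leaves one free choice: \<open>b\<close> is taken from
  \<open>e0\<close>, and the codegree condition supplies some \<open>c\<close>. The property passes
  from the edge nearer to \<open>e0\<close> to the farther one, and \<open>b\<close> lies outside
  the latter as \<open>glue\<close> requires.\<close>

lemma edge_connect [consumes 2, case_names base step]:
  assumes e: "e0 \<in> E" "e \<in> E" and base: "P e0"
    and step: "\<And>S x x' b c. insert x' (insert x S) \<in> E \<Longrightarrow> insert c (insert b S) \<in> E \<Longrightarrow>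
      x \<notin> S \<Longrightarrow> x' \<notin> S \<Longrightarrow> x \<noteq> x' \<Longrightarrow> b \<notin> S \<Longrightarrow> c \<notin> S \<Longrightarrow> b \<noteq> c \<Longrightarrow> b \<notin> insert x' (insert x S) \<Longrightarrow>
      P (insert c (insert b S)) \<Longrightarrow> P (insert x' (insert x S))"
  shows "P e"
  using e(2)
proof (induction "card (e0 - e)" arbitrary: e rule: less_induct)
  case less
  have fin: "finite e0" "finite e" using edgeV[OF e(1)] edgeV[OF less.prems] finV finite_subset by blast+
  have ce: "card e = r" "card e0 = r" using edge_card e(1) less.prems by auto
  have cc: "card (e - e0) = card (e0 - e)"
    using ce fin by (metis card_le_sym_Diff le_antisym order_refl)
  show ?case
  proof (cases "e0 - e = {}")
    case True
    then have "e0 = e" using card_subset_eq[OF fin(2)] ce by auto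
    then show ?thesis using base by simp
  next
    case False
    then obtain b where b: "b \<in> e0" "b \<notin> e" by blast
    have "card (e0 - e) \<noteq> 0" using False fin by simp
    then have "e - e0 \<noteq> {}" using cc by (metis card.empty)
    then obtain x where x: "x \<in> e" "x \<notin> e0" by blast
    have "\<exists>x' c. x' \<in> e \<and> x' \<noteq> x \<and> c \<notin> e - {x, x'} \<and> c \<noteq> b \<and> insert c (insert b (e - {x, x'})) \<in> E
       \<and> (e0 - insert c (insert b (e - {x, x'})) \<subseteq> e0 - e - {b})"
    proof (cases "e - e0 = {x}")
      case True
      have "card (e - {x}) = r - 1" using ce x by simp
      then have "card (e - {x}) \<noteq> 0" using r3 by linarith
      then have "e - {x} \<noteq> {}" by (metis card.empty)
      then obtain x' where x': "x' \<in> e" "x' \<noteq> x" by blast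
      \<comment> \<open>The last exchange has to land exactly on \<open>e0\<close>, so a vertex
        \<open>x'\<close> common to both edges is removed and put back in the role of
        \<open>c\<close>.\<close>
      have eq: "insert x' (insert b (e - {x, x'})) = insert b (e - {x})" using x' by auto
      have "card (insert b (e - {x})) = card e0" using b ce x fin r3 by simp
      moreover have c1: "card (e0 - e) = 1" using True cc by simp
      then have "e0 - e = {b}" using b by (metis Diff_iff card_1_singletonE singletonD)
      then have "e0 \<subseteq> insert b (e - {x})" using x by auto
      ultimately have "e0 = insert b (e - {x})" using fin by (metis card_subset_eq finite_Diff finite_insert)
      then show ?thesis using x' eq e(1) b by (intro exI[of _ x']) auto
    next
      case False
      then obtain x' where x': "x' \<in> e" "x' \<noteq> x" "x' \<notin> e0" using x by blast
      let ?S = "e - {x, x'}"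
      have "card ?S = r - 2" using ce x x' by (simp add: card_Diff_subset)
      then have "card (insert b ?S) = r - 1" using b fin r3 by simp
      moreover have "insert b ?S \<subseteq> V" using edgeV[OF e(1)] edgeV[OF less.prems] b by auto
      ultimately have "card V < 3 * card {v \<in> V. v \<notin> insert b ?S \<and> insert v (insert b ?S) \<in> E}" using codeg by blast
      then have "{v \<in> V. v \<notin> insert b ?S \<and> insert v (insert b ?S) \<in> E} \<noteq> {}" by (metis card.empty mult_0_right not_less_zero)
      then obtain c where c: "c \<notin> insert b ?S" "insert c (insert b ?S) \<in> E" by blast
      then show ?thesis using x' x by (intro exI[of _ x'] exI[of _ c]) auto
    qed
    then obtain x' c where x': "x' \<in> e" "x' \<noteq> x" and c: "c \<notin> e - {x, x'}" "c \<noteq> b"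
      and E': "insert c (insert b (e - {x, x'})) \<in> E"
      and sub: "e0 - insert c (insert b (e - {x, x'})) \<subseteq> e0 - e - {b}" by blast
    have "card (e0 - insert c (insert b (e - {x, x'}))) \<le> card (e0 - e - {b})"
      using sub fin by (intro card_mono) auto
    also have "\<dots> < card (e0 - e)" using b fin by (intro psubset_card_mono) auto
    finally have IH: "P (insert c (insert b (e - {x, x'})))" using less.hyps E' by blast
    have ee: "insert x' (insert x (e - {x, x'})) = e" using x x' by auto
    show ?thesis
      using step[of x' x "e - {x, x'}" c b] ee less.prems E' IH c b x' by auto
  qed
qed

text \<open>The 3-cycle on \<open>i\<close>, \<open>j\<close>, \<open>k\<close> conjugates
  \<open>transpose i l\<close> into \<open>transpose j l\<close>, which would put \<open>i\<close>
  and \<open>j\<close> into one block through \<open>l\<close>.\<close>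

lemma no_partner:
  assumes state: "state f" and d: "i \<noteq> j" "j \<noteq> k" "i \<noteq> k" and lt: "i < r" "j < r" "k < r"
    and n: "\<not> swappable f i j" "\<not> swappable f j k" "\<not> swappable f i k" and l: "l < r" "l \<noteq> i" "swappable f i l"
  shows False
proof -
  have "l \<noteq> j" "l \<noteq> k" using l n by auto
  let ?\<rho> = "transpose i j \<circ> transpose j k"
  have c: "conn f (f \<circ> ?\<rho>)" by (rule three_cycle[OF state d lt n])
  have p: "?\<rho> permutes {..<r}" "inv ?\<rho> permutes {..<r}"
    using permutes_compose[OF transpose_permutes[OF lt(2,3)] transpose_permutes[OF lt(1,2)]] permutes_inv by blast+
  have tp: "transpose i l permutes {..<r}" using transpose_permutes[OF lt(1) l(1)] .
  have "conn f (f \<circ> (?\<rho> \<circ> (transpose i l \<circ> inv ?\<rho>)))"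
    using monodromy_comp[OF c monodromy_comp[OF l(3) monodromy_inv[OF c p(1)] p(2)] permutes_compose[OF p(2) tp]] .
  moreover have "?\<rho> \<circ> (transpose i l \<circ> inv ?\<rho>) = transpose j l"
  proof -
    have "?\<rho> \<circ> transpose i l = transpose j l \<circ> ?\<rho>"
      using d \<open>l \<noteq> j\<close> \<open>l \<noteq> k\<close> l(2) by (auto simp: fun_eq_iff transpose_def)
    then have "?\<rho> \<circ> transpose i l \<circ> inv ?\<rho> = transpose j l \<circ> ?\<rho> \<circ> inv ?\<rho>" by (rule arg_cong)
    also have "\<dots> = transpose j l \<circ> (?\<rho> \<circ> inv ?\<rho>)" by (rule comp_assoc)
    also have "\<dots> = transpose j l" unfolding permutes_inv_o(1)[OF p(1)] by simp
    finally show ?thesis unfolding comp_assoc .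
  qed
  ultimately have "swappable f j l" by simp
  then have "swappable f l j" by (rule swappable_sym)
  then show False using swappable_trans[OF l(3) _ lt(1) l(1) lt(2)] n by blast
qed

text \<open>The three link graphs do not see the other vertices of the labelled edge, so the
  colouring of \<open>mixed_triple\<close> can be overwritten there by the block function
  \<open>c\<close>, after a complement if \<open>c i\<close> is false. Colourings obtained from
  different triples thereby become comparable.\<close>

lemma normalised_triple_aux:
  assumes state: "state f" and c: "\<forall>p<r. \<forall>q<r. swappable f p q \<longleftrightarrow> c p = c q"
    and d: "i \<noteq> j" "j \<noteq> k" "i \<noteq> k" and lt: "i < r" "j < r" "k < r" and cc: "c i = c j" "c i \<noteq> c k"
  shows "\<exists>\<chi>. balanced \<chi> \<and> (\<forall>p<r. \<chi> (f p) = c p) \<and> pair_parity f \<chi> i j \<and> pair_parity f \<chi> j k \<and> pair_parity f \<chi> i k"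
proof -
  have "swappable f i j" "\<not> swappable f i k" using c cc lt by blast+
  from mixed_triple[OF state d lt this] obtain \<chi> where
    x: "\<chi> (f i)" "\<chi> (f j)" "\<not> \<chi> (f k)" "pair_parity f \<chi> i j" "pair_parity f \<chi> j k" "pair_parity f \<chi> i k"
      "card V < 3 * card {v \<in> V. \<chi> v}" "card V < 3 * card {v \<in> V. \<not> \<chi> v}" by blast
  note inj = state_inj[OF state]
  let ?F = "f ` {..<r}"
  define \<chi>' where "\<chi>' v = (if v \<in> ?F then c (inv_into {..<r} f v) else (\<chi> v = c i))" for v
  have n: "\<chi>' (f p) = c p" if "p < r" for p using that inj by (auto simp: \<chi>'_def inv_into_f_f)
  have e: "\<chi>' v = (\<chi> v = c i)" if "v \<notin> ?F \<or> v \<in> {f i, f j, f k}" for v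
    using that
  proof
    assume "v \<notin> ?F" then show ?thesis by (simp add: \<chi>'_def)
  next
    assume "v \<in> {f i, f j, f k}" then show ?thesis using n lt cc x by auto
  qed
  have r: "v \<notin> ?F \<or> v \<in> {f i, f j, f k}" if "v \<notin> rest f p q" "{p, q} \<subseteq> {i, j, k}" for v p q
    using that by (auto simp: rest_def)
  have "pair_parity f \<chi>' i j" "pair_parity f \<chi>' j k" "pair_parity f \<chi>' i k"
    by (rule pair_parity_transfer[OF state d(1) lt(1,2) x(4), of \<chi>' "c i"] pair_parity_transfer[OF state d(2) lt(2,3) x(5), of \<chi>' "c i"]
       pair_parity_transfer[OF state d(3) lt(1,3) x(6), of \<chi>' "c i"], rule e, erule r, simp)+
  moreover have "balanced \<chi>'"
  proof -
    have F: "finite ?F" "card ?F \<le> r" using card_image_le[of "{..<r}" f] by auto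
    have b: "r < card {v \<in> V. \<chi>' v = t}" for t
    proof -
      have "card V < 3 * card {v \<in> V. \<chi> v = (t = c i)}" using x(7,8) by (cases "t = c i") auto
      then have "2 * r < card {v \<in> V. \<chi> v = (t = c i)}" using big by linarith
      moreover have "card {v \<in> V. \<chi> v = (t = c i)} - card ?F \<le> card ({v \<in> V. \<chi> v = (t = c i)} - ?F)"
        using diff_card_le_card_Diff[OF F(1)] by blast
      moreover have "card ({v \<in> V. \<chi> v = (t = c i)} - ?F) \<le> card {v \<in> V. \<chi>' v = t}"
        using finV e by (intro card_mono) auto
      ultimately show ?thesis using F(2) by linarith
    qed
    show ?thesis using b[of True] b[of False] by (simp add: balanced_def)
  qed
  ultimately show ?thesis using n by blast
qed

lemma normalised_triple:
  assumes state: "state f" and c: "\<forall>p<r. \<forall>q<r. swappable f p q \<longleftrightarrow> c p = c q"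
    and d: "i \<noteq> j" "j \<noteq> k" "i \<noteq> k" and lt: "i < r" "j < r" "k < r" and cc: "\<not> (c i = c j \<and> c j = c k)"
  shows "\<exists>\<chi>. balanced \<chi> \<and> (\<forall>p<r. \<chi> (f p) = c p) \<and> pair_parity f \<chi> i j \<and> pair_parity f \<chi> j k \<and> pair_parity f \<chi> i k"
proof -
  consider "c i = c j" "c i \<noteq> c k" | "c j = c k" "c j \<noteq> c i" | "c i = c k" "c i \<noteq> c j" using cc by blast
  then show ?thesis
  proof cases
    case 1 then show ?thesis using normalised_triple_aux[OF state c d lt] by blast
  next
    case 2
    show ?thesis using normalised_triple_aux[OF state c d(2) d(3)[symmetric] d(1)[symmetric] lt(2,3,1) 2]
      pair_parity_sym[of k i] pair_parity_sym[of j i] d by metis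
  next
    case 3
    show ?thesis using normalised_triple_aux[OF state c d(3) d(2)[symmetric] d(1) lt(1,3,2) 3]
      pair_parity_sym[of k j] d by metis
  qed
qed

text \<open>One common pair of positions suffices: \<open>unique_parity\<close> compares the
  colourings up to complement off the remaining vertices of the edge, the vertex \<open>f p\<close>
  rules out the complement, and the remaining vertices are normalised.\<close>

lemma normalised_agree:
  assumes state: "state f" and pq: "p \<noteq> q" "p < r" "q < r" and b: "balanced \<chi>" "balanced \<chi>'"
    and n: "\<forall>p<r. \<chi> (f p) = c p" "\<forall>p<r. \<chi>' (f p) = c p" and pair_parity: "pair_parity f \<chi> p q" "pair_parity f \<chi>' p q" and v: "v \<in> V"
  shows "\<chi>' v = \<chi> v"
proof -
  note rp = rest_props[OF state pq]
  have u: "\<exists>d. \<forall>v\<in>V - rest f p q. \<chi>' v = (\<chi> v = d)"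
  proof (rule unique_parity[OF rp(1,2) _ _ b])
    fix a b' assume "a \<notin> rest f p q" "b' \<notin> rest f p q" "a \<noteq> b'" "insert b' (insert a (rest f p q)) \<in> E"
    then have "state (f(p := a, q := b'))" unfolding state_def upd_image[OF pq] by simp
    then show "(\<chi> a = \<chi> b') = (\<chi> (f p) = \<chi> (f q))" "(\<chi>' a = \<chi>' b') = (\<chi>' (f p) = \<chi>' (f q))"
      using pair_parity unfolding pair_parity_def by blast+
  qed
  then obtain d where d: "\<forall>v\<in>V - rest f p q. \<chi>' v = (\<chi> v = d)" by blast
  have "\<chi>' (f p) = (\<chi> (f p) = d)" using d rp(3) state_V[OF state pq(2)] by blast
  then have d1: "d" using n pq by (cases "c p") auto
  show ?thesis
  proof (cases "v \<in> rest f p q")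
    case True then show ?thesis using n by (auto simp: rest_def)
  next
    case False then show ?thesis using d d1 v by blast
  qed
qed

section \<open>Consequences of an even permutation that lies in no monodromy group\<close>

context
  fixes \<sigma> :: "nat \<Rightarrow> nat"
  assumes perm_sigma: "\<sigma> permutes {..<r}" and even_sigma: "evenperm \<sigma>"
    and no_monodromy: "\<And>f. state f \<Longrightarrow> \<not> conn f (f \<circ> \<sigma>)"
begin

text \<open>A single block would yield \<open>\<sigma>\<close> from transpositions, and singletons
  alone would yield it from 3-cycles. If there were three blocks, some position \<open>p\<close>
  with a partner would exist, and at least two of the three representatives would lie outside its
  block, against \<open>no_partner\<close>.\<close>

lemma two_blocks:
  assumes state: "state f"
  shows "\<exists>c i0 k0. i0 < r \<and> k0 < r \<and> c i0 \<and> \<not> c k0 \<and> (\<forall>p<r. \<forall>q<r. swappable f p q \<longleftrightarrow> c p = c q)"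
proof -
  have "\<exists>i<r. \<exists>k<r. \<not> swappable f i k"
  proof (rule ccontr)
    assume "\<not> ?thesis"
    then have "\<And>i. i < r \<Longrightarrow> swappable f i (\<sigma> i)" using permutes_in_image[OF perm_sigma] by (metis lessThan_iff)
    from monodromy_blocks[OF perm_sigma this] no_monodromy[OF state] show False by blast
  qed
  then obtain i0 k0 where ik: "i0 < r" "k0 < r" "\<not> swappable f i0 k0" by blast
  have "\<exists>p<r. \<exists>q<r. p \<noteq> q \<and> swappable f p q"
  proof (rule ccontr)
    assume "\<not> ?thesis"
    then have "conn f (f \<circ> \<sigma>)" using three_cycle[OF state] by (intro monodromy_even[OF _ perm_sigma even_sigma]) blast
    then show False using no_monodromy[OF state] by blast
  qed
  then obtain p q where pq: "p < r" "q < r" "p \<noteq> q" "swappable f p q" by blast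
  have triple: False if lt: "i < r" "j < r" "k < r" and n: "\<not> swappable f i j" "\<not> swappable f j k" "\<not> swappable f i k" for i j k
  proof -
    have ps: "False" if ab: "a < r" "b < r" "\<not> swappable f a b" "\<not> swappable f p a" "\<not> swappable f p b" for a b
    proof -
      have "a \<noteq> b" "p \<noteq> a" "p \<noteq> b" using ab by (metis swappable_refl)+
      then show False using no_partner[OF state _ _ _ pq(1) ab(1,2) _ _ _ pq(2) _ pq(4)] ab pq(3) by blast
    qed
    show False
    proof (cases "swappable f p i")
      case True
      then have "\<not> swappable f p j" "\<not> swappable f p k"
        using n swappable_trans[OF swappable_sym[OF True]] pq(1) lt by blast+
      then show False using ps[OF lt(2,3) n(2)] by blast
    next
      case F: False
      show False
      proof (cases "swappable f p j")
        case True
        then have "\<not> swappable f p k" using n swappable_trans[OF swappable_sym[OF True]] pq(1) lt by blast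
        then show False using ps[OF lt(1,3) n(3)] F by blast
      next
        case False
        then show False using ps[OF lt(1,2) n(1)] F by blast
      qed
    qed
  qed
  have "swappable f a b \<longleftrightarrow> swappable f i0 a = swappable f i0 b" if ab: "a < r" "b < r" for a b
  proof (cases "swappable f i0 a"; cases "swappable f i0 b")
    assume 1: "swappable f i0 a" "swappable f i0 b"
    show ?thesis using swappable_trans[OF swappable_sym[OF 1(1)] 1(2) ab(1) ik(1) ab(2)] 1 by blast
  next
    assume 1: "swappable f i0 a" "\<not> swappable f i0 b"
    show ?thesis using swappable_trans[OF 1(1) _ ik(1) ab] 1 by blast
  next
    assume 1: "\<not> swappable f i0 a" "swappable f i0 b"
    show ?thesis using swappable_trans[OF 1(2) _ ik(1) ab(2,1)] 1 swappable_sym by blast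
  next
    assume 1: "\<not> swappable f i0 a" "\<not> swappable f i0 b"
    have "swappable f a k0" "swappable f b k0"
      using triple[OF ik(1) ab(1) ik(2)] triple[OF ik(1) ab(2) ik(2)] ik(3) 1 by blast+
    then have "swappable f a b" using swappable_trans[OF _ _ ab(1) ik(2) ab(2)] swappable_sym by blast
    then show ?thesis using 1 by blast
  qed
  then have "\<forall>p<r. \<forall>q<r. swappable f p q \<longleftrightarrow> swappable f i0 p = swappable f i0 q" by blast
  with ik swappable_refl[of f i0] show ?thesis by (intro exI[of _ "swappable f i0"] exI[of _ i0] exI[of _ k0] conjI)
qed

text \<open>All triples through \<open>i0\<close> and \<open>k0\<close>, chosen from different
  blocks, give one normalised colouring because they share that pair. A pair \<open>p\<close>,
  \<open>q\<close> avoiding both is completed by whichever of \<open>i0\<close>, \<open>k0\<close>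
  lies in the other block than \<open>p\<close>; that triple is mixed and shares the pair
  \<open>p\<close>, \<open>t\<close> with the colouring already found.\<close>

lemma local_parity: assumes state: "state f" shows "\<exists>\<chi>. balanced \<chi> \<and> edge_parity (f ` {..<r}) \<chi>"
proof -
  obtain c i0 k0 where ik: "i0 < r" "k0 < r" "c i0" "\<not> c k0" and c: "\<forall>p<r. \<forall>q<r. swappable f p q \<longleftrightarrow> c p = c q"
    using two_blocks[OF state] by (elim exE conjE)
  have ne: "i0 \<noteq> k0" using ik by auto
  have T: "\<exists>\<chi>. balanced \<chi> \<and> (\<forall>p<r. \<chi> (f p) = c p) \<and> pair_parity f \<chi> i0 k0 \<and> pair_parity f \<chi> k0 l \<and> pair_parity f \<chi> i0 l"
    if l: "l < r" "l \<noteq> i0" "l \<noteq> k0" for l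
  proof -
    have "\<not> (c i0 = c k0 \<and> c k0 = c l)" using ik by blast
    then show ?thesis using normalised_triple[OF state c ne l(3)[symmetric] l(2)[symmetric] ik(1,2) l(1)] by blast
  qed
  have "card ({..<r} - {i0, k0}) = r - 2" using ik ne by (simp add: card_Diff_subset)
  then have "card ({..<r} - {i0, k0}) \<noteq> 0" using r3 by linarith
  then have "{..<r} - {i0, k0} \<noteq> {}" by (metis card.empty)
  then obtain l0 where l0: "l0 < r" "l0 \<noteq> i0" "l0 \<noteq> k0" by auto
  obtain \<chi> where x: "balanced \<chi>" "\<forall>p<r. \<chi> (f p) = c p" "pair_parity f \<chi> i0 k0" using T[OF l0] by blast
  have trans: "pair_parity f \<chi> p q" if "p \<noteq> q" "p < r" "q < r" "pair_parity f \<chi>' p q" "\<forall>v\<in>V. \<chi>' v = \<chi> v" for \<chi>' p q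
    by (rule pair_parity_transfer[OF state that(1-4), of \<chi> True]) (use that(5) in auto)
  have base: "pair_parity f \<chi> k0 l \<and> pair_parity f \<chi> i0 l" if l: "l < r" "l \<noteq> i0" "l \<noteq> k0" for l
  proof -
    obtain \<chi>' where y: "balanced \<chi>'" "\<forall>p<r. \<chi>' (f p) = c p" "pair_parity f \<chi>' i0 k0" "pair_parity f \<chi>' k0 l" "pair_parity f \<chi>' i0 l"
      using T[OF l] by blast
    have "\<forall>v\<in>V. \<chi>' v = \<chi> v" using normalised_agree[OF state ne ik(1,2) x(1) y(1) x(2) y(2) x(3) y(3)] by blast
    then show ?thesis using trans[OF _ _ _ y(4)] trans[OF _ _ _ y(5)] l ik by auto
  qed
  have "pair_parity f \<chi> p q" if pq: "p < r" "q < r" "p \<noteq> q" for p q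
  proof -
    have sp: "pair_parity f \<chi> p q" if "p < r" "q < r" "p \<noteq> q" "p \<in> {i0, k0}" for p q
    proof (cases "q \<in> {i0, k0}")
      case True then show ?thesis using x(3) pair_parity_sym[OF ne x(3)] that by auto
    next
      case False then show ?thesis using base[of q] that by auto
    qed
    show ?thesis
    proof (cases "p \<in> {i0, k0} \<or> q \<in> {i0, k0}")
      case True then show ?thesis using sp pq pair_parity_sym[of q p] by blast
    next
      case False
      define t where "t = (if c p then k0 else i0)"
      have t: "t < r" "t \<in> {i0, k0}" "t \<noteq> p" "t \<noteq> q" "c t \<noteq> c p" using ik False by (auto simp: t_def)
      obtain \<chi>' where y: "balanced \<chi>'" "\<forall>p<r. \<chi>' (f p) = c p" "pair_parity f \<chi>' p q" "pair_parity f \<chi>' p t"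
        using normalised_triple[OF state c pq(3) t(4)[symmetric] t(3)[symmetric] pq(1,2) t(1)] t(5) by blast
      have "pair_parity f \<chi> p t" using sp[of t p] t pq pair_parity_sym[of t p] by blast
      then have "\<forall>v\<in>V. \<chi>' v = \<chi> v"
        using normalised_agree[OF state t(3)[symmetric] pq(1) t(1) x(1) y(1) x(2) y(2) _ y(4)] by blast
      then show ?thesis using trans[OF pq(3,1,2) y(3)] by blast
    qed
  qed
  then show ?thesis using pair_parity_imp_edge_parity[OF state] x(1) by blast
qed

text \<open>A complement does not affect \<open>edge_parity\<close>, so the colouring of one edge
  serves for all others once \<open>glue\<close> has been carried along \<open>edge_connect\<close>.
  The same exchanges then keep the parity of the number of coloured vertices.\<close>

lemma global_parity:
  "\<exists>\<chi> \<kappa>. balanced \<chi> \<and> (\<forall>e\<in>E. edge_parity e \<chi>) \<and> (\<forall>e\<in>E. even (card {v \<in> e. \<chi> v}) = \<kappa>)"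
proof (cases "E = {}")
  case True
  have "r - 1 \<le> card V" using big by linarith
  then obtain S where "S \<subseteq> V" "card S = r - 1" by (rule obtain_subset_with_card_n)
  then show ?thesis using codeg[of S] True by simp
next
  case False
  then obtain e0 where e0: "e0 \<in> E" by blast
  have "\<forall>e\<in>E. \<exists>\<chi>. balanced \<chi> \<and> edge_parity e \<chi>" using local_parity edge_state by metis
  then obtain ch where ch: "\<And>e. e \<in> E \<Longrightarrow> balanced (ch e)" "\<And>e. e \<in> E \<Longrightarrow> edge_parity e (ch e)" using bchoice[of E] by metis
  let ?c = "ch e0"
  have pt: "edge_parity e ?c" if e: "e \<in> E" "\<exists>d. \<forall>v\<in>V. ch e v = (?c v = d)" for e
    unfolding edge_parity_def
  proof (intro allI impI)
    fix S x y a b assume a: "e = insert y (insert x S)" "x \<notin> S" "y \<notin> S" "x \<noteq> y" "a \<notin> S" "b \<notin> S" "a \<noteq> b"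
      "insert b (insert a S) \<in> E"
    have "(ch e a = ch e b) = (ch e x = ch e y)" by (rule edge_parityD[OF ch(2)[OF e(1)] a])
    moreover have "a \<in> V" "b \<in> V" "x \<in> V" "y \<in> V" using edgeV[OF a(8)] edgeV[OF e(1)] a(1) by auto
    ultimately show "(?c a = ?c b) = (?c x = ?c y)" using e(2) by metis
  qed
  have main: "(\<exists>d. \<forall>v\<in>V. ch e v = (?c v = d)) \<and> even (card {v \<in> e. ?c v}) = even (card {v \<in> e0. ?c v})"
    if e: "e \<in> E" for e
    using e0 e
  proof (induction rule: edge_connect)
    case base show ?case by (auto intro: exI[of _ True])
  next
    case (step S x x' b c)
    let ?e = "insert x' (insert x S)" and ?e' = "insert c (insert b S)"
    obtain d where d: "\<forall>v\<in>V. ch ?e' v = (ch ?e v = d)"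
      using glue[OF step.hyps(1,2) refl refl step.hyps(3-9) ch(2)[OF step.hyps(1)] ch(2)[OF step.hyps(2)]
        ch(1)[OF step.hyps(1)] ch(1)[OF step.hyps(2)]] by blast
    obtain d' where "\<forall>v\<in>V. ch ?e' v = (?c v = d')" using step.IH by blast
    then have "\<forall>v\<in>V. ch ?e v = (?c v = (d = d'))" using d by auto
    then have 1: "\<exists>d. \<forall>v\<in>V. ch ?e v = (?c v = d)" by blast
    have "(?c b = ?c c) = (?c x = ?c x')"
      using edge_parityD[OF pt[OF step.hyps(1) 1] refl step.hyps(3,4,5,6,7,8,2)] .
    moreover have "finite S" using edgeV[OF step.hyps(1)] finV finite_subset by auto
    ultimately have "even (card {v \<in> ?e. ?c v}) = even (card {v \<in> ?e'. ?c v})"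
      using card_filter_insert2[OF _ step.hyps(3,4,5), of ?c] card_filter_insert2[OF _ step.hyps(6,7,8), of ?c]
      by (cases "?c x"; cases "?c x'"; cases "?c b"; cases "?c c") auto
    then show ?case using 1 step.IH by blast
  qed
  show ?thesis
  proof (intro exI conjI ballI)
    show "balanced ?c" by (rule ch(1)[OF e0])
    show "edge_parity e ?c" if "e \<in> E" for e using pt[OF that conjunct1[OF main[OF that]]] .
    show "even (card {v \<in> e. ?c v}) = even (card {v \<in> e0. ?c v})" if "e \<in> E" for e
      using main[OF that] by blast
  qed
qed

text \<open>If the colour classes of some labelled edge occupy an invariant set of positions and its
  complement, then \<open>\<sigma>\<close> moves each position within its colour, and by
  \<open>same_side_swappable\<close> it is a product of available transpositions.\<close>

lemma invariant_set_even:
  assumes P: "P \<subseteq> {..<r}" "odd (card P)" and inv: "\<And>i. i < r \<Longrightarrow> \<sigma> i \<in> P \<longleftrightarrow> i \<in> P"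
  shows False
proof -
  obtain \<chi> \<kappa> where b: "balanced \<chi>" and p: "\<And>e. e \<in> E \<Longrightarrow> edge_parity e \<chi>"
    and k: "\<And>e. e \<in> E \<Longrightarrow> even (card {v \<in> e. \<chi> v}) = \<kappa>" using global_parity by blast
  \<comment> \<open>Of the two invariant sets \<open>{}\<close> and \<open>P\<close>, this is the
    one whose size has the parity common to all edges.\<close>
  define Q where "Q = (if \<kappa> then {} else P)"
  have Q: "Q \<subseteq> {..<r}" "even (card Q) = \<kappa>" "\<And>i. i < r \<Longrightarrow> \<sigma> i \<in> Q \<longleftrightarrow> i \<in> Q"
    using P inv by (auto simp: Q_def)
  have cQ: "card Q \<le> r" using card_mono[OF finite_lessThan Q(1)] by simp
  \<comment> \<open>The colour of the vertex \<open>w\<close> that completes the edge cannot be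
    chosen but is forced by parity. Starting from \<open>card Q - 1\<close> coloured vertices, which
    truncated subtraction turns into none for empty \<open>Q\<close>, the total comes out as
    \<open>card Q\<close> either way.\<close>
  have "card Q - 1 \<le> card {v \<in> V. \<chi> v}" using b cQ unfolding balanced_def by linarith
  then obtain A where A: "A \<subseteq> {v \<in> V. \<chi> v}" "card A = card Q - 1" by (rule obtain_subset_with_card_n)
  have "r - 1 - card A \<le> card {v \<in> V. \<not> \<chi> v}" using b unfolding balanced_def by linarith
  then obtain B where B: "B \<subseteq> {v \<in> V. \<not> \<chi> v}" "card B = r - 1 - card A" by (rule obtain_subset_with_card_n)
  have AB: "A \<subseteq> V" "B \<subseteq> V" "A \<inter> B = {}" using A(1) B(1) by auto
  have fin: "finite A" "finite B" using AB finV finite_subset by blast+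
  have "card (A \<union> B) = r - 1" using card_Un_disjoint[OF fin AB(3)] A(2) B(2) cQ by linarith
  moreover have "A \<union> B \<subseteq> V" using AB by auto
  ultimately have "card V < 3 * card {v \<in> V. v \<notin> A \<union> B \<and> insert v (A \<union> B) \<in> E}" using codeg by blast
  then have "{v \<in> V. v \<notin> A \<union> B \<and> insert v (A \<union> B) \<in> E} \<noteq> {}" by (metis card.empty mult_0_right not_less_zero)
  then obtain w where w: "w \<notin> A \<union> B" "insert w (A \<union> B) \<in> E" by blast
  let ?e = "insert w (A \<union> B)"
  have "{v \<in> ?e. \<chi> v} = (if \<chi> w then insert w A else A)" using A B by auto
  then have "card {v \<in> ?e. \<chi> v} = card Q - 1 + of_bool (\<chi> w)" using w fin A by auto
  then have cX: "card {v \<in> ?e. \<chi> v} = card Q" using k[OF w(2)] Q(2) by (cases "card Q"; cases "\<chi> w") auto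
  have fe: "finite ?e" using fin by simp
  have cY: "card {v \<in> ?e. \<not> \<chi> v} = card ({..<r} - Q)"
  proof -
    have "{v \<in> ?e. \<not> \<chi> v} = ?e - {v \<in> ?e. \<chi> v}" by auto
    then have "card {v \<in> ?e. \<not> \<chi> v} = r - card Q"
      using card_Diff_subset[of "{v \<in> ?e. \<chi> v}" ?e] fe edge_card[OF w(2)] cX by auto
    then show ?thesis using card_Diff_subset[of Q "{..<r}"] Q(1) finite_subset[OF Q(1)] by auto
  qed
  obtain g where g: "bij_betw g Q {v \<in> ?e. \<chi> v}"
    using finite_same_card_bij[of Q "{v \<in> ?e. \<chi> v}"] cX fe finite_subset[OF Q(1)] by auto
  obtain h where h: "bij_betw h ({..<r} - Q) {v \<in> ?e. \<not> \<chi> v}"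
    using finite_same_card_bij[of "{..<r} - Q" "{v \<in> ?e. \<not> \<chi> v}"] cY fe by auto
  define f where "f i = (if i \<in> Q then g i else h i)" for i
  have gi: "g ` Q = {v \<in> ?e. \<chi> v}" and hi: "h ` ({..<r} - Q) = {v \<in> ?e. \<not> \<chi> v}"
    using g h by (auto simp: bij_betw_def)
  have "f ` {..<r} = g ` Q \<union> h ` ({..<r} - Q)" using Q(1) by (auto simp: f_def image_iff)
  then have fe': "f ` {..<r} = ?e" unfolding gi hi by auto
  then have state: "state f" using w(2) by (simp add: state_def)
  have ch: "\<chi> (f i) \<longleftrightarrow> i \<in> Q" if "i < r" for i
    using gi hi that by (auto simp: f_def)
  have "conn f (f \<circ> \<sigma>)"
  proof (rule monodromy_blocks[OF perm_sigma])
    fix i assume i: "i < r"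
    have si: "\<sigma> i < r" using permutes_in_image[OF perm_sigma] i by simp
    show "swappable f i (\<sigma> i)"
    proof (cases "i = \<sigma> i")
      case True then show ?thesis using swappable_refl by metis
    next
      case False
      have "edge_parity (f ` {..<r}) \<chi>" unfolding fe' by (rule p[OF w(2)])
      from same_side_swappable[OF state False i si b edge_parity_imp_pair_parity[OF state False i si this]]
      show ?thesis using ch[OF i] ch[OF si] Q(3)[OF i] by blast
    qed
  qed
  then show False using no_monodromy[OF state] by blast
qed

end

theorem exists_monodromy:
  assumes "\<sigma> permutes {..<r}" "evenperm \<sigma>" "P \<subseteq> {..<r}" "odd (card P)" "\<And>i. i < r \<Longrightarrow> \<sigma> i \<in> P \<longleftrightarrow> i \<in> P"
  shows "\<exists>f. state f \<and> conn f (f \<circ> \<sigma>)"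
  using invariant_set_even[of \<sigma> P] assms by blast

end

section \<open>Closed tight walks of bounded length\<close>

text \<open>Balls around sufficiently spaced points of a geodesic are disjoint, which bounds its length.\<close>

lemma short_path:
  fixes R :: "'b \<Rightarrow> 'b \<Rightarrow> bool"
  assumes sym: "\<And>x y. R x y \<Longrightarrow> R y x" and fin: "finite \<Omega>"
    and B: "\<And>x. R\<^sup>*\<^sup>* x0 x \<Longrightarrow> B x \<subseteq> \<Omega> \<and> B x \<noteq> {} \<and> card \<Omega> \<le> M * card (B x)"
    and near: "\<And>x y. R\<^sup>*\<^sup>* x0 x \<Longrightarrow> y \<in> B x \<Longrightarrow> \<exists>k\<le>\<rho>. (R ^^ k) x y"
    and y: "R\<^sup>*\<^sup>* x0 y"
  shows "\<exists>d\<le>(2 * \<rho> + 1) * M. (R ^^ d) x0 y"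
proof -
  define d where "d = (LEAST d. (R ^^ d) x0 y)"
  have d: "(R ^^ d) x0 y" unfolding d_def using y rtranclp_imp_relpowp LeastI_ex[of "\<lambda>d. (R ^^ d) x0 y"] by metis
  have least: "d \<le> e" if "(R ^^ e) x0 y" for e unfolding d_def using that by (rule Least_le)
  have rsym: "(R ^^ k) u v \<Longrightarrow> (R ^^ k) v u" for k u v
  proof (induction k arbitrary: v)
    case (Suc k)
    then obtain w where "(R ^^ k) u w" "R w v" by auto
    then show ?case using Suc.IH sym relpowp_Suc_I2 by metis
  qed simp
  have radd: "(R ^^ a) u v \<Longrightarrow> (R ^^ b) v w \<Longrightarrow> (R ^^ (a + b)) u w" for a b u v w
    unfolding relpowp_add by blast
  obtain f where f: "f 0 = x0" "f d = y" "\<And>i. i < d \<Longrightarrow> R (f i) (f (Suc i))"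
    using d unfolding relpowp_fun_conv by blast
  have seg: "(R ^^ n) (f i) (f (i + n))" if "i + n \<le> d" for i n
    using that
  proof (induction n)
    case (Suc n) then show ?case using f(3)[of "i + n"] by (auto intro: relpowp_Suc_I)
  qed simp
  have reach: "R\<^sup>*\<^sup>* x0 (f i)" if "i \<le> d" for i
    using seg[of 0 i] that f(1) relpowp_imp_rtranclp by fastforce
  have "d \<le> (2 * \<rho> + 1) * M"
  proof (rule ccontr)
    assume big: "\<not> ?thesis"
    \<comment> \<open>There are \<open>M + 1\<close> centres. A point common to two balls would give
      a detour of length at most \<open>2 * \<rho>\<close> between centres at distance at least
      \<open>2 * \<rho> + 1\<close>, whereas each ball fills a fraction \<open>1 / M\<close> of
      \<open>\<Omega>\<close>.\<close>
    define z where "z t = f ((2 * \<rho> + 1) * t)" for t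
    have le: "(2 * \<rho> + 1) * t \<le> d" if "t \<le> M" for t
      using mult_le_mono2[OF that, of "2 * \<rho> + 1"] big by linarith
    have rz: "R\<^sup>*\<^sup>* x0 (z t)" if "t \<le> M" for t unfolding z_def using reach[OF le[OF that]] .
    have dis: "B (z s) \<inter> B (z t) = {}" if state: "s < t" "t \<le> M" for s t
    proof (rule ccontr)
      assume "B (z s) \<inter> B (z t) \<noteq> {}"
      then obtain b where b: "b \<in> B (z s)" "b \<in> B (z t)" by blast
      obtain k1 k2 where k: "k1 \<le> \<rho>" "(R ^^ k1) (z s) b" "k2 \<le> \<rho>" "(R ^^ k2) (z t) b"
        using near[OF rz b(1)] near[OF rz b(2)] state by auto
      have 1: "(R ^^ ((2 * \<rho> + 1) * s)) x0 (z s)" using seg[of 0 "(2 * \<rho> + 1) * s"] le[of s] state f(1) by (simp add: z_def)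
      have 2: "(R ^^ (d - (2 * \<rho> + 1) * t)) (z t) y"
        using seg[of "(2 * \<rho> + 1) * t" "d - (2 * \<rho> + 1) * t"] le[of t] state f(2) by (simp add: z_def)
      have "(R ^^ ((2 * \<rho> + 1) * s + (k1 + (k2 + (d - (2 * \<rho> + 1) * t))))) x0 y"
        by (rule radd[OF 1 radd[OF k(2) radd[OF rsym[OF k(4)] 2]]])
      from least[OF this] have "d \<le> (2 * \<rho> + 1) * s + (2 * \<rho> + (d - (2 * \<rho> + 1) * t))" using k by linarith
      moreover have "(2 * \<rho> + 1) * s + (2 * \<rho> + 1) \<le> (2 * \<rho> + 1) * t"
        using mult_le_mono2[of "Suc s" t "2 * \<rho> + 1"] state by simp
      ultimately show False using le[of t] state by linarith
    qed
    have "(\<Sum>t\<le>M. card (B (z t))) = card (\<Union>t\<le>M. B (z t))"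
    proof (rule card_UN_disjoint[symmetric])
      show "\<forall>i\<in>{..M}. finite (B (z i))" using B rz fin finite_subset by (meson atMost_iff)
      show "\<forall>i\<in>{..M}. \<forall>j\<in>{..M}. i \<noteq> j \<longrightarrow> B (z i) \<inter> B (z j) = {}"
        using dis by (metis Int_commute atMost_iff nat_neq_iff)
    qed simp
    also have "\<dots> \<le> card \<Omega>" using B rz fin by (intro card_mono) auto
    finally have s: "(\<Sum>t\<le>M. card (B (z t))) \<le> card \<Omega>" .
    have "(M + 1) * card \<Omega> = (\<Sum>t\<le>M. card \<Omega>)" by simp
    also have "\<dots> \<le> (\<Sum>t\<le>M. M * card (B (z t)))" using B rz by (intro sum_mono) auto
    also have "\<dots> = M * (\<Sum>t\<le>M. card (B (z t)))" by (simp add: sum_distrib_left)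
    also have "\<dots> \<le> M * card \<Omega>" using s by simp
    finally have "card \<Omega> = 0" by simp
    then have "\<Omega> = {}" using fin by simp
    then show False using B[OF rtranclp.rtrancl_refl] by blast
  qed
  then show ?thesis using d by blast
qed

section \<open>Path lengths in the graph of labelled edges\<close>

context large_codegree begin

lemma hole_card: assumes state: "state h" and t: "t < r" shows "card V < 3 * card {v. state (h(t := v))}"
proof -
  let ?S = "h ` ({..<r} - {t})"
  have inj: "inj_on h ({..<r} - {t})" using state_inj[OF state] by (rule inj_on_subset) auto
  have im: "h(t := v) ` {..<r} = insert v ?S" for v using t by (auto simp: image_iff)
  have "card ?S = r - 1" using card_image[OF inj] t by simp
  moreover have "?S \<subseteq> V" using state_V[OF state] by auto
  ultimately have "card V < 3 * card {v \<in> V. v \<notin> ?S \<and> insert v ?S \<in> E}" using codeg by blast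
  moreover have "{v. state (h(t := v))} \<subseteq> V" unfolding state_def im using edgeV by blast
  then have "finite {v. state (h(t := v))}" using finite_subset[OF _ finV] by blast
  then have "card {v \<in> V. v \<notin> ?S \<and> insert v ?S \<in> E} \<le> card {v. state (h(t := v))}"
    by (rule card_mono) (unfold state_def im, blast)
  ultimately show ?thesis by linarith
qed

text \<open>Freezing the values from \<open>r\<close> on makes the set finite, while it still
  contains every state connected to \<open>f\<close>.\<close>

definition state_space :: "(nat \<Rightarrow> 'a) \<Rightarrow> (nat \<Rightarrow> 'a) set" where
  "state_space f = {g. (\<forall>i<r. g i \<in> V) \<and> (\<forall>i. i \<ge> r \<longrightarrow> g i = f i)}"

lemma state_space_card: "finite (state_space f)" "card (state_space f) = card V ^ r"
proof -
  have inj: "inj_on (\<lambda>g. restrict g {..<r}) (state_space f)"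
  proof (rule inj_onI)
    fix g h assume g: "g \<in> state_space f" and h: "h \<in> state_space f" and e: "restrict g {..<r} = restrict h {..<r}"
    show "g = h"
    proof
      fix i show "g i = h i"
      proof (cases "i < r")
        case True then show ?thesis using fun_cong[OF e, of i] by simp
      next
        case False then show ?thesis using g h by (simp add: state_space_def)
      qed
    qed
  qed
  have im: "(\<lambda>g. restrict g {..<r}) ` state_space f = {..<r} \<rightarrow>\<^sub>E V"
  proof (intro equalityI subsetI)
    fix g assume g: "g \<in> {..<r} \<rightarrow>\<^sub>E V"
    let ?h = "\<lambda>i. if i < r then g i else f i"
    have "?h \<in> state_space f" using g by (auto simp: state_space_def)
    moreover have "restrict ?h {..<r} = g" using g by (auto simp: fun_eq_iff PiE_def extensional_def)
    ultimately show "g \<in> (\<lambda>g. restrict g {..<r}) ` state_space f" by (metis (no_types, lifting) image_eqI)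
  next
    fix g assume "g \<in> (\<lambda>g. restrict g {..<r}) ` state_space f"
    then show "g \<in> {..<r} \<rightarrow>\<^sub>E V" unfolding state_space_def by force
  qed
  have "bij_betw (\<lambda>g. restrict g {..<r}) (state_space f) ({..<r} \<rightarrow>\<^sub>E V)" using inj im by (simp add: bij_betw_def)
  then show "finite (state_space f)" "card (state_space f) = card V ^ r"
    using bij_betw_finite bij_betw_same_card finV by (fastforce simp: card_PiE finite_PiE)+
qed

lemma conn_state_space: assumes "state f" "conn f g" shows "g \<in> state_space f"
  using assms(2)
proof (induction rule: rtranclp_induct)
  case base show ?case using state_V[OF assms(1)] by (auto simp: state_space_def)
next
  case (step g h)
  have "state h" using step by (simp add: step_def)
  obtain i v where "i < r" "h = g(i := v)" using step by (auto simp: step_def)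
  then show ?case using step.IH state_V[OF \<open>state h\<close>] by (auto simp: state_space_def)
qed

definition near_states :: "(nat \<Rightarrow> 'a) \<Rightarrow> nat \<Rightarrow> (nat \<Rightarrow> 'a) set" where
  "near_states g t = {h. state h \<and> (\<forall>i\<ge>t. h i = g i) \<and> (step ^^ t) g h}"

lemma near_states_conn: assumes "h \<in> near_states g t" shows "conn g h"
proof -
  have "(step ^^ t) g h" using assms unfolding near_states_def by (elim CollectE conjE)
  then show ?thesis by (rule relpowp_imp_rtranclp)
qed

text \<open>Positions \<open>0\<close> to \<open>t - 1\<close> are rewritten once each in increasing
  order, with more than a third of the vertices available every time. As the state before a
  rewriting still agrees with \<open>g\<close> at position \<open>t\<close>, the result determines
  both that state and the chosen vertex, so nothing is counted twice.\<close>

lemma near_states_card: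
  assumes state: "state g" and t: "t \<le> r"
  shows "finite (near_states g t) \<and> near_states g t \<noteq> {} \<and> card V ^ t \<le> 3 ^ t * card (near_states g t)"
  using t
proof (induction t)
  case 0
  have "near_states g 0 = {g}" using state by (auto simp: near_states_def)
  then show ?case by simp
next
  case (Suc t)
  let ?B = "near_states g t" and ?N = "\<lambda>h. {v. state (h(t := v))}"
  have fin: "finite (near_states g (Suc t))"
  proof (rule finite_subset[OF _ state_space_card(1)[of g]])
    show "near_states g (Suc t) \<subseteq> state_space g"
      by (rule subsetI) (rule conn_state_space[OF state near_states_conn])
  qed
  have stB: "state h" if "h \<in> ?B" for h using that by (simp add: near_states_def)
  have sub: "(\<lambda>(h, v). h(t := v)) ` Sigma ?B ?N \<subseteq> near_states g (Suc t)"
  proof (clarify)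
    fix h v assume h: "h \<in> ?B" and v: "state (h(t := v))"
    have swappable': "t < r" using Suc.prems by simp
    have "step h (h(t := v))" unfolding step_def using stB[OF h] v swappable' by blast
    moreover have "(step ^^ t) g h" using h unfolding near_states_def by (elim CollectE conjE)
    ultimately have "(step ^^ Suc t) g (h(t := v))" by (intro relpowp_Suc_I)
    moreover have "\<forall>i\<ge>Suc t. (h(t := v)) i = g i" using h by (auto simp: near_states_def)
    ultimately show "h(t := v) \<in> near_states g (Suc t)" using v unfolding near_states_def by blast
  qed
  have inj: "inj_on (\<lambda>(h, v). h(t := v)) (Sigma ?B ?N)"
  proof (rule inj_onI, clarify)
    fix h v h' v' assume h: "h \<in> ?B" "h' \<in> ?B" and e: "h(t := v) = h'(t := v')"
    have "h i = h' i" for i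
    proof (cases "i = t")
      case True then show ?thesis using h by (auto simp: near_states_def)
    next
      case False then show ?thesis using fun_cong[OF e, of i] by simp
    qed
    moreover have "v = v'" using fun_cong[OF e, of t] by simp
    ultimately show "h = h' \<and> v = v'" by auto
  qed
  have N: "card V < 3 * card (?N h)" if "h \<in> ?B" for h using hole_card[OF stB[OF that]] Suc.prems by simp
  have finN: "finite (?N h)" if "h \<in> ?B" for h
    using N[OF that] by (metis card.infinite mult_0_right not_less_zero)
  have IH: "finite ?B" "?B \<noteq> {}" "card V ^ t \<le> 3 ^ t * card ?B" using Suc by auto
  have "card V ^ Suc t \<le> card V * (3 ^ t * card ?B)" using IH(3) by simp
  also have "\<dots> = 3 ^ t * (\<Sum>h\<in>?B. card V)" by simp
  also have "\<dots> \<le> 3 ^ t * (\<Sum>h\<in>?B. 3 * card (?N h))"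
    using N by (intro mult_le_mono2 sum_mono) (auto intro: less_imp_le)
  also have "\<dots> = 3 ^ Suc t * card (Sigma ?B ?N)" using IH finN by (simp add: sum_distrib_left[symmetric])
  also have "card (Sigma ?B ?N) \<le> card (near_states g (Suc t))"
    using card_inj_on_le[OF inj sub fin] .
  finally have c: "card V ^ Suc t \<le> 3 ^ Suc t * card (near_states g (Suc t))" by simp
  moreover have "card V ^ Suc t > 0" using big r3 by simp
  ultimately have "near_states g (Suc t) \<noteq> {}" by (metis card.empty mult_0_right not_less)
  then show ?case using c fin by blast
qed

text \<open>The value of \<open>D\<close> comes from \<open>short_path\<close> with radius
  \<open>r\<close>, the number of positions to rewrite, and density \<open>1 / 3 ^ r\<close>, the
  share of \<open>state_space f\<close> that \<open>near_states\<close> occupies.\<close>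

lemma conn_path:
  assumes state: "state f" and c: "conn f g" and D: "D = (2 * r + 1) * 3 ^ r"
  shows "\<exists>F. F 0 = f \<and> F D = g \<and> (\<forall>i<D. step (F i) (F (Suc i)))"
proof -
  have "\<exists>d\<le>(2 * r + 1) * 3 ^ r. (step ^^ d) f g"
  proof (rule short_path[where \<Omega> = "state_space f" and B = "\<lambda>g. near_states g r", OF step_sym state_space_card(1) _ _ c])
    fix x assume x: "conn f x"
    have sx: "state x" using state_conn[OF x state] .
    have "near_states x r \<subseteq> state_space f"
      by (rule subsetI) (rule conn_state_space[OF state conn_trans[OF x near_states_conn]])
    then show "near_states x r \<subseteq> state_space f \<and> near_states x r \<noteq> {} \<and> card (state_space f) \<le> 3 ^ r * card (near_states x r)"
      using near_states_card[OF sx order_refl] state_space_card(2) by simp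
  next
    fix x y assume "y \<in> near_states x r"
    then show "\<exists>k\<le>r. (step ^^ k) x y" by (auto simp: near_states_def)
  qed
  then obtain d where d: "d \<le> D" "(step ^^ d) f g" using D by blast
  have "state g" using state_conn[OF c state] .
  \<comment> \<open>Replacing a vertex by itself counts as a step, so a shorter path can be padded
    to length exactly \<open>D\<close>.\<close>
  moreover have "g = g(0 := g 0)" "0 < r" using r3 by auto
  ultimately have "step g g" unfolding step_def by blast
  then have "(step ^^ n) g g" for n by (induction n) auto
  then have "(step ^^ (d + (D - d))) f g" using d unfolding relpowp_add by blast
  then have "(step ^^ D) f g" using d by simp
  then show ?thesis unfolding relpowp_fun_conv by blast
qed

text \<open>The states are written out one after the other, \<open>r\<close> vertices each, with the
  last one repeated. A window starting at offset \<open>s\<close> reads the positions from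
  \<open>s\<close> on in one state and those below \<open>s\<close> in the next. These states differ
  in one position \<open>p\<close>, so the window shows the later state if \<open>p < s\<close> and
  the earlier one otherwise. At the end, \<open>r dvd l + c\<close> makes the rotation by
  \<open>c\<close> compensate for the residue of \<open>l\<close>.\<close>

lemma closed_walk:
  assumes F: "\<And>i. i < D \<Longrightarrow> step (F i) (F (Suc i))" and state: "state (F 0)"
    and FD: "\<And>i. i < r \<Longrightarrow> F D i = F 0 ((i + c) mod r)"
    and l: "(D + 1) * r \<le> l" "r dvd l + c"
  shows "\<exists>w. \<forall>i<l. (\<lambda>j. w ((i + j) mod l)) ` {..<r} \<in> E"
proof -
  have r0: "0 < r" using r3 by simp
  define u where "u t = F (min (t div r) D) (t mod r)" for t
  have stF: "state (F q)" if "q \<le> D" for q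
    using that
  proof (induction q)
    case (Suc q) then show ?case using F[of q] by (auto simp: step_def)
  qed (rule state)
  have window: "\<exists>G. state G \<and> (\<forall>j<r. u (i + j) = G ((i + j) mod r))" for i
  proof -
    define q s where "q = i div r" and "s = i mod r"
    have i: "i = q * r + s" "s < r" using r0 by (auto simp: q_def s_def)
    have lo: "(i + j) div r = q \<and> (i + j) mod r = s + j" if "s + j < r" for j
      using that r0 unfolding i(1) by (simp add: add.assoc)
    have hi: "(i + j) div r = Suc q \<and> (i + j) mod r = s + j - r" if "\<not> s + j < r" "j < r" for j
    proof -
      have e: "i + j = Suc q * r + (s + j - r)" using that i by simp
      have "s + j - r < r" using that i(2) by simp
      then show ?thesis unfolding e by (metis Euclidean_Rings.div_eq_0_iff add.commute add_0 div_mult_self1_is_m div_mult_self3 mod_less mod_mult_self3 r0 less_irrefl)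
    qed
    show ?thesis
    proof (cases "q < D")
      case False
      have "u (i + j) = F D ((i + j) mod r)" for j
      proof -
        have "q \<le> (i + j) div r" unfolding q_def by (rule div_le_mono) simp
        then show ?thesis using False by (simp add: u_def min_absorb2)
      qed
      then show ?thesis using stF[of D] by blast
    next
      case True
      obtain p v where p: "p < r" "F (Suc q) = (F q)(p := v)" using F[OF True] by (auto simp: step_def)
      show ?thesis
      proof (cases "p < s")
        case ps: True
        have "u (i + j) = F (Suc q) ((i + j) mod r)" if "j < r" for j
          using lo[of j] hi[OF _ that] True ps p by (cases "s + j < r") (auto simp: u_def min_absorb1)
        then show ?thesis using stF[of "Suc q"] True by auto
      next
        case ps: False
        have "u (i + j) = F q ((i + j) mod r)" if "j < r" for j
          using lo[of j] hi[OF _ that] True ps p that i(2) by (cases "s + j < r") (auto simp: u_def min_absorb1)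
        then show ?thesis using stF[of q] True by auto
      qed
    qed
  qed
  have wrap: "u ((i + j) mod l) = u (i + j)" if ij: "i < l" "j < r" for i j
  proof (cases "i + j < l")
    case False
    have rl: "r \<le> l" using l(1) by simp
    define t where "t = i + j - l"
    have t: "i + j = l + t" "t < r" using False ij by (auto simp: t_def)
    have "u t = F 0 t" using t(2) by (simp add: u_def)
    moreover have "(i + j) mod l = t" using t rl by simp
    moreover have "u (i + j) = F 0 t"
    proof -
      \<comment> \<open>The length is large enough that every index from \<open>l\<close> on falls
        into the part where only \<open>F D\<close> is read.\<close>
      have "(D + 1) * r div r \<le> (i + j) div r" using l(1) t(1) by (intro div_le_mono) linarith
      then have "D \<le> (i + j) div r" using r0 by simp
      then have "u (i + j) = F D ((i + j) mod r)" by (simp add: u_def min_absorb2)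
      also have "\<dots> = F 0 (((i + j) mod r + c) mod r)" using FD r0 by simp
      also have "((i + j) mod r + c) mod r = (l + c + t) mod r" unfolding t(1) by (metis mod_add_left_eq add.assoc add.commute)
      also have "\<dots> = t" using l(2) t(2) by (metis add.commute dvd_imp_mod_0 mod_add_self1 mod_less mod_add_right_eq add_0)
      finally show ?thesis .
    qed
    ultimately show ?thesis by simp
  qed simp
  have "(\<lambda>j. u ((i + j) mod l)) ` {..<r} \<in> E" if i: "i < l" for i
  proof -
    obtain G where G: "state G" "\<forall>j<r. u (i + j) = G ((i + j) mod r)" using window by blast
    have "(\<lambda>j. u ((i + j) mod l)) ` {..<r} = G ` ((\<lambda>j. (i + j) mod r) ` {..<r})"
      unfolding image_image using wrap[OF i] G(2) by (intro image_cong) auto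
    also have "(\<lambda>j. (i + j) mod r) ` {..<r} = {..<r}"
    proof (rule endo_inj_surj)
      show "inj_on (\<lambda>j. (i + j) mod r) {..<r}"
      proof (rule inj_onI)
        fix x y assume "x \<in> {..<r}" "y \<in> {..<r}" "(i + x) mod r = (i + y) mod r"
        then show "x = y" by (metis cong_def cong_add_lcancel_nat cong_less_modulus_unique_nat lessThan_iff)
      qed
    qed (use r0 in auto)
    finally show ?thesis using G(1) by (simp add: state_def)
  qed
  then show ?thesis by blast
qed

end

section \<open>The rotation as a permutation of the positions\<close>

definition shift :: "nat \<Rightarrow> nat \<Rightarrow> nat \<Rightarrow> nat" where
  "shift r c i = (if i < r then (i + c) mod r else i)"

lemma shift_permutes: "shift r c permutes {..<r}"
proof (rule bij_imp_permutes)
  have "inj_on (shift r c) {..<r}"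
  proof (rule inj_onI)
    fix x y assume xy: "x \<in> {..<r}" "y \<in> {..<r}" "shift r c x = shift r c y"
    then have "[x + c = y + c] (mod r)" by (simp add: shift_def cong_def)
    then show "x = y" using xy by (simp add: cong_add_rcancel_nat cong_less_modulus_unique_nat)
  qed
  moreover have "shift r c ` {..<r} \<subseteq> {..<r}" by (auto simp: shift_def)
  ultimately show "bij_betw (shift r c) {..<r} {..<r}" by (simp add: bij_betw_def endo_inj_surj)
qed (simp add: shift_def)

lemma shift_funpow: "i < r \<Longrightarrow> (shift r c ^^ n) i = (i + n * c) mod r"
proof (induction n)
  case (Suc n)
  then have "(shift r c ^^ Suc n) i = ((i + n * c) mod r + c) mod r"
    by (simp add: shift_def[of r c "(i + n * c) mod r"])
  also have "\<dots> = (i + n * c + c) mod r" by (rule mod_add_left_eq)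
  finally show ?case by (simp add: algebra_simps)
qed simp

lemma evenperm_funpow: assumes "permutation p" shows "evenperm (p ^^ n) \<longleftrightarrow> even n \<or> evenperm p"
proof (induction n)
  case (Suc n)
  have "permutation (p ^^ n)"
  proof (induction n)
    case (Suc n) show ?case unfolding funpow.simps by (rule permutation_compose[OF assms Suc.IH])
  qed simp
  then have "evenperm (p ^^ Suc n) \<longleftrightarrow> evenperm p = evenperm (p ^^ n)"
    unfolding funpow.simps by (rule evenperm_comp[OF assms])
  then show ?case using Suc.IH unfolding even_Suc by blast
qed simp

text \<open>An odd power of the shift is the identity.\<close>
lemma evenperm_shift: assumes "odd (r div gcd r c)" shows "evenperm (shift r c)"
proof -
  let ?m = "r div gcd r c"
  have "?m * c = r * (c div gcd r c)" by (metis div_mult_swap dvd_div_mult gcd_dvd1 gcd_dvd2)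
  then have "(i + ?m * c) mod r = i" if "i < r" for i using that by simp
  then have "(shift r c ^^ ?m) i = i" for i
  proof (cases "i < r")
    case False
    then have "(shift r c ^^ n) i = i" for n by (induction n) (auto simp: shift_def)
    then show ?thesis .
  qed (simp add: shift_funpow)
  then have "shift r c ^^ ?m = id" by auto
  moreover have "permutation (shift r c)" using shift_permutes by (auto simp: permutation_permutes)
  ultimately show ?thesis using evenperm_funpow[of "shift r c" ?m] assms by (metis evenperm_id)
qed

lemma card_multiples: assumes "0 < g" shows "card {i. i < g * m \<and> g dvd i} = m"
proof -
  have "{i. i < g * m \<and> g dvd i} = (\<lambda>j. g * j) ` {..<m}" using assms by (auto simp: dvd_def)
  moreover have "inj_on (\<lambda>j. g * j) {..<m}" using assms by (auto simp: inj_on_def)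
  ultimately show ?thesis by (simp add: card_image)
qed

context large_codegree begin

theorem closed_walk_exists:
  assumes o: "odd (r div gcd r c)" and l: "((2 * r + 1) * 3 ^ r + 1) * r \<le> l" "r dvd l + c"
  shows "\<exists>w. \<forall>i<l. (\<lambda>j. w ((i + j) mod l)) ` {..<r} \<in> E"
proof -
  let ?g = "gcd r c"
  \<comment> \<open>This is the orbit of position \<open>0\<close> under the shift; its size is the
    odd number \<open>r div gcd r c\<close>.\<close>
  define P where "P = {i. i < r \<and> ?g dvd i}"
  have g: "0 < ?g" "?g * (r div ?g) = r" using r3 by auto
  have cP: "card P = r div ?g" using card_multiples[OF g(1), of "r div ?g"] g(2) by (simp add: P_def)
  have inv: "shift r c i \<in> P \<longleftrightarrow> i \<in> P" if "i < r" for i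
  proof -
    have "?g dvd (i + c) mod r \<longleftrightarrow> ?g dvd i + c" by (simp add: dvd_mod_iff)
    also have "\<dots> \<longleftrightarrow> ?g dvd i" by (simp add: dvd_add_left_iff)
    finally show ?thesis using that by (simp add: P_def shift_def)
  qed
  obtain f where f: "state f" "conn f (f \<circ> shift r c)"
    using exists_monodromy[OF shift_permutes evenperm_shift[OF o], of P] cP inv o by (auto simp: P_def)
  let ?D = "(2 * r + 1) * 3 ^ r"
  obtain F where F: "F 0 = f" "F ?D = f \<circ> shift r c" "\<forall>i<?D. step (F i) (F (Suc i))"
    using conn_path[OF f refl] by blast
  show ?thesis
  proof (rule closed_walk[where F = F and D = ?D and c = c, OF _ _ _ l])
    show "step (F i) (F (Suc i))" if "i < ?D" for i using F(3) that by blast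
    show "state (F 0)" using F(1) f(1) by simp
    show "F ?D i = F 0 ((i + c) mod r)" if "i < r" for i using that unfolding F(1,2) by (simp add: shift_def)
  qed
qed

end

section \<open>Random sampling and blow-ups\<close>

text \<open>Given that two prescribed coordinates coincide, one of them is redundant; overwriting it
  by an arbitrary vertex embeds such maps, paired with a vertex, into all maps.\<close>

lemma noninj_count:
  assumes fin: "finite V"
  shows "card {f \<in> {..<m} \<rightarrow>\<^sub>E V. \<not> inj_on f {..<m}} * card V \<le> m ^ 2 * card V ^ m"
proof -
  let ?P = "{..<m} \<rightarrow>\<^sub>E V"
  let ?K = "{p \<in> {..<m} \<times> {..<m}. fst p \<noteq> snd p}"
  let ?C = "\<lambda>p. {f \<in> ?P. f (fst p) = f (snd p)}"
  have finP: "finite ?P" using fin by (simp add: finite_PiE)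
  have one: "card (?C p) * card V \<le> card V ^ m" if p: "p \<in> ?K" for p
  proof -
    let ?h = "\<lambda>(f, v). f(snd p := v)"
    have "inj_on ?h (?C p \<times> V)"
    proof (rule inj_onI, clarify)
      fix f v g w assume f: "f \<in> ?P" "f (fst p) = f (snd p)" and g: "g \<in> ?P" "g (fst p) = g (snd p)"
        and e: "f(snd p := v) = g(snd p := w)"
      have ne: "fst p \<noteq> snd p" using p by simp
      have off: "f i = g i" if "i \<noteq> snd p" for i using fun_cong[OF e, of i] that by simp
      have "f i = g i" for i using off[of i] off[OF ne] f(2) g(2) by (cases "i = snd p") auto
      moreover have "v = w" using fun_cong[OF e, of "snd p"] by simp
      ultimately show "f = g \<and> v = w" by auto
    qed
    moreover have "?h ` (?C p \<times> V) \<subseteq> ?P"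
      using p by (auto simp: PiE_iff extensional_def split: if_splits)
    ultimately have "card (?C p \<times> V) \<le> card ?P" using card_inj_on_le[OF _ _ finP] by blast
    then show ?thesis by (simp add: card_cartesian_product card_PiE)
  qed
  have "{f \<in> ?P. \<not> inj_on f {..<m}} \<subseteq> (\<Union>p\<in>?K. ?C p)" by (auto simp: inj_on_def)
  then have "card {f \<in> ?P. \<not> inj_on f {..<m}} \<le> card (\<Union>p\<in>?K. ?C p)"
    using finP by (intro card_mono) auto
  also have "\<dots> \<le> (\<Sum>p\<in>?K. card (?C p))" by (intro card_UN_le) auto
  finally have "card {f \<in> ?P. \<not> inj_on f {..<m}} * card V \<le> (\<Sum>p\<in>?K. card (?C p)) * card V" by simp
  also have "\<dots> = (\<Sum>p\<in>?K. card (?C p) * card V)" by (rule sum_distrib_right)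
  also have "\<dots> \<le> (\<Sum>p\<in>?K. card V ^ m)" by (intro sum_mono one)
  also have "\<dots> = card ?K * card V ^ m" by simp
  also have "\<dots> \<le> m ^ 2 * card V ^ m"
  proof (intro mult_le_mono1)
    have "card ?K \<le> card ({..<m} \<times> {..<m})" by (intro card_mono) auto
    then show "card ?K \<le> m ^ 2" by (simp add: card_cartesian_product power2_eq_square)
  qed
  finally show ?thesis .
qed

text \<open>This is the theorem of Erdos on complete multipartite subhypergraphs of dense
  hypergraphs, phrased for sets of maps. The induction is the Kovari-Sos-Turan double count: some
  \<open>t\<close> values of the last coordinate are shared by a positive proportion of the maps on
  the other coordinates. The sides \<open>T i\<close> are not claimed to be disjoint.\<close>

lemma box_lemma:
  fixes c :: real
  assumes "0 < c"
  shows "\<exists>N0. \<forall>(V :: 'a set) R. finite V \<and> N0 \<le> card V \<and> R \<subseteq> ({..<m} \<rightarrow>\<^sub>E V) \<and> c * real (card V) ^ m \<le> real (card R)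
    \<longrightarrow> (\<exists>T. (\<forall>i<m. T i \<subseteq> V \<and> card (T i) = t) \<and> ({..<m} \<rightarrow>\<^sub>E V) \<inter> Pi {..<m} T \<subseteq> R)"
  using assms
proof (induction m arbitrary: c)
  case 0
  show ?case
  proof (intro exI[of _ 0] allI impI, elim conjE)
    fix V :: "'a set" and R assume R: "R \<subseteq> ({..<0::nat} \<rightarrow>\<^sub>E V)" "c * real (card V) ^ 0 \<le> real (card R)"
    have "card R \<noteq> 0" using R(2) 0 by auto
    then have "R \<noteq> {}" by auto
    then have "R = {\<lambda>_. undefined}" using R(1) by auto
    then show "\<exists>T. (\<forall>i<0::nat. T i \<subseteq> V \<and> card (T i) = t) \<and> ({..<0::nat} \<rightarrow>\<^sub>E V) \<inter> Pi {..<0::nat} T \<subseteq> R" by auto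
  qed
next
  case (Suc m)
  \<comment> \<open>A proportion \<open>c / 2\<close> of the partial maps admit at least a
    proportion \<open>c / 2\<close> of the vertices as extensions, hence \<open>(c / 2) ^ t\<close>
    of the \<open>t\<close>-tuples. The last halving pays for tuples that are not injective.\<close>
  define c' where "c' = (c / 2) ^ Suc t / 2"
  have c': "0 < c'" using Suc.prems by (simp add: c'_def)
  from Suc.IH[OF c'] obtain N1 where N1: "\<forall>(V :: 'a set) R. finite V \<and> N1 \<le> card V \<and> R \<subseteq> ({..<m} \<rightarrow>\<^sub>E V) \<and>
      c' * real (card V) ^ m \<le> real (card R) \<longrightarrow>
      (\<exists>T. (\<forall>i<m. T i \<subseteq> V \<and> card (T i) = t) \<and> ({..<m} \<rightarrow>\<^sub>E V) \<inter> Pi {..<m} T \<subseteq> R)" ..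
  \<comment> \<open>Beyond \<open>N2\<close> vertices, the proportion of non-injective tuples, at
    most \<open>t ^ 2\<close> over the number of vertices, is below \<open>c'\<close>.\<close>
  obtain N2 :: nat where N2: "real t ^ 2 / c' < real N2" using reals_Archimedean2 by blast
  show ?case
  proof (intro exI[of _ "max N1 (max N2 1)"] allI impI, elim conjE)
    fix V :: "'a set" and R
    assume fin: "finite V" and NV: "max N1 (max N2 1) \<le> card V" and R: "R \<subseteq> ({..<Suc m} \<rightarrow>\<^sub>E V)"
      and cR: "c * real (card V) ^ Suc m \<le> real (card R)"
    define N where "N = real (card V)"
    have N: "0 < N" "real N2 \<le> N" using NV by (auto simp: N_def)
    let ?Y = "{..<m} \<rightarrow>\<^sub>E V" and ?T = "{..<t} \<rightarrow>\<^sub>E V"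
    have finY: "finite ?Y" "finite ?T" using fin by (auto simp: finite_PiE)
    have cY: "real (card ?Y) = N ^ m" "real (card ?T) = N ^ t" by (auto simp: card_PiE N_def)
    define Nb where "Nb y = {v \<in> V. y(m := v) \<in> R}" for y
    have NbV: "Nb y \<subseteq> V" "finite (Nb y)" for y using fin by (auto simp: Nb_def)
    have "R \<subseteq> (\<lambda>(y, v). y(m := v)) ` Sigma ?Y Nb"
    proof
      fix f assume f: "f \<in> R"
      then have fP: "f \<in> {..<Suc m} \<rightarrow>\<^sub>E V" using R by blast
      have "f(m := undefined) \<in> ?Y" using fP by (auto simp: PiE_iff extensional_def)
      moreover have "f m \<in> Nb (f(m := undefined))" using f fP by (auto simp: Nb_def)
      moreover have "f = (f(m := undefined))(m := f m)" by simp
      ultimately show "f \<in> (\<lambda>(y, v). y(m := v)) ` Sigma ?Y Nb"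
        by (intro image_eqI[of _ _ "(f(m := undefined), f m)"]) auto
    qed
    then have "card R \<le> card (Sigma ?Y Nb)"
      using finY NbV by (meson surj_card_le finite_SigmaI)
    then have "card R \<le> (\<Sum>y\<in>?Y. card (Nb y))" using finY NbV by simp
    then have "real (card R) \<le> (\<Sum>y\<in>?Y. real (card (Nb y)))" by (metis of_nat_le_iff of_nat_sum)
    then have sumR: "c * N ^ Suc m \<le> (\<Sum>y\<in>?Y. real (card (Nb y)))" using cR by (simp add: N_def)
    define Y' where "Y' = {y \<in> ?Y. c * N / 2 \<le> real (card (Nb y))}"
    have Y'Y: "Y' \<subseteq> ?Y" "finite Y'" using finY by (auto simp: Y'_def)
    have "(\<Sum>y\<in>?Y. real (card (Nb y))) \<le> (\<Sum>y\<in>?Y. (if y \<in> Y' then N else 0) + c * N / 2)"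
    proof (intro sum_mono)
      fix y assume y: "y \<in> ?Y"
      have "card (Nb y) \<le> card V" using NbV fin by (simp add: card_mono)
      then have "real (card (Nb y)) \<le> N" by (simp add: N_def)
      moreover have "0 \<le> c * N / 2" using Suc.prems N by simp
      ultimately show "real (card (Nb y)) \<le> (if y \<in> Y' then N else 0) + c * N / 2" using y by (auto simp: Y'_def)
    qed
    also have "\<dots> = real (card Y') * N + N ^ m * (c * N / 2)"
      using finY Y'Y cY by (simp add: sum.distrib sum.If_cases Int_absorb1)
    finally have "c * N ^ Suc m \<le> real (card Y') * N + N ^ m * (c * N / 2)" using sumR by linarith
    then have "(c / 2 * N ^ m) * N \<le> real (card Y') * N" by (simp add: field_simps)
    then have cY': "c / 2 * N ^ m \<le> real (card Y')" using N by simp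
    let ?G = "\<lambda>\<tau>. {y \<in> ?Y. \<forall>s<t. \<tau> s \<in> Nb y}"
    \<comment> \<open>The pairs of a partial map and a \<open>t\<close>-tuple of its extensions are
      counted by tuples and by maps.\<close>
    have "(\<Sum>\<tau>\<in>?T. real (card (?G \<tau>))) = (\<Sum>\<tau>\<in>?T. \<Sum>y\<in>?G \<tau>. 1)" by simp
    also have "\<dots> = (\<Sum>y\<in>?Y. \<Sum>\<tau>\<in>{\<tau> \<in> ?T. \<forall>s<t. \<tau> s \<in> Nb y}. 1)"
      using finY by (intro sum.swap_restrict) auto
    also have "\<dots> = (\<Sum>y\<in>?Y. real (card (Nb y)) ^ t)"
    proof (intro sum.cong refl)
      fix y
      have "{\<tau> \<in> ?T. \<forall>s<t. \<tau> s \<in> Nb y} = {..<t} \<rightarrow>\<^sub>E Nb y" using NbV(1)[of y] unfolding PiE_def Pi_def by auto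
      then show "(\<Sum>\<tau>\<in>{\<tau> \<in> ?T. \<forall>s<t. \<tau> s \<in> Nb y}. 1) = real (card (Nb y)) ^ t" by (simp add: card_PiE)
    qed
    also have "\<dots> \<ge> (\<Sum>y\<in>Y'. (c * N / 2) ^ t)"
    proof -
      have "(\<Sum>y\<in>Y'. (c * N / 2) ^ t) \<le> (\<Sum>y\<in>Y'. real (card (Nb y)) ^ t)"
        using Suc.prems N by (intro sum_mono power_mono) (auto simp: Y'_def)
      also have "\<dots> \<le> (\<Sum>y\<in>?Y. real (card (Nb y)) ^ t)" using finY Y'Y by (intro sum_mono2) auto
      finally show ?thesis .
    qed
    finally have "real (card Y') * (c * N / 2) ^ t \<le> (\<Sum>\<tau>\<in>?T. real (card (?G \<tau>)))" by simp
    moreover have "c / 2 * N ^ m * (c * N / 2) ^ t \<le> real (card Y') * (c * N / 2) ^ t"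
      using cY' Suc.prems N by (intro mult_right_mono) auto
    moreover have "c / 2 * N ^ m * (c * N / 2) ^ t = 2 * c' * N ^ m * N ^ t"
      by (simp add: c'_def power_divide power_mult_distrib)
    ultimately have low: "2 * c' * N ^ m * N ^ t \<le> (\<Sum>\<tau>\<in>?T. real (card (?G \<tau>)))" by linarith
    have "\<exists>\<tau>\<in>?T. inj_on \<tau> {..<t} \<and> c' * N ^ m \<le> real (card (?G \<tau>))"
    proof (rule ccontr)
      assume n: "\<not> ?thesis"
      define J where "J = {\<tau> \<in> ?T. \<not> inj_on \<tau> {..<t}}"
      have J: "J \<subseteq> ?T" by (auto simp: J_def)
      have "(\<Sum>\<tau>\<in>?T. real (card (?G \<tau>))) \<le> (\<Sum>\<tau>\<in>?T. (if \<tau> \<in> J then N ^ m else 0) + c' * N ^ m)"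
      proof (intro sum_mono)
        fix \<tau> assume t: "\<tau> \<in> ?T"
        have "card (?G \<tau>) \<le> card ?Y" using finY by (intro card_mono) auto
        then have "real (card (?G \<tau>)) \<le> N ^ m" using cY(1) by linarith
        moreover have "0 \<le> c' * N ^ m" using c' N by simp
        ultimately show "real (card (?G \<tau>)) \<le> (if \<tau> \<in> J then N ^ m else 0) + c' * N ^ m"
          using n t by (cases "\<tau> \<in> J") (auto simp: J_def)
      qed
      also have "\<dots> = real (card J) * N ^ m + N ^ t * (c' * N ^ m)"
        using finY cY J by (simp add: sum.distrib sum.If_cases Int_absorb1)
      finally have "2 * c' * N ^ m * N ^ t \<le> real (card J) * N ^ m + N ^ t * (c' * N ^ m)" using low by linarith
      then have "(c' * N ^ t) * N ^ m \<le> real (card J) * N ^ m" by (simp add: algebra_simps)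
      then have "c' * N ^ t \<le> real (card J)" using N by simp
      then have "c' * N ^ t * N \<le> real (card J) * N" using N by simp
      also have "\<dots> \<le> real t ^ 2 * N ^ t"
        using noninj_count[OF fin, of t] unfolding N_def J_def by (metis (mono_tags, lifting) of_nat_le_iff of_nat_mult of_nat_power)
      finally have "(c' * N) * N ^ t \<le> real t ^ 2 * N ^ t" by (simp add: algebra_simps)
      then have "c' * N \<le> real t ^ 2" using N by simp
      then have "N \<le> real t ^ 2 / c'" using c' by (simp add: field_simps)
      then show False using N N2 by linarith
    qed
    then obtain \<tau> where \<tau>: "\<tau> \<in> ?T" "inj_on \<tau> {..<t}" "c' * N ^ m \<le> real (card (?G \<tau>))" by blast
    have "\<exists>T. (\<forall>i<m. T i \<subseteq> V \<and> card (T i) = t) \<and> ?Y \<inter> Pi {..<m} T \<subseteq> ?G \<tau>"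
      by (rule N1[rule_format]) (use fin NV \<tau>(3) in \<open>auto simp: N_def\<close>)
    then obtain T where T: "\<And>i. i < m \<Longrightarrow> T i \<subseteq> V \<and> card (T i) = t" "?Y \<inter> Pi {..<m} T \<subseteq> ?G \<tau>" by blast
    let ?T' = "T(m := \<tau> ` {..<t})"
    have "?T' i \<subseteq> V \<and> card (?T' i) = t" if "i < Suc m" for i
      using that T(1)[of i] \<tau> by (cases "i = m") (auto simp: card_image)
    moreover have "({..<Suc m} \<rightarrow>\<^sub>E V) \<inter> Pi {..<Suc m} ?T' \<subseteq> R"
    proof
      fix f assume f: "f \<in> ({..<Suc m} \<rightarrow>\<^sub>E V) \<inter> Pi {..<Suc m} ?T'"
      let ?y = "f(m := undefined)"
      have fP: "f i \<in> ?T' i" if "i < Suc m" for i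
        using Pi_mem[of f "{..<Suc m}" ?T' i] f that by blast
      have fT: "f i \<in> T i" if "i < m" for i using fP[of i] that by simp
      have "?y \<in> ?Y" using f by (auto simp: PiE_iff extensional_def)
      moreover have "?y \<in> Pi {..<m} T" using fT by auto
      ultimately have "?y \<in> ?Y \<inter> Pi {..<m} T" by blast
      then have y: "\<forall>s<t. \<tau> s \<in> Nb ?y" using T(2) by blast
      have "f m \<in> \<tau> ` {..<t}" using fP[of m] by simp
      then obtain s where "s < t" "f m = \<tau> s" by blast
      then have "f m \<in> Nb ?y" using y by simp
      then show "f \<in> R" by (simp add: Nb_def)
    qed
    ultimately show "\<exists>T. (\<forall>i<Suc m. T i \<subseteq> V \<and> card (T i) = t) \<and> ({..<Suc m} \<rightarrow>\<^sub>E V) \<inter> Pi {..<Suc m} T \<subseteq> R"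
      by (intro exI[of _ ?T']) blast
  qed
qed

section \<open>Concentration of codegrees in a random sample\<close>

lemma exp_minus_le: assumes "0 \<le> (x::real)" shows "exp (- x) \<le> 1 - x + x\<^sup>2 / 2"
proof -
  have pos: "0 < 1 + x + x\<^sup>2 / 2" using assms by (simp add: add_pos_nonneg)
  have "exp (- x) = 1 / exp x" by (simp add: exp_minus field_simps)
  also have "\<dots> \<le> 1 / (1 + x + x\<^sup>2 / 2)"
    using exp_lower_Taylor_quadratic[OF assms] pos by (intro divide_left_mono) auto
  also have "\<dots> \<le> 1 - x + x\<^sup>2 / 2"
  proof -
    have "(1 - x + x\<^sup>2 / 2) * (1 + x + x\<^sup>2 / 2) = 1 + (x\<^sup>2)\<^sup>2 / 4"
      by (simp add: algebra_simps power2_eq_square)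
    then have "1 \<le> (1 - x + x\<^sup>2 / 2) * (1 + x + x\<^sup>2 / 2)" by simp
    then show ?thesis using pos by (simp add: divide_le_eq)
  qed
  finally show ?thesis .
qed

text \<open>Chernoff bound for a uniformly random function that is prescribed on \<open>I\<close>.\<close>
lemma chernoff_count:
  fixes \<alpha> \<epsilon> :: real and g :: "nat \<Rightarrow> 'a"
  assumes fin: "finite V" and W: "W \<subseteq> V" "\<alpha> * card V \<le> card W" and \<alpha>: "0 \<le> \<alpha>" "\<alpha> \<le> 1" and \<epsilon>: "0 < \<epsilon>"
    and I: "I \<subseteq> {..<m}"
  defines "B \<equiv> \<lambda>i. if i \<in> I then {g i} else V"
  shows "real (card {f \<in> PiE {..<m} B. real (card {t \<in> {..<m}. t \<notin> I \<and> f t \<in> W}) < (\<alpha> - \<epsilon>) * m})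
    \<le> exp (card I - m * \<epsilon>\<^sup>2 / 2) * real (card V) ^ (m - card I)"
proof -
  let ?X = "\<lambda>f. card {t \<in> {..<m}. t \<notin> I \<and> f t \<in> W}"
  let ?bad = "{f \<in> PiE {..<m} B. real (?X f) < (\<alpha> - \<epsilon>) * m}"
  \<comment> \<open>The tilt of the exponential moment is \<open>\<epsilon>\<close> itself:
    \<open>exp_minus_le\<close> bounds the second-order loss by
    \<open>\<epsilon>\<^sup>2 / 2\<close>, half of the gain \<open>\<epsilon>\<^sup>2\<close> from
    the deviation.\<close>
  define z where "z = exp (- \<epsilon>)"
  define \<psi> where "\<psi> t v = (if t \<notin> I \<and> v \<in> W then z else 1)" for t :: nat and v
  define N where "N = real (card V)"
  have z: "0 < z" "z \<le> 1" "z \<le> 1 - \<epsilon> + \<epsilon>\<^sup>2 / 2" using \<epsilon> exp_minus_le[of \<epsilon>] by (auto simp: z_def)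
  have finB: "finite (B i)" for i using fin by (simp add: B_def)
  have finI: "finite I" using I finite_subset by blast
  have finP: "finite (PiE {..<m} B)" using finB by (simp add: finite_PiE)
  have prod: "(\<Prod>t<m. \<psi> t (f t)) = exp (- \<epsilon> * real (?X f))" for f
  proof -
    have "(\<Prod>t<m. \<psi> t (f t)) = (\<Prod>t\<in>{t \<in> {..<m}. t \<notin> I \<and> f t \<in> W}. z)"
      unfolding \<psi>_def by (rule prod.inter_filter[symmetric]) simp
    also have "\<dots> = exp (- \<epsilon>) ^ ?X f" by (simp add: z_def)
    also have "\<dots> = exp (- \<epsilon> * real (?X f))" by (simp add: exp_of_nat_mult[symmetric] mult.commute)
    finally show ?thesis .
  qed
  have factor: "(\<Sum>v\<in>B t. \<psi> t v) \<le> (if t \<in> I then 1 else N * exp (- (1 - z) * \<alpha>))" for t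
  proof (cases "t \<in> I")
    case True then show ?thesis by (simp add: B_def \<psi>_def)
  next
    case False
    have "(\<Sum>v\<in>B t. \<psi> t v) = (\<Sum>v\<in>V. if v \<in> W then z else 1)" using False by (simp add: B_def \<psi>_def)
    also have "\<dots> = z * card W + card (V - W)"
      using fin W(1) by (simp add: sum.If_cases Int_absorb1 Diff_eq)
    also have "real (card (V - W)) = N - card W"
      using W(1) fin by (simp add: card_Diff_subset finite_subset card_mono of_nat_diff N_def)
    also have "z * card W + (N - card W) = N - (1 - z) * card W" by (simp add: algebra_simps)
    also have "\<dots> \<le> N - (1 - z) * (\<alpha> * N)" using W(2) z by (simp add: N_def mult_left_mono)
    also have "\<dots> = N * (1 + (- (1 - z) * \<alpha>))" by (simp add: algebra_simps)
    also have "\<dots> \<le> N * exp (- (1 - z) * \<alpha>)" by (intro mult_left_mono exp_ge_add_one_self) (simp add: N_def)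
    finally show ?thesis using False by simp
  qed
  have "real (card ?bad) = (\<Sum>f\<in>?bad. 1)" by simp
  also have "\<dots> \<le> (\<Sum>f\<in>?bad. exp (\<epsilon> * ((\<alpha> - \<epsilon>) * m)) * (\<Prod>t<m. \<psi> t (f t)))"
  proof (intro sum_mono)
    fix f assume "f \<in> ?bad"
    then have "0 \<le> \<epsilon> * ((\<alpha> - \<epsilon>) * m - real (?X f))" using \<epsilon> by simp
    then have "1 \<le> exp (\<epsilon> * ((\<alpha> - \<epsilon>) * m - real (?X f)))" by simp
    also have "\<dots> = exp (\<epsilon> * ((\<alpha> - \<epsilon>) * m)) * exp (- \<epsilon> * real (?X f))"
      by (simp add: exp_add[symmetric] algebra_simps)
    finally show "1 \<le> exp (\<epsilon> * ((\<alpha> - \<epsilon>) * m)) * (\<Prod>t<m. \<psi> t (f t))" unfolding prod .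
  qed
  also have "\<dots> \<le> (\<Sum>f\<in>PiE {..<m} B. exp (\<epsilon> * ((\<alpha> - \<epsilon>) * m)) * (\<Prod>t<m. \<psi> t (f t)))"
    using finP by (intro sum_mono2) (auto simp: prod)
  also have "\<dots> = exp (\<epsilon> * ((\<alpha> - \<epsilon>) * m)) * (\<Prod>t<m. \<Sum>v\<in>B t. \<psi> t v)"
    using prod_sum_PiE[of "{..<m}" B \<psi>] finB by (simp add: sum_distrib_left)
  also have "(\<Prod>t<m. \<Sum>v\<in>B t. \<psi> t v) \<le> (\<Prod>t<m. if t \<in> I then 1 else N * exp (- (1 - z) * \<alpha>))"
    using factor z by (intro prod_mono) (auto simp: \<psi>_def intro!: sum_nonneg)
  also have "\<dots> = (N * exp (- (1 - z) * \<alpha>)) ^ (m - card I)"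
    using I finI by (simp add: prod.If_cases Int_absorb1 Diff_eq[symmetric] card_Diff_subset)
  also have "exp (\<epsilon> * ((\<alpha> - \<epsilon>) * m)) * (N * exp (- (1 - z) * \<alpha>)) ^ (m - card I)
    = exp (\<epsilon> * ((\<alpha> - \<epsilon>) * m) - (1 - z) * \<alpha> * real (m - card I)) * N ^ (m - card I)"
    by (simp add: power_mult_distrib exp_of_nat_mult[symmetric] exp_diff exp_minus field_simps exp_add[symmetric])
  also have "\<dots> \<le> exp (card I - m * \<epsilon>\<^sup>2 / 2) * N ^ (m - card I)"
  proof (intro mult_right_mono, subst exp_le_cancel_iff)
    have cI: "card I \<le> m" using card_mono[OF _ I] by simp
    have "(1 - z) * \<alpha> * real (m - card I) = (1 - z) * \<alpha> * m - (1 - z) * \<alpha> * card I"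
      using cI by (simp add: of_nat_diff algebra_simps)
    \<comment> \<open>The prescribed coordinates contribute nothing to the count, which costs at
      most a factor \<open>exp (card I)\<close>.\<close>
    moreover have "(1 - z) * \<alpha> * card I \<le> 1 * real (card I)"
      using z \<alpha> by (intro mult_right_mono mult_le_one) auto
    moreover have "\<epsilon> * ((\<alpha> - \<epsilon>) * m) - (1 - z) * \<alpha> * m = (\<alpha> * (\<epsilon> - 1 + z) - \<epsilon>\<^sup>2) * m"
      by (simp add: algebra_simps power2_eq_square)
    moreover have "(\<alpha> * (\<epsilon> - 1 + z) - \<epsilon>\<^sup>2) * m \<le> (- \<epsilon>\<^sup>2 / 2) * m"
    proof (intro mult_right_mono)
      have "\<alpha> * (\<epsilon> - 1 + z) \<le> \<alpha> * (\<epsilon>\<^sup>2 / 2)" using z \<alpha> by (intro mult_left_mono) auto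
      also have "\<dots> \<le> 1 * (\<epsilon>\<^sup>2 / 2)" using \<alpha> by (intro mult_right_mono) auto
      finally show "\<alpha> * (\<epsilon> - 1 + z) - \<epsilon>\<^sup>2 \<le> - \<epsilon>\<^sup>2 / 2" by simp
    qed simp
    moreover have "(- \<epsilon>\<^sup>2 / 2) * m = - (m * \<epsilon>\<^sup>2 / 2)" by simp
    moreover have "A - C \<le> i - x / 2" if "C = D - F" "F \<le> 1 * i" "A - D = Q" "Q \<le> Y" "Y = - (x / 2)"
      for A C D F Q Y i x :: real using that by linarith
    ultimately show "\<epsilon> * ((\<alpha> - \<epsilon>) * m) - (1 - z) * \<alpha> * real (m - card I) \<le> card I - m * \<epsilon>\<^sup>2 / 2"
      by blast
  qed (simp add: N_def)
  finally show ?thesis using mult_left_mono by (simp add: N_def)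
qed

lemma union_bound_small:
  fixes c :: real assumes "0 < c"
  shows "\<exists>M. \<forall>m\<ge>M. real m ^ k * exp (real k - real m * c) \<le> 1 / 4"
proof -
  have "filterlim (\<lambda>m. c * real m) at_top sequentially"
    using assms filterlim_real_sequentially by (intro filterlim_tendsto_pos_mult_at_top[OF tendsto_const]) auto
  then have "((\<lambda>m. (c * real m) ^ k / exp (c * real m)) \<longlongrightarrow> 0) sequentially"
    by (rule filterlim_compose[OF tendsto_power_div_exp_0])
  then have "((\<lambda>m. exp k / c ^ k * ((c * real m) ^ k / exp (c * real m))) \<longlongrightarrow> exp k / c ^ k * 0) sequentially"
    by (intro tendsto_intros)
  moreover have "exp k / c ^ k * ((c * real m) ^ k / exp (c * real m)) = real m ^ k * exp (real k - real m * c)" for m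
    using assms by (simp add: exp_diff power_mult_distrib mult.commute)
  ultimately have "((\<lambda>m. real m ^ k * exp (real k - real m * c)) \<longlongrightarrow> 0) sequentially" by simp
  then have "eventually (\<lambda>m. real m ^ k * exp (real k - real m * c) < 1 / 4) sequentially"
    by (rule order_tendstoD) simp
  then show ?thesis unfolding eventually_sequentially by (meson less_imp_le)
qed

text \<open>Maps are counted rather than subsets, so that the good samples form a dense set to which
  \<open>box_lemma\<close> applies. Of the half that is given away, a quarter covers non-injective
  maps, whence \<open>4 * m ^ 2\<close>, and a quarter the union bound over all \<open>I\<close>.
  The sample size depends only on \<open>\<epsilon>\<close> and \<open>k\<close>, while
  \<open>\<alpha>\<close> may vary with the hypergraph.\<close>

lemma sampling:
  fixes \<epsilon> :: real
  assumes \<epsilon>: "0 < \<epsilon>"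
  shows "\<exists>M. \<forall>m\<ge>M. \<exists>N0. \<forall>(V :: 'a set) E (\<alpha> :: real). finite V \<longrightarrow> N0 \<le> card V \<longrightarrow> 0 \<le> \<alpha> \<longrightarrow> \<alpha> \<le> 1 \<longrightarrow>
    (\<forall>S\<subseteq>V. card S = k \<longrightarrow> \<alpha> * card V \<le> card {v \<in> V. v \<notin> S \<and> insert v S \<in> E}) \<longrightarrow>
    real (card V) ^ m / 2 \<le> card {f \<in> {..<m} \<rightarrow>\<^sub>E V. inj_on f {..<m} \<and>
      (\<forall>I\<subseteq>{..<m}. card I = k \<longrightarrow> (\<alpha> - \<epsilon>) * m \<le> card {t \<in> {..<m}. t \<notin> I \<and> insert (f t) (f ` I) \<in> E})}"
proof -
  obtain M where M: "\<And>m. m \<ge> M \<Longrightarrow> real m ^ k * exp (real k - real m * (\<epsilon>\<^sup>2 / 2)) \<le> 1 / 4"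
    using union_bound_small[of "\<epsilon>\<^sup>2 / 2" k] \<epsilon> by auto
  show ?thesis
  proof (rule exI[of _ "max M k"], intro allI impI, goal_cases)
    case (1 m)
    note m = this
    show ?case
    proof (rule exI[of _ "4 * m ^ 2 + 1"], intro allI impI)
      fix V :: "'a set" and E :: "'a set set" and \<alpha> :: real
      assume fin: "finite V" and NV: "4 * m ^ 2 + 1 \<le> card V" and \<alpha>: "0 \<le> \<alpha>" "\<alpha> \<le> 1"
        and cod: "\<forall>S\<subseteq>V. card S = k \<longrightarrow> \<alpha> * card V \<le> card {v \<in> V. v \<notin> S \<and> insert v S \<in> E}"
      let ?P = "{..<m} \<rightarrow>\<^sub>E V"
      let ?X = "\<lambda>f I. card {t \<in> {..<m}. t \<notin> I \<and> insert (f t) (f ` I) \<in> E}"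
      let ?good = "{f \<in> ?P. inj_on f {..<m} \<and> (\<forall>I\<subseteq>{..<m}. card I = k \<longrightarrow> (\<alpha> - \<epsilon>) * m \<le> ?X f I)}"
      define NI where "NI = {f \<in> ?P. \<not> inj_on f {..<m}}"
      define Bad where "Bad I = {f \<in> ?P. inj_on f {..<m} \<and> real (?X f I) < (\<alpha> - \<epsilon>) * m}" for I
      define KI where "KI = {I. I \<subseteq> {..<m} \<and> card I = k}"
      define N where "N = real (card V)"
      have N: "0 < N" "4 * real m ^ 2 \<le> N" using NV by (auto simp: N_def simp flip: of_nat_power of_nat_mult) 
      have finP: "finite ?P" using fin by (simp add: finite_PiE)
      have finKI: "finite KI" unfolding KI_def by simp
      have "real (card NI) * N \<le> real m ^ 2 * N ^ m"
        using noninj_count[OF fin, of m] unfolding NI_def N_def by (metis (mono_tags, lifting) of_nat_le_iff of_nat_mult of_nat_power)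
      also have "\<dots> \<le> N / 4 * N ^ m" using N by (intro mult_right_mono) auto
      finally have NI: "real (card NI) \<le> N ^ m / 4" using N by (simp add: field_simps)
      have bad: "real (card (Bad I)) \<le> exp (real k - m * (\<epsilon>\<^sup>2 / 2)) * N ^ m" if I: "I \<in> KI" for I
      proof -
        have IJ: "I \<subseteq> {..<m}" "card I = k" "finite I" using I finite_subset by (auto simp: KI_def)
        let ?G = "{g \<in> I \<rightarrow>\<^sub>E V. inj_on g I}"
        have finG: "finite ?G" using fin IJ(3) by (simp add: finite_PiE)
        let ?B = "\<lambda>g i. if i \<in> I then {g i} else V"
        let ?W = "\<lambda>g. {v \<in> V. v \<notin> g ` I \<and> insert v (g ` I) \<in> E}"
        let ?C = "\<lambda>g. {f \<in> PiE {..<m} (?B g). real (card {t \<in> {..<m}. t \<notin> I \<and> f t \<in> ?W g}) < (\<alpha> - \<epsilon>) * m}"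
        \<comment> \<open>Once the images of \<open>I\<close> are fixed as \<open>g\<close>, the set
          to be hit is the fixed neighbourhood \<open>?W g\<close> and the other values are
          independent, as \<open>chernoff_count\<close> needs.\<close>
        have "Bad I \<subseteq> (\<Union>g\<in>?G. ?C g)"
        proof
          fix f assume f: "f \<in> Bad I"
          then have fP: "f \<in> ?P" and inj: "inj_on f {..<m}" by (auto simp: Bad_def)
          let ?g = "restrict f I"
          have g: "?g \<in> ?G" using fP inj IJ(1) by (auto simp: inj_on_def PiE_iff)
          have "f \<in> PiE {..<m} (?B ?g)" using fP by (auto simp: PiE_iff)
          moreover have "{t \<in> {..<m}. t \<notin> I \<and> f t \<in> ?W ?g} = {t \<in> {..<m}. t \<notin> I \<and> insert (f t) (f ` I) \<in> E}"
          proof -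
            have "f t \<in> V" "f t \<notin> f ` I" if "t < m" "t \<notin> I" for t
              using fP that inj_on_image_mem_iff[OF inj _ IJ(1), of t] by auto
            then show ?thesis by auto
          qed
          ultimately have "f \<in> ?C ?g" using f by (simp add: Bad_def)
          then show "f \<in> (\<Union>g\<in>?G. ?C g)" using g by blast
        qed
        moreover have finC: "finite (?C g)" for g using fin by (intro finite_subset[OF Collect_restrict] finite_PiE) auto
        ultimately have "card (Bad I) \<le> card (\<Union>g\<in>?G. ?C g)" using finG by (intro card_mono) auto
        also have "\<dots> \<le> (\<Sum>g\<in>?G. card (?C g))" by (rule card_UN_le[OF finG])
        finally have "real (card (Bad I)) \<le> real (\<Sum>g\<in>?G. card (?C g))" by (rule of_nat_mono)
        also have "\<dots> = (\<Sum>g\<in>?G. real (card (?C g)))" by (rule of_nat_sum)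
        also have "\<dots> \<le> (\<Sum>g\<in>?G. exp (card I - m * \<epsilon>\<^sup>2 / 2) * N ^ (m - card I))"
        proof (intro sum_mono)
          fix g assume g: "g \<in> ?G"
          have "g ` I \<subseteq> V" "card (g ` I) = k" using g IJ by (auto simp: card_image)
          then have "\<alpha> * card V \<le> card (?W g)" using cod by blast
          then show "real (card (?C g)) \<le> exp (card I - m * \<epsilon>\<^sup>2 / 2) * N ^ (m - card I)"
            unfolding N_def by (intro chernoff_count[OF fin _ _ \<alpha> \<epsilon> IJ(1)]) auto
        qed
        also have "\<dots> = real (card ?G) * (exp (card I - m * \<epsilon>\<^sup>2 / 2) * N ^ (m - card I))" by simp
        also have "\<dots> \<le> N ^ k * (exp (card I - m * \<epsilon>\<^sup>2 / 2) * N ^ (m - card I))"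
        proof (intro mult_right_mono)
          have "card ?G \<le> card (I \<rightarrow>\<^sub>E V)" using fin IJ(3) by (intro card_mono finite_PiE) auto
          then show "real (card ?G) \<le> N ^ k" using IJ by (simp add: card_PiE N_def flip: of_nat_power)
        qed (use N in auto)
        also have "\<dots> = exp (real k - m * (\<epsilon>\<^sup>2 / 2)) * N ^ m"
          using IJ(2) m by (simp add: power_add[symmetric])
        finally show ?thesis .
      qed
      have "card KI = m choose k" unfolding KI_def using n_subsets[of "{..<m}" k] by simp
      also have "\<dots> \<le> m ^ k" using m by (intro binomial_le_pow) simp
      finally have cKI: "real (card KI) \<le> real m ^ k" by (simp flip: of_nat_power)
      have "card (\<Union>I\<in>KI. Bad I) \<le> (\<Sum>I\<in>KI. card (Bad I))" by (rule card_UN_le[OF finKI])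
      then have "real (card (\<Union>I\<in>KI. Bad I)) \<le> real (\<Sum>I\<in>KI. card (Bad I))" by (rule of_nat_mono)
      also have "\<dots> = (\<Sum>I\<in>KI. real (card (Bad I)))" by (rule of_nat_sum)
      also have "\<dots> \<le> (\<Sum>I\<in>KI. exp (real k - m * (\<epsilon>\<^sup>2 / 2)) * N ^ m)" by (intro sum_mono bad)
      also have "\<dots> = real (card KI) * (exp (real k - m * (\<epsilon>\<^sup>2 / 2)) * N ^ m)" by simp
      also have "\<dots> \<le> real m ^ k * (exp (real k - m * (\<epsilon>\<^sup>2 / 2)) * N ^ m)" using cKI N by (intro mult_right_mono) auto
      also have "\<dots> = (real m ^ k * exp (real k - m * (\<epsilon>\<^sup>2 / 2))) * N ^ m" by simp
      also have "\<dots> \<le> 1 / 4 * N ^ m" using M[of m] m N by (intro mult_right_mono) auto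
      finally have B: "real (card (\<Union>I\<in>KI. Bad I)) \<le> N ^ m / 4" by simp
      have "?P \<subseteq> ?good \<union> (NI \<union> (\<Union>I\<in>KI. Bad I))" by (force simp: NI_def Bad_def KI_def not_le)
      moreover have "finite (?good \<union> (NI \<union> (\<Union>I\<in>KI. Bad I)))" by (rule finite_subset[OF _ finP]) (auto simp: NI_def Bad_def)
      ultimately have "card ?P \<le> card (?good \<union> (NI \<union> (\<Union>I\<in>KI. Bad I)))" by (intro card_mono)
      also have "\<dots> \<le> card ?good + (card NI + card (\<Union>I\<in>KI. Bad I))"
        using card_Un_le[of ?good "NI \<union> (\<Union>I\<in>KI. Bad I)"] card_Un_le[of NI "\<Union>I\<in>KI. Bad I"] by linarith
      finally have "N ^ m \<le> real (card ?good) + (real (card NI) + real (card (\<Union>I\<in>KI. Bad I)))"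
        by (simp add: card_PiE N_def flip: of_nat_power of_nat_add)
      then show "real (card V) ^ m / 2 \<le> card ?good" using NI B unfolding N_def by linarith
    qed
  qed
qed

section \<open>The codegree Turan density\<close>

lemma codegree_eq_neighbours:
  assumes "r_graph r H" "S \<subseteq> verts H" "card S = r - 1" "1 \<le> r"
  shows "card {e \<in> edges H. S \<subseteq> e} = card {v \<in> verts H. v \<notin> S \<and> insert v S \<in> edges H}"
proof -
  have fin: "finite S" using assms finite_subset by (auto simp: r_graph_def)
  let ?f = "\<lambda>v. insert v S"
  let ?N = "{v \<in> verts H. v \<notin> S \<and> insert v S \<in> edges H}"
  have "{e \<in> edges H. S \<subseteq> e} = ?f ` ?N"
  proof (intro equalityI subsetI)
    fix e assume e: "e \<in> {e \<in> edges H. S \<subseteq> e}"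
    then have eH: "e \<subseteq> verts H" "card e = r" using assms(1) by (auto simp: r_graph_def)
    have "card (e - S) = 1" using card_Diff_subset[OF fin, of e] e eH assms by auto
    then obtain v where "e - S = {v}" by (rule card_1_singletonE)
    then have "e = insert v S" "v \<notin> S" "v \<in> verts H" using e eH by auto
    then show "e \<in> ?f ` ?N" using e by blast
  qed auto
  moreover have "inj_on ?f ?N" by (auto simp: inj_on_def)
  ultimately show ?thesis by (simp add: card_image)
qed

lemma codegree_set_finite:
  assumes "finite (verts H)" shows "finite {card {e \<in> edges H. S \<subseteq> e} | S. S \<subseteq> verts H \<and> card S = r - 1}"
  by (rule finite_subset[of _ "(\<lambda>S. card {e \<in> edges H. S \<subseteq> e}) ` Pow (verts H)"]) (use assms in auto)

lemma min_codegree_le: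
  assumes "r_graph r H" "S \<subseteq> verts H" "card S = r - 1" "1 \<le> r"
  shows "min_codegree r H \<le> card {v \<in> verts H. v \<notin> S \<and> insert v S \<in> edges H}"
proof -
  have "finite (verts H)" using assms by (simp add: r_graph_def)
  then have "min_codegree r H \<le> card {e \<in> edges H. S \<subseteq> e}"
    unfolding min_codegree_def using assms by (intro Min_le codegree_set_finite) auto
  then show ?thesis using codegree_eq_neighbours[OF assms] by simp
qed

lemma min_codegree_attained:
  assumes "r_graph r H" "r - 1 \<le> card (verts H)" "1 \<le> r"
  shows "\<exists>S\<subseteq>verts H. card S = r - 1 \<and> min_codegree r H = card {v \<in> verts H. v \<notin> S \<and> insert v S \<in> edges H}"
proof -
  let ?A = "{card {e \<in> edges H. S \<subseteq> e} | S. S \<subseteq> verts H \<and> card S = r - 1}"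
  have "finite (verts H)" using assms by (simp add: r_graph_def)
  then have fin: "finite ?A" by (rule codegree_set_finite)
  obtain S0 where "S0 \<subseteq> verts H" "card S0 = r - 1" using obtain_subset_with_card_n[OF assms(2)] by blast
  then have "?A \<noteq> {}" by blast
  then have "min_codegree r H \<in> ?A" unfolding min_codegree_def using Min_in[OF fin] by blast
  then show ?thesis using codegree_eq_neighbours[OF assms(1) _ _ assms(3)] by auto
qed

lemma min_codegree_le_card:
  assumes "r_graph r H" "r - 1 \<le> card (verts H)" "1 \<le> r"
  shows "min_codegree r H \<le> card (verts H)"
proof -
  have "finite (verts H)" using assms by (simp add: r_graph_def)
  then have "card {v \<in> verts H. v \<notin> S \<and> insert v S \<in> edges H} \<le> card (verts H)" for S by (intro card_mono) auto
  then show ?thesis using min_codegree_attained[OF assms] by metis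
qed

text \<open>The maximum is meaningful because the values are bounded by \<open>n\<close> and, as
  \<open>F\<close> has an edge, the edgeless hypergraph is a competitor.\<close>

lemma codegree_ex_facts:
  assumes r: "1 \<le> r" "r \<le> n" and F: "edges F \<noteq> {}"
  shows "\<exists>H :: nat hypergraph. r_graph r H \<and> card (verts H) = n \<and> \<not> contains_subgraph H F \<and> codegree_ex r n {F} = min_codegree r H"
    and "\<And>H :: nat hypergraph. r_graph r H \<Longrightarrow> card (verts H) = n \<Longrightarrow> \<not> contains_subgraph H F \<Longrightarrow> min_codegree r H \<le> codegree_ex r n {F}"
    and "codegree_ex r n {F} \<le> n"
proof -
  define A where "A = {min_codegree r H | H :: nat hypergraph. r_graph r H \<and> card (verts H) = n \<and> (\<forall>F\<in>{F}. \<not> contains_subgraph H F)}"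
  have le: "d \<le> n" if d: "d \<in> A" for d
  proof -
    obtain H :: "nat hypergraph" where H: "d = min_codegree r H" "r_graph r H" "card (verts H) = n" using d unfolding A_def by blast
    have "r - 1 \<le> card (verts H)" using r H(3) by simp
    then show ?thesis using min_codegree_le_card[OF H(2) _ r(1)] H by simp
  qed
  then have "A \<subseteq> {..n}" by blast
  then have fin: "finite A" using finite_subset by blast
  have "r_graph r ({..<n}, {} :: nat set set)" "\<not> contains_subgraph ({..<n}, {} :: nat set set) F"
    using F by (auto simp: r_graph_def contains_subgraph_def)
  moreover have "card (verts ({..<n}, {} :: nat set set)) = n" by simp
  ultimately have "min_codegree r ({..<n}, {} :: nat set set) \<in> A" unfolding A_def by blast
  then have "A \<noteq> {}" by blast
  have ex: "codegree_ex r n {F} = Max A" unfolding codegree_ex_def A_def ..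
  have mem: "codegree_ex r n {F} \<in> A" unfolding ex by (rule Max_in[OF fin \<open>A \<noteq> {}\<close>])
  then show "\<exists>H :: nat hypergraph. r_graph r H \<and> card (verts H) = n \<and> \<not> contains_subgraph H F \<and> codegree_ex r n {F} = min_codegree r H"
    unfolding A_def by blast
  show "codegree_ex r n {F} \<le> n" using le[OF mem] .
  show "min_codegree r H \<le> codegree_ex r n {F}"
    if "r_graph r H" "card (verts H) = n" "\<not> contains_subgraph H F" for H :: "nat hypergraph"
  proof -
    have "min_codegree r H \<in> A" unfolding A_def using that by blast
    then show ?thesis unfolding ex by (rule Max_ge[OF fin])
  qed
qed

section \<open>Hypergraphs pulled back to a sample\<close>

definition pullback :: "nat \<Rightarrow> (nat \<Rightarrow> 'a) \<Rightarrow> 'a set set \<Rightarrow> nat hypergraph" where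
  "pullback m f E = ({..<m}, {e. e \<subseteq> {..<m} \<and> f ` e \<in> E})"

lemma pullback_neighbours:
  assumes "I \<subseteq> {..<m}"
  shows "{t \<in> verts (pullback m f E). t \<notin> I \<and> insert t I \<in> edges (pullback m f E)} =
    {t \<in> {..<m}. t \<notin> I \<and> insert (f t) (f ` I) \<in> E}"
  using assms by (auto simp: pullback_def)

lemma pullback_r_graph:
  assumes "r_graph r H" "inj_on f {..<m}" shows "r_graph r (pullback m f (edges H))"
proof -
  have "card e = r" if "e \<subseteq> {..<m}" "f ` e \<in> edges H" for e
    using that assms card_image[OF inj_on_subset[OF assms(2) that(1)]] by (auto simp: r_graph_def)
  then show ?thesis by (auto simp: r_graph_def pullback_def)
qed

lemma pullback_contains:
  assumes "contains_subgraph (pullback m f (edges H)) F" "inj_on f {..<m}" "f ` {..<m} \<subseteq> verts H"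
  shows "contains_subgraph H F"
proof -
  obtain \<phi> where \<phi>: "inj_on \<phi> (verts F)" "\<phi> ` verts F \<subseteq> {..<m}" "\<And>e. e \<in> edges F \<Longrightarrow> f ` (\<phi> ` e) \<in> edges H"
    using assms(1) by (auto simp: contains_subgraph_def pullback_def)
  have "inj_on (f \<circ> \<phi>) (verts F)" using \<phi> assms(2) by (meson comp_inj_on inj_on_subset)
  moreover have "(f \<circ> \<phi>) ` verts F \<subseteq> verts H" using \<phi>(2) assms(3) by auto
  moreover have "\<forall>e\<in>edges F. (f \<circ> \<phi>) ` e \<in> edges H" using \<phi>(3) by (metis image_comp)
  ultimately show ?thesis unfolding contains_subgraph_def by blast
qed

text \<open>A single good sample of an extremal hypergraph is enough: it remains free of
  \<open>F\<close> and loses at most \<open>\<epsilon>\<close> in relative codegree, so it competes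
  for the maximum on \<open>m\<close> vertices.\<close>

lemma codegree_ex_almost_decreasing:
  fixes \<epsilon> :: real
  assumes r: "1 \<le> r" and F: "edges F \<noteq> {}" and \<epsilon>: "0 < \<epsilon>"
  shows "\<exists>M. \<forall>m\<ge>M. \<exists>N. \<forall>n\<ge>N. codegree_ex r n {F} / n - \<epsilon> \<le> codegree_ex r m {F} / m"
proof -
  from sampling[OF \<epsilon>, where ?'a = nat and k = "r - 1"]
  obtain M where M: "\<forall>m\<ge>M. \<exists>N0. \<forall>(V :: nat set) E (\<alpha> :: real). finite V \<longrightarrow> N0 \<le> card V \<longrightarrow> 0 \<le> \<alpha> \<longrightarrow> \<alpha> \<le> 1 \<longrightarrow>
    (\<forall>S\<subseteq>V. card S = r - 1 \<longrightarrow> \<alpha> * card V \<le> card {v \<in> V. v \<notin> S \<and> insert v S \<in> E}) \<longrightarrow>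
    real (card V) ^ m / 2 \<le> card {f \<in> {..<m} \<rightarrow>\<^sub>E V. inj_on f {..<m} \<and>
      (\<forall>I\<subseteq>{..<m}. card I = r - 1 \<longrightarrow> (\<alpha> - \<epsilon>) * m \<le> card {t \<in> {..<m}. t \<notin> I \<and> insert (f t) (f ` I) \<in> E})}" ..
  show ?thesis
  proof (rule exI[of _ "max M r"], intro allI impI)
    fix m assume m: "max M r \<le> m"
    then have "M \<le> m" by simp
    from M[rule_format, OF this] obtain N0 where N0: "\<forall>(V :: nat set) E (\<alpha> :: real). finite V \<longrightarrow> N0 \<le> card V \<longrightarrow> 0 \<le> \<alpha> \<longrightarrow> \<alpha> \<le> 1 \<longrightarrow>
      (\<forall>S\<subseteq>V. card S = r - 1 \<longrightarrow> \<alpha> * card V \<le> card {v \<in> V. v \<notin> S \<and> insert v S \<in> E}) \<longrightarrow>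
      real (card V) ^ m / 2 \<le> card {f \<in> {..<m} \<rightarrow>\<^sub>E V. inj_on f {..<m} \<and>
        (\<forall>I\<subseteq>{..<m}. card I = r - 1 \<longrightarrow> (\<alpha> - \<epsilon>) * m \<le> card {t \<in> {..<m}. t \<notin> I \<and> insert (f t) (f ` I) \<in> E})}" ..
    show "\<exists>N. \<forall>n\<ge>N. codegree_ex r n {F} / n - \<epsilon> \<le> codegree_ex r m {F} / m"
    proof (rule exI[of _ "max N0 r"], intro allI impI)
      fix n assume n: "max N0 r \<le> n"
      have rn: "r \<le> n" "r \<le> m" "0 < real n" "0 < real m" using n m r by auto
      obtain H :: "nat hypergraph" where H: "r_graph r H" "card (verts H) = n" "\<not> contains_subgraph H F"
        "codegree_ex r n {F} = min_codegree r H"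
        using codegree_ex_facts(1)[OF r rn(1) F] by blast
      define \<alpha> where "\<alpha> = codegree_ex r n {F} / n"
      have \<alpha>: "0 \<le> \<alpha>" "\<alpha> \<le> 1" using codegree_ex_facts(3)[OF r rn(1) F] rn by (auto simp: \<alpha>_def)
      have fin: "finite (verts H)" using H(1) by (simp add: r_graph_def)
      have cod: "\<alpha> * card (verts H) \<le> card {v \<in> verts H. v \<notin> S \<and> insert v S \<in> edges H}"
        if "S \<subseteq> verts H" "card S = r - 1" for S
        using min_codegree_le[OF H(1) that r] H rn by (simp add: \<alpha>_def)
      define G where "G = {f \<in> {..<m} \<rightarrow>\<^sub>E verts H. inj_on f {..<m} \<and>
        (\<forall>I\<subseteq>{..<m}. card I = r - 1 \<longrightarrow> (\<alpha> - \<epsilon>) * m \<le> card {t \<in> {..<m}. t \<notin> I \<and> insert (f t) (f ` I) \<in> edges H})}"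
      have "N0 \<le> card (verts H)" using n H(2) by simp
      from N0[rule_format, OF fin this \<alpha> cod] have "real (card (verts H)) ^ m / 2 \<le> card G"
        unfolding G_def by blast
      moreover have "0 < real (card (verts H)) ^ m / 2" using rn H(2) by simp
      ultimately have "0 < real (card G)" by linarith
      then have "G \<noteq> {}" by auto
      then obtain f where f: "f \<in> {..<m} \<rightarrow>\<^sub>E verts H" "inj_on f {..<m}"
        and fI: "\<And>I. I \<subseteq> {..<m} \<Longrightarrow> card I = r - 1 \<Longrightarrow>
          (\<alpha> - \<epsilon>) * m \<le> card {t \<in> {..<m}. t \<notin> I \<and> insert (f t) (f ` I) \<in> edges H}" unfolding G_def by blast
      let ?H = "pullback m f (edges H)"
      have rg: "r_graph r ?H" by (rule pullback_r_graph[OF H(1) f(2)])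
      have free: "\<not> contains_subgraph ?H F" using pullback_contains[OF _ f(2)] H(3) f(1) by blast
      have cH: "card (verts ?H) = m" by (simp add: pullback_def)
      have "r - 1 \<le> card (verts ?H)" unfolding cH using rn by simp
      obtain S where S: "S \<subseteq> verts ?H" "card S = r - 1"
        "min_codegree r ?H = card {v \<in> verts ?H. v \<notin> S \<and> insert v S \<in> edges ?H}"
        using min_codegree_attained[OF rg \<open>r - 1 \<le> card (verts ?H)\<close> r] by blast
      have SI: "S \<subseteq> {..<m}" using S(1) by (simp add: pullback_def)
      have "(\<alpha> - \<epsilon>) * m \<le> min_codegree r ?H" unfolding S(3) pullback_neighbours[OF SI] by (rule fI[OF SI S(2)])
      also have "\<dots> \<le> codegree_ex r m {F}" using codegree_ex_facts(2)[OF r rn(2) F rg cH free] by simp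
      finally show "codegree_ex r n {F} / n - \<epsilon> \<le> codegree_ex r m {F} / m"
        using rn by (simp add: \<alpha>_def field_simps)
    qed
  qed
qed

text \<open>The limit is the limit superior \<open>s\<close>: by \<open>dec\<close> every late term
  is at least \<open>s\<close> up to an arbitrarily small error. Tails are taken from
  \<open>n0\<close> on, where the upper bound is available.\<close>

lemma almost_decreasing_convergent:
  fixes a :: "nat \<Rightarrow> real"
  assumes bd: "\<And>n. 0 \<le> a n" "\<And>n. n \<ge> n0 \<Longrightarrow> a n \<le> 1"
    and dec: "\<And>\<epsilon>. 0 < \<epsilon> \<Longrightarrow> \<exists>M. \<forall>m\<ge>M. \<exists>N. \<forall>n\<ge>N. a n - \<epsilon> \<le> a m"
  shows "convergent a"
proof -
  define s where "s = (INF N\<in>{n0..}. SUP n\<in>{N..}. a n)"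
  have bA: "bdd_above (a ` {N..})" if "n0 \<le> N" for N using bd(2) that by (intro bdd_aboveI[of _ 1]) auto
  have ge0: "0 \<le> (SUP n\<in>{N..}. a n)" if "n0 \<le> N" for N
    by (rule order_trans[OF bd(1)[of N] cSUP_upper[OF _ bA[OF that]]]) simp
  have bB: "bdd_below ((\<lambda>N. SUP n\<in>{N..}. a n) ` {n0..})" using ge0 by (intro bdd_belowI[of _ 0]) auto
  have "a \<longlonglongrightarrow> s"
  proof (rule LIMSEQ_I)
    fix e :: real assume e: "0 < e"
    obtain M where M: "\<And>m. m \<ge> M \<Longrightarrow> \<exists>N. \<forall>n\<ge>N. a n - e / 2 \<le> a m" using dec[of "e / 2"] e by auto
    have "(INF N\<in>{n0..}. SUP n\<in>{N..}. a n) < s + e" using e by (simp add: s_def[symmetric])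
    then have "\<exists>K\<in>{n0..}. (SUP n\<in>{K..}. a n) < s + e"
      by (subst (asm) cINF_less_iff[OF _ bB]) auto
    then obtain K where K: "n0 \<le> K" "(SUP n\<in>{K..}. a n) < s + e" by auto
    have "norm (a m - s) < e" if m: "m \<ge> max K M" for m
    proof -
      have "a m \<le> (SUP n\<in>{K..}. a n)" using m by (intro cSUP_upper bA K) auto
      then have u: "a m < s + e" using K by linarith
      obtain N where N: "\<And>n. n \<ge> N \<Longrightarrow> a n - e / 2 \<le> a m" using M[of m] m by auto
      have "s \<le> (SUP n\<in>{max n0 N..}. a n)" unfolding s_def by (rule cINF_lower[OF bB]) simp
      also have "\<dots> \<le> a m + e / 2"
      proof (rule cSUP_least)
        fix n assume "n \<in> {max n0 N..}"
        then show "a n \<le> a m + e / 2" using N[of n] by simp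
      qed simp
      finally show ?thesis using u e by simp
    qed
    then show "\<exists>no. \<forall>n\<ge>no. norm (a n - s) < e" by blast
  qed
  then show ?thesis by (rule convergentI)
qed

text \<open>The cycle vertex \<open>j\<close> goes to the \<open>j\<close>-th of the
  \<open>l\<close> vertices in \<open>T (w j)\<close>, so repeated visits of the walk to one place
  receive distinct vertices. That different sides do not interfere follows from the injectivity of
  all maps in \<open>R\<close>.\<close>

lemma blowup_contains_cycle:
  fixes H :: "'a hypergraph"
  assumes l: "0 < l" "r \<le> l" and w: "\<And>j. j < l \<Longrightarrow> w j < m"
    and T: "\<And>i. i < m \<Longrightarrow> T i \<subseteq> verts H \<and> card (T i) = l"
    and R: "({..<m} \<rightarrow>\<^sub>E verts H) \<inter> Pi {..<m} T \<subseteq> R"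
    and inj: "\<And>f. f \<in> R \<Longrightarrow> inj_on f {..<m}"
    and walk: "\<And>f i. f \<in> R \<Longrightarrow> i < l \<Longrightarrow> (\<lambda>j. f (w ((i + j) mod l))) ` {..<r} \<in> edges H"
    and winj: "\<And>i. i < l \<Longrightarrow> inj_on (\<lambda>j. w ((i + j) mod l)) {..<r}"
  shows "contains_subgraph H (tight_cycle r l)"
proof -
  have "\<exists>\<tau>. bij_betw \<tau> {..<l} (T i)" if "i < m" for i
  proof -
    have "finite (T i)" using T[OF that] l(1) by (metis card.infinite less_irrefl)
    then show ?thesis using ex_bij_betw_nat_finite[of "T i"] T[OF that] by (auto simp: atLeast0LessThan)
  qed
  then obtain \<tau> where \<tau>: "\<And>i. i < m \<Longrightarrow> bij_betw (\<tau> i) {..<l} (T i)" by metis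
  have \<tau>T: "\<tau> i j \<in> T i" if "i < m" "j < l" for i j using bij_betwE[OF \<tau>[OF that(1)]] that(2) by blast
  define \<phi> where "\<phi> j = \<tau> (w j) j" for j
  have ext: "\<exists>f\<in>R. \<forall>j\<in>K. f (w j) = \<phi> j" if K: "K \<subseteq> {..<l}" "inj_on w K" for K
  proof -
    define f where "f = (\<lambda>x\<in>{..<m}. if x \<in> w ` K then \<phi> (inv_into K w x) else \<tau> x 0)"
    have fT: "f x \<in> T x" if x: "x < m" for x
    proof (cases "x \<in> w ` K")
      case True
      then obtain j where j: "j \<in> K" "x = w j" by blast
      then have "f x = \<tau> x j" using x K by (simp add: f_def \<phi>_def)
      then show ?thesis using \<tau>T[OF x, of j] j K by auto
    next
      case False then show ?thesis using \<tau>T[OF x l(1)] x by (simp add: f_def)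
    qed
    have "f x \<in> verts H" if "x < m" for x using fT[OF that] T[OF that] by blast
    moreover have "f \<in> extensional {..<m}" by (simp add: f_def)
    ultimately have "f \<in> {..<m} \<rightarrow>\<^sub>E verts H" by (simp add: PiE_iff)
    moreover have "f \<in> Pi {..<m} T" using fT by auto
    ultimately have "f \<in> R" using R by blast
    moreover have "f (w j) = \<phi> j" if "j \<in> K" for j
    proof -
      have "w j < m" using w that K by auto
      then show ?thesis using that K by (simp add: f_def)
    qed
    ultimately show ?thesis by blast
  qed
  have "inj_on \<phi> {..<l}"
  proof (rule inj_onI)
    fix a b assume a: "a \<in> {..<l}" and b: "b \<in> {..<l}" and e: "\<phi> a = \<phi> b"
    show "a = b"
    proof (cases "w a = w b")
      case True
      then show ?thesis using e a b bij_betw_imp_inj_on[OF \<tau>[OF w[of a]]] by (auto simp: \<phi>_def inj_on_def)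
    next
      case False
      have "{a, b} \<subseteq> {..<l}" "inj_on w {a, b}" using a b False by auto
      then obtain f where f: "f \<in> R" "\<forall>j\<in>{a, b}. f (w j) = \<phi> j" using ext by blast
      then have "f (w a) = f (w b)" using e by simp
      then show ?thesis using inj_onD[OF inj[OF f(1)], of "w a" "w b"] w a b False by auto
    qed
  qed
  moreover have "\<phi> ` {..<l} \<subseteq> verts H"
  proof (rule image_subsetI)
    fix j assume "j \<in> {..<l}"
    then have j: "j < l" by simp
    show "\<phi> j \<in> verts H" unfolding \<phi>_def using \<tau>T[OF w[OF j] j] T[OF w[OF j]] by blast
  qed
  moreover have "\<phi> ` e \<in> edges H" if e: "e \<in> edges (tight_cycle r l)" for e
  proof -
    obtain i where i: "i < l" "e = {(i + j) mod l | j. j < r}" using e by (auto simp: tight_cycle_def)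
    have ei: "e = (\<lambda>j. (i + j) mod l) ` {..<r}" unfolding i(2) by auto
    have "e \<subseteq> {..<l}" using l(1) unfolding ei by auto
    moreover have "inj_on w e" using winj[OF i(1)] unfolding ei inj_on_def by blast
    ultimately obtain f where f: "f \<in> R" "\<forall>j\<in>e. f (w j) = \<phi> j" using ext by blast
    have "\<phi> ` e = (\<lambda>j. f (w j)) ` e" using f(2) by (intro image_cong) auto
    also have "\<dots> = (\<lambda>j. f (w ((i + j) mod l))) ` {..<r}" unfolding ei by (simp add: image_image)
    finally show ?thesis using walk[OF f(1) i(1)] by simp
  qed
  ultimately show ?thesis unfolding contains_subgraph_def by (intro exI[of _ \<phi>]) (auto simp: tight_cycle_def)
qed

lemma codegree_ex_upper:
  fixes \<epsilon> :: real
  assumes r3: "3 \<le> r" and o: "odd (r div gcd r c)"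
    and l: "((2 * r + 1) * 3 ^ r + 1) * r \<le> l" "r dvd l + c" and \<epsilon>: "0 < \<epsilon>"
  shows "\<exists>N. \<forall>n\<ge>N. codegree_ex r n {tight_cycle r l} \<le> (1 / 3 + \<epsilon>) * n"
proof -
  have r1: "1 \<le> r" using r3 by simp
  have rl: "r \<le> l" using l(1) by simp
  then have l0: "0 < l" using r3 by simp
  have F: "edges (tight_cycle r l) \<noteq> {}" using l0 by (auto simp: tight_cycle_def)
  have "0 < \<epsilon> / 2" using \<epsilon> by simp
  from sampling[OF this, where ?'a = nat and k = "r - 1"]
  obtain M where M: "\<forall>m\<ge>M. \<exists>N0. \<forall>(V :: nat set) E (\<alpha> :: real). finite V \<longrightarrow> N0 \<le> card V \<longrightarrow> 0 \<le> \<alpha> \<longrightarrow> \<alpha> \<le> 1 \<longrightarrow>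
    (\<forall>S\<subseteq>V. card S = r - 1 \<longrightarrow> \<alpha> * card V \<le> card {v \<in> V. v \<notin> S \<and> insert v S \<in> E}) \<longrightarrow>
    real (card V) ^ m / 2 \<le> card {f \<in> {..<m} \<rightarrow>\<^sub>E V. inj_on f {..<m} \<and>
      (\<forall>I\<subseteq>{..<m}. card I = r - 1 \<longrightarrow> (\<alpha> - \<epsilon> / 2) * m \<le> card {t \<in> {..<m}. t \<notin> I \<and> insert (f t) (f ` I) \<in> E})}" ..
  \<comment> \<open>The bound \<open>6 * r\<close> is the size demanded by
    \<open>large_codegree\<close>, which is applied to the sample and not to
    \<open>H\<close>.\<close>
  define m where "m = max M (6 * r)"
  have "M \<le> m" and m6: "6 * r \<le> m" and m0: "0 < m" using r3 by (auto simp: m_def)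
  from M[rule_format, OF \<open>M \<le> m\<close>] obtain N0 where N0: "\<forall>(V :: nat set) E (\<alpha> :: real). finite V \<longrightarrow> N0 \<le> card V \<longrightarrow> 0 \<le> \<alpha> \<longrightarrow> \<alpha> \<le> 1 \<longrightarrow>
      (\<forall>S\<subseteq>V. card S = r - 1 \<longrightarrow> \<alpha> * card V \<le> card {v \<in> V. v \<notin> S \<and> insert v S \<in> E}) \<longrightarrow>
      real (card V) ^ m / 2 \<le> card {f \<in> {..<m} \<rightarrow>\<^sub>E V. inj_on f {..<m} \<and>
        (\<forall>I\<subseteq>{..<m}. card I = r - 1 \<longrightarrow> (\<alpha> - \<epsilon> / 2) * m \<le> card {t \<in> {..<m}. t \<notin> I \<and> insert (f t) (f ` I) \<in> E})}" ..
  \<comment> \<open>At least half of all maps are good samples, and each contains one of at most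
    \<open>m ^ l\<close> closed walks, so some walk serves this proportion of all maps.\<close>
  define p where "p = 1 / (2 * real m ^ l)"
  have "0 < p" using m0 by (simp add: p_def)
  from box_lemma[OF this, where ?'a = nat and m = m and t = l]
  obtain N1 where N1: "\<forall>(V :: nat set) R. finite V \<and> N1 \<le> card V \<and> R \<subseteq> ({..<m} \<rightarrow>\<^sub>E V) \<and> p * real (card V) ^ m \<le> real (card R)
    \<longrightarrow> (\<exists>T. (\<forall>i<m. T i \<subseteq> V \<and> card (T i) = l) \<and> ({..<m} \<rightarrow>\<^sub>E V) \<inter> Pi {..<m} T \<subseteq> R)" ..
  show ?thesis
  proof (rule exI[of _ "max r (max N0 N1)"], intro allI impI, rule ccontr)
    fix n assume n: "max r (max N0 N1) \<le> n" and nle: "\<not> codegree_ex r n {tight_cycle r l} \<le> (1 / 3 + \<epsilon>) * n"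
    have rn: "r \<le> n" "0 < real n" using n r3 by auto
    obtain H :: "nat hypergraph" where H: "r_graph r H" "card (verts H) = n" "\<not> contains_subgraph H (tight_cycle r l)"
      "codegree_ex r n {tight_cycle r l} = min_codegree r H"
      using codegree_ex_facts(1)[OF r1 rn(1) F] by blast
    have fin: "finite (verts H)" using H(1) by (simp add: r_graph_def)
    define \<alpha> where "\<alpha> = 1 / 3 + \<epsilon>"
    have "\<alpha> * n < codegree_ex r n {tight_cycle r l}" using nle by (simp add: \<alpha>_def)
    also have "\<dots> \<le> real n" using codegree_ex_facts(3)[OF r1 rn(1) F] by simp
    finally have "\<alpha> * n < 1 * real n" by simp
    then have "\<alpha> < 1" using rn(2) mult_less_cancel_right_pos by blast
    then have \<alpha>: "0 \<le> \<alpha>" "\<alpha> \<le> 1" using \<epsilon> by (auto simp: \<alpha>_def)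
    have cod: "\<alpha> * card (verts H) \<le> card {v \<in> verts H. v \<notin> S \<and> insert v S \<in> edges H}"
      if "S \<subseteq> verts H" "card S = r - 1" for S
      using min_codegree_le[OF H(1) that r1] H nle by (simp add: \<alpha>_def)
    define G where "G = {f \<in> {..<m} \<rightarrow>\<^sub>E verts H. inj_on f {..<m} \<and>
      (\<forall>I\<subseteq>{..<m}. card I = r - 1 \<longrightarrow> (\<alpha> - \<epsilon> / 2) * m \<le> card {t \<in> {..<m}. t \<notin> I \<and> insert (f t) (f ` I) \<in> edges H})}"
    have "N0 \<le> card (verts H)" using n H(2) by simp
    from N0[rule_format, OF fin this \<alpha> cod] have cG: "real (card (verts H)) ^ m / 2 \<le> card G"
      unfolding G_def by blast
    have finG: "finite G" unfolding G_def using fin by (intro finite_subset[OF Collect_restrict] finite_PiE) auto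
    define Ws where "Ws = {..<l} \<rightarrow>\<^sub>E {..<m}"
    define R where "R w = {f \<in> G. \<forall>i<l. (\<lambda>j. w ((i + j) mod l)) ` {..<r} \<in> edges (pullback m f (edges H))}" for w
    have finW: "finite Ws" by (simp add: Ws_def finite_PiE)
    have "G \<subseteq> (\<Union>w\<in>Ws. R w)"
    proof
      fix f assume f: "f \<in> G"
      then have fi: "inj_on f {..<m}" by (simp add: G_def)
      let ?H = "pullback m f (edges H)"
      have rg: "r_graph r ?H" by (rule pullback_r_graph[OF H(1) fi])
      have vH: "verts ?H = {..<m}" by (simp add: pullback_def)
      interpret large_codegree r "{..<m}" "edges ?H"
      proof
        show "3 \<le> r" by (rule r3)
        show "e \<subseteq> {..<m}" "card e = r" if "e \<in> edges ?H" for e using rg that vH by (auto simp: r_graph_def)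
        show "6 * r \<le> card {..<m}" using m6 by simp
        fix S :: "nat set" assume S: "S \<subseteq> {..<m}" "card S = r - 1"
        have "(\<alpha> - \<epsilon> / 2) * m \<le> card {t \<in> {..<m}. t \<notin> S \<and> insert (f t) (f ` S) \<in> edges H}"
          using f S unfolding G_def by blast
        also have "{t \<in> {..<m}. t \<notin> S \<and> insert (f t) (f ` S) \<in> edges H} = {v \<in> {..<m}. v \<notin> S \<and> insert v S \<in> edges ?H}"
          using pullback_neighbours[OF S(1), of f "edges H"] vH by simp
        finally have "(\<alpha> - \<epsilon> / 2) * m \<le> card {v \<in> {..<m}. v \<notin> S \<and> insert v S \<in> edges ?H}" .
        \<comment> \<open>Sampling costs half of the slack; the other half keeps the codegrees
          strictly above a third.\<close>
        moreover have "real m / 3 < (\<alpha> - \<epsilon> / 2) * m" using m0 \<epsilon> by (simp add: \<alpha>_def field_simps)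
        ultimately have "real m < 3 * real (card {v \<in> {..<m}. v \<notin> S \<and> insert v S \<in> edges ?H})" by linarith
        then show "card {..<m} < 3 * card {v \<in> {..<m}. v \<notin> S \<and> insert v S \<in> edges ?H}" by simp
      qed simp
      obtain w where w: "\<forall>i<l. (\<lambda>j. w ((i + j) mod l)) ` {..<r} \<in> edges ?H"
        using closed_walk_exists[OF o l] by blast
      have "w i < m" if "i < l" for i
      proof -
        have "(\<lambda>j. w ((i + j) mod l)) ` {..<r} \<subseteq> {..<m}" using w that edgeV by blast
        moreover have "(0::nat) \<in> {..<r}" using r3 by simp
        ultimately have "w ((i + 0) mod l) \<in> {..<m}" by blast
        then show ?thesis using that by simp
      qed
      then have "restrict w {..<l} \<in> Ws" by (simp add: Ws_def)
      moreover have "f \<in> R (restrict w {..<l})"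
      proof -
        have "(\<lambda>j. restrict w {..<l} ((i + j) mod l)) = (\<lambda>j. w ((i + j) mod l))" for i using l0 by auto
        then show ?thesis using f w by (simp add: R_def)
      qed
      ultimately show "f \<in> (\<Union>w\<in>Ws. R w)" by blast
    qed
    moreover have finR: "finite (R w)" for w using finG by (simp add: R_def)
    ultimately have "card G \<le> card (\<Union>w\<in>Ws. R w)" using finW by (intro card_mono) auto
    also have "\<dots> \<le> (\<Sum>w\<in>Ws. card (R w))" by (rule card_UN_le[OF finW])
    finally have sG: "real (card G) \<le> real (\<Sum>w\<in>Ws. card (R w))" by (rule of_nat_mono)
    have cW: "real (card Ws) = real m ^ l" by (simp add: Ws_def card_PiE)
    have "\<exists>w\<in>Ws. p * real (card (verts H)) ^ m \<le> real (card (R w))"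
    proof (rule ccontr)
      assume no: "\<not> ?thesis"
      have "Ws \<noteq> {}" using m0 by (auto simp: Ws_def PiE_eq_empty_iff)
      then have "(\<Sum>w\<in>Ws. real (card (R w))) < (\<Sum>w\<in>Ws. p * real (card (verts H)) ^ m)"
        using finW no by (intro sum_strict_mono) auto
      also have "\<dots> = real m ^ l * (p * real (card (verts H)) ^ m)" using cW by simp
      also have "\<dots> = real (card (verts H)) ^ m / 2" using m0 by (simp add: p_def)
      finally show False using sG cG by simp
    qed
    then obtain w where w: "w \<in> Ws" "p * real (card (verts H)) ^ m \<le> real (card (R w))" by blast
    have "N1 \<le> card (verts H)" using n H(2) by simp
    moreover have "R w \<subseteq> {..<m} \<rightarrow>\<^sub>E verts H" unfolding R_def G_def by blast
    ultimately have "finite (verts H) \<and> N1 \<le> card (verts H) \<and> R w \<subseteq> {..<m} \<rightarrow>\<^sub>E verts H \<and>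
      p * real (card (verts H)) ^ m \<le> real (card (R w))" using fin w(2) by blast
    from N1[rule_format, OF this]
    obtain T where T: "\<forall>i<m. T i \<subseteq> verts H \<and> card (T i) = l" "({..<m} \<rightarrow>\<^sub>E verts H) \<inter> Pi {..<m} T \<subseteq> R w"
      by (elim exE conjE)
    have w1: "w j < m" if "j < l" for j using w(1) that by (auto simp: Ws_def)
    have ne: "\<exists>f. f \<in> R w"
    proof -
      have "0 < p * real (card (verts H)) ^ m" using \<open>0 < p\<close> H(2) rn by simp
      then have "card (R w) \<noteq> 0" using w(2) by linarith
      then show ?thesis by (metis card.empty ex_in_conv)
    qed
    have "contains_subgraph H (tight_cycle r l)"
    proof (rule blowup_contains_cycle[OF l0 rl w1 _ T(2)])
      show "T i \<subseteq> verts H \<and> card (T i) = l" if "i < m" for i using T(1) that by blast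
      show "inj_on f {..<m}" if "f \<in> R w" for f using that by (simp add: R_def G_def)
      show "(\<lambda>j. f (w ((i + j) mod l))) ` {..<r} \<in> edges H" if "f \<in> R w" "i < l" for f i
        using that by (auto simp: R_def pullback_def image_image)
      show "inj_on (\<lambda>j. w ((i + j) mod l)) {..<r}" if i: "i < l" for i
      proof -
        \<comment> \<open>One sample carrying the walk already shows that its windows consist of
          \<open>r\<close> distinct places, since they are edges there.\<close>
        obtain f where f: "f \<in> R w" using ne by blast
        have "inj_on f {..<m}" using f by (simp add: R_def G_def)
        from pullback_r_graph[OF H(1) this] have "card ((\<lambda>j. w ((i + j) mod l)) ` {..<r}) = r"
          using f i unfolding R_def r_graph_def by blast
        then show ?thesis by (intro eq_card_imp_inj_on) auto
      qed
    qed
    then show False using H(3) by blast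
  qed
qed

theorem theorem1:
  fixes r :: nat and k :: int
  assumes "r \<ge> 2"
    and "\<not> [k = 0] (mod int r)"
    and "odd (int r div gcd (int r) k)"
  shows "\<exists>L::nat. \<forall>l::nat. l > L \<and> [int l = k] (mod int r) \<longrightarrow>
           codegree_density r (tight_cycle r l) \<le> 1 / 3"
proof -
  \<comment> \<open>The sign is reversed because a path ending in the rotation by \<open>c\<close>
    unrolls to closed walks of length congruent to \<open>- c\<close>.\<close>
  define c where "c = nat ((- k) mod int r)"
  have ic: "int c = (- k) mod int r" using assms(1) by (simp add: c_def)
  have "gcd (int r) (int c) = gcd (int r) k" unfolding ic by (metis gcd_neg2_int gcd_red_int gcd.commute)
  then have "int (r div gcd r c) = int r div gcd (int r) k" by (simp add: zdiv_int)
  then have o: "odd (r div gcd r c)" using assms(3) by (metis even_of_nat)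
  have c0: "c \<noteq> 0"
  proof
    assume "c = 0"
    then have "int r dvd - k" using ic by (simp add: mod_eq_0_iff_dvd)
    then show False using assms(2) by (simp add: cong_0_iff)
  qed
  have cr: "c < r" using assms(1) ic by (metis of_nat_less_iff pos_mod_bound of_nat_0_less_iff less_le_trans zero_less_numeral)
  have r3: "3 \<le> r"
  proof (rule ccontr)
    assume "\<not> 3 \<le> r"
    \<comment> \<open>For graphs the only nonzero residue is \<open>1\<close>, where the quotient
      \<open>r div gcd r c\<close> is \<open>2\<close> and hence even.\<close>
    then have "r = 2" "c = 1" using assms(1) c0 cr by auto
    then show False using o by simp
  qed
  show ?thesis
  proof (intro exI[of _ "((2 * r + 1) * 3 ^ r + 1) * r"] allI impI, elim conjE)
    fix l :: nat assume l: "((2 * r + 1) * 3 ^ r + 1) * r < l" "[int l = k] (mod int r)"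
    have "[int l + int c = k + (- k)] (mod int r)"
      unfolding ic by (intro cong_add l(2)) (simp add: cong_def)
    then have "int r dvd int (l + c)" by (simp add: cong_0_iff)
    then have dvd: "r dvd l + c" by (simp only: int_dvd_int_iff)
    let ?F = "tight_cycle r l"
    have F: "edges ?F \<noteq> {}" using l(1) by (auto simp: tight_cycle_def)
    let ?a = "\<lambda>n. real (codegree_ex r n {?F}) / real n"
    have r1: "1 \<le> r" using r3 by simp
    \<comment> \<open>The operator \<open>lim\<close> yields the limit only where it exists, so
      convergence has to be established before the density can be bounded.\<close>
    have "convergent ?a"
    proof (rule almost_decreasing_convergent[of ?a r])
      show "?a n \<le> 1" if "r \<le> n" for n using codegree_ex_facts(3)[OF r1 that F] by (auto simp: divide_le_eq_1)
      show "\<exists>M. \<forall>m\<ge>M. \<exists>N. \<forall>n\<ge>N. ?a n - \<epsilon> \<le> ?a m" if "0 < \<epsilon>" for \<epsilon>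
        using codegree_ex_almost_decreasing[OF r1 F that] .
    qed simp
    then have lim: "?a \<longlonglongrightarrow> codegree_density r ?F"
      unfolding codegree_density_def codegree_density_family_def by (simp add: convergent_LIMSEQ_iff)
    show "codegree_density r ?F \<le> 1 / 3"
    proof (rule field_le_epsilon)
      fix e :: real assume e: "0 < e"
      obtain N where N: "\<And>n. n \<ge> N \<Longrightarrow> codegree_ex r n {?F} \<le> (1 / 3 + e) * n"
        using codegree_ex_upper[OF r3 o less_imp_le[OF l(1)] dvd e] by blast
      have "?a n \<le> 1 / 3 + e" if "max N 1 \<le> n" for n
        using N[of n] that by (simp add: divide_le_eq)
      then show "codegree_density r ?F \<le> 1 / 3 + e" by (intro LIMSEQ_le_const2[OF lim]) blast
    qed
  qed
qed

end
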